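(* Let $\Sigma$ be a simplicial tropical fan of dimension $d$, let $f$ be a conewise integral linear function on $\Sigma$ whose divisor $\Delta=\mathrm{div}(f)$ is reduced, and let $\widetilde\Sigma$ be the tropical modification of $\Sigma$ along $\Delta$ with respect to $f$. Assume furthermore that $\Sigma$ is div-faithful. Then there is an isomorphism $$A^\bullet(\widetilde\Sigma)\simeq A^\bullet(\Sigma)$$ between the Chow rings. Moreover, this isomorphism is compatible with the Poincaré duality for Chow rings: when $\Sigma$ is unimodular (hence so is $\widetilde\Sigma$), it identifies the degree maps $A^d(\widetilde\Sigma)\to\mathbb Z$ and $A^d(\Sigma)\to\mathbb Z$, and thus the pairings $A^k\times A^{d-k}\to\mathbb Z$.
   Context: **Fans.** $N$ is a free $\mathbb Z$-module of finite rank, $M=\mathrm{Hom}(N,\mathbb Z)$, $N_{\mathbb R}=N\otimes\mathbb R$. A rational fan $\Sigma$ in $N_{\mathbb R}$ is a non-empty finite collection of strongly convex rational polyhedral cones, closed under taking faces, any two of which meet along a common face. $|\Sigma|$ is the support, $\Sigma_k$ the set of $k$-dimensional cones; $\tau\prec\sigma$ means that $\tau$ is a face of $\sigma$; for a ray $\rho\in\Sigma_1$, $e_\rho$ is the generator of $\rho\cap N$. Put $N_\sigma=N\cap\mathrm{span}(\sigma)$, $N^\sigma=N/N_\sigma$. The star fan $\Sigma^\sigma$ is the fan in $N^\sigma_{\mathbb R}$ formed by the images of the cones of $\Sigma$ containing $\sigma$. If $\tau\prec\sigma$ has codimension one, $e^\tau_\sigma$ is the generator of $N_\sigma/N_\tau$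 lying in the image of $\sigma$, and $\mathfrak n_{\sigma/\tau}\in N_\sigma$ is any lift of it. A tropical fan of dimension $d$ is a rational fan of pure dimension $d$ with $\sum_{\sigma\in\Sigma_d,\sigma\supset\tau}e^\tau_\sigma=0$ in $N^\tau$ for every $\tau\in\Sigma_{d-1}$. Simplicial: each cone is generated by linearly independent vectors; unimodular: each cone is generated by part of a basis of $N$. **Divisors and tropical modification.** A conewise integral linear function on $\Sigma$ is a continuous $f\colon|\Sigma|\to\mathbb R$ whose restriction to each cone $\sigma$ is given by an integral linear form $f_\sigma$ on $N_\sigma$. For $\tau\in\Sigma_{d-1}$ put $\mathrm{ord}_\tau(f)=-\sum_{\sigma\in\Sigma_d,\sigma\supset\tau}f_\sigma(\mathfrak n_{\sigma/\tau})+f_\tau\bigl(\sum_{\sigma\in\Sigma_d,\sigma\supset\tau}\mathfrak n_{\sigma/\tau}\bigr)$. The divisor $\mathrm{div}(f)$ is the weight function $\tau\mapsto\mathrm{ord}_\tau(f)$; it is trivial if all weights vanish, and reduced if all non-zero weights are equal to one, in which case it is identified with the subfan $\Delta$ of $\Sigma$ of all faces of the cones $\tau$ with $\mathrm{ord}_\tau(f)=1$ ($\Delta=\emptyset$ if $\mathrm{div}(f)$ is trivial, which is allowed). The tropical modification of $\Sigma$ along $\Delta$ with respect to $f$ is the tropical fan $\widetilde\Sigma$ in $N_{\mathbb R}\times\mathbb R$, with lattice $N\times\mathbb Z$, formed by the cones $\{(x,f(x)):x\in\sigma\}$, $\sigma\in\Sigma$, and $\{(x,f(x)):x\in\delta\}+\mathbb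 R_+(0,1)$, $\delta\in\Delta$. $\Sigma$ is div-faithful if for every $\eta\in\Sigma$ and every conewise integral linear function $g$ on $\Sigma^\eta$ with $\mathrm{div}(g)$ trivial, $g$ is the restriction to $|\Sigma^\eta|$ of a linear function on $N^\eta_{\mathbb R}$. **Chow ring.** For a simplicial fan, $A^\bullet(\Sigma)=\mathbb Z[\mathrm x_\rho\mid\rho\in\Sigma_1]/(I+J)$, where $I$ is generated by the products $\mathrm x_{\rho_1}\cdots\mathrm x_{\rho_k}$ such that $\rho_1,\dots,\rho_k$ do not form a cone of $\Sigma$, and $J$ by the elements $\sum_\rho\langle m,e_\rho\rangle\mathrm x_\rho$, $m\in M$. For a unimodular tropical fan of dimension $d$, the degree map $\deg\colon A^d(\Sigma)\to\mathbb Z$ is the well-defined map sending $\prod_{\rho\prec\sigma,\dim\rho=1}\mathrm x_\rho$ to $1$ for every $\sigma\in\Sigma_d$, and the Poincaré duality for the Chow ring is the statement that the pairings $A^k(\Sigma)\times A^{d-k}(\Sigma)\to\mathbb Z$, $(\alpha,\beta)\mapsto\deg(\alpha\beta)$, are perfect.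
   Formalization: In "div-faithful", the linear function on N^η_ℝ is required to be integral on N^η; with merely real linear functions the claim fails, e.g. rays (1,0), (1,3), (-2,-3) in ℤ² with f = y/3. *)

theory Defs
  imports
    "HOL-Analysis.Analysis"
    "HOL-Library.Poly_Mapping"
    "HOL-Algebra.QuotRing"
begin

section \<open>Lattices and fans\<close>

text \<open>
  A free module \<open>N\<close> of finite rank is given as the set of integral combinations of linearly
  independent vectors in a Euclidean space; \<open>N\<^sub>\<real>\<close> is then \<open>span N\<close>. The vectors need not span
  the ambient space, so every rank, including 0, is covered.
\<close>

definition lattice_basis :: "'a::euclidean_space set \<Rightarrow> 'a set \<Rightarrow> bool" where
  "lattice_basis N B \<longleftrightarrow>
     independent B \<and> N = range (\<lambda>c::'a \<Rightarrow> int. \<Sum>b\<in>B. of_int (c b) *\<^sub>R b)"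

definition is_lattice :: "'a::euclidean_space set \<Rightarrow> bool" where
  "is_lattice N \<longleftrightarrow> (\<exists>B. lattice_basis N B)"

text \<open>The dual \<open>M = Hom(N, \<int>)\<close>; the values of its elements outside \<open>N\<close> are irrelevant.\<close>

definition dual_lattice :: "'a::euclidean_space set \<Rightarrow> ('a \<Rightarrow> int) set" where
  "dual_lattice N = {m. \<forall>x\<in>N. \<forall>y\<in>N. m (x + y) = m x + m y}"

definition rational_cone :: "'a::euclidean_space set \<Rightarrow> 'a set \<Rightarrow> bool" where
  "rational_cone N \<sigma> \<longleftrightarrow> (\<exists>S. finite S \<and> S \<subseteq> N \<and> \<sigma> = convex_cone hull S)"

definition strongly_convex :: "'a::euclidean_space set \<Rightarrow> bool" where
  "strongly_convex \<sigma> \<longleftrightarrow> \<sigma> \<inter> uminus ` \<sigma> = {0}"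

text \<open>The library counts the empty set as a face of every set; faces of cones are non-empty.\<close>

definition cone_face :: "'a::euclidean_space set \<Rightarrow> 'a set \<Rightarrow> bool" where
  "cone_face \<tau> \<sigma> \<longleftrightarrow> \<tau> face_of \<sigma> \<and> \<tau> \<noteq> {}"

definition rational_fan :: "'a::euclidean_space set \<Rightarrow> 'a set set \<Rightarrow> bool" where
  "rational_fan N \<Sigma> \<longleftrightarrow>
     finite \<Sigma> \<and> \<Sigma> \<noteq> {} \<and>
     (\<forall>\<sigma>\<in>\<Sigma>. rational_cone N \<sigma> \<and> strongly_convex \<sigma>) \<and>
     (\<forall>\<sigma>\<in>\<Sigma>. \<forall>\<tau>. cone_face \<tau> \<sigma> \<longrightarrow> \<tau> \<in> \<Sigma>) \<and>
     (\<forall>\<sigma>\<in>\<Sigma>. \<forall>\<sigma>'\<in>\<Sigma>. cone_face (\<sigma> \<inter> \<sigma>') \<sigma> \<and> cone_face (\<sigma> \<inter> \<sigma>') \<sigma>')"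

definition cones :: "'a::euclidean_space set set \<Rightarrow> nat \<Rightarrow> 'a set set" where
  "cones \<Sigma> k = {\<sigma>\<in>\<Sigma>. dim \<sigma> = k}"

text \<open>The cones of dimension \<open>d - 1\<close>; there are none if \<open>d = 0\<close>.\<close>

definition codim1_cones :: "'a::euclidean_space set set \<Rightarrow> nat \<Rightarrow> 'a set set" where
  "codim1_cones \<Sigma> d = {\<tau>\<in>\<Sigma>. dim \<tau> + 1 = d}"

definition pure_dim :: "'a::euclidean_space set set \<Rightarrow> nat \<Rightarrow> bool" where
  "pure_dim \<Sigma> d \<longleftrightarrow> (\<forall>\<sigma>\<in>\<Sigma>. (\<forall>\<sigma>'\<in>\<Sigma>. \<sigma> \<subseteq> \<sigma>' \<longrightarrow> \<sigma>' = \<sigma>) \<longrightarrow> dim \<sigma> = d)"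

definition simplicial_fan :: "'a::euclidean_space set set \<Rightarrow> bool" where
  "simplicial_fan \<Sigma> \<longleftrightarrow> (\<forall>\<sigma>\<in>\<Sigma>. \<exists>B. independent B \<and> \<sigma> = convex_cone hull B)"

definition unimodular_fan :: "'a::euclidean_space set \<Rightarrow> 'a set set \<Rightarrow> bool" where
  "unimodular_fan N \<Sigma> \<longleftrightarrow>
     (\<forall>\<sigma>\<in>\<Sigma>. \<exists>B C. B \<subseteq> C \<and> lattice_basis N C \<and> \<sigma> = convex_cone hull B)"

text \<open>The primitive vector \<open>e\<^sub>\<rho>\<close> of a ray, the generator of the monoid \<open>\<rho> \<inter> N\<close>.\<close>

definition ray_gen :: "'a::euclidean_space set \<Rightarrow> 'a set \<Rightarrow> 'a" where
  "ray_gen N \<rho> = (THE v. \<rho> \<inter> N = range (\<lambda>k::nat. of_nat k *\<^sub>R v))"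

text \<open>\<open>N\<^sub>\<sigma>\<close>\<close>

definition cone_lattice :: "'a::euclidean_space set \<Rightarrow> 'a set \<Rightarrow> 'a set" where
  "cone_lattice N \<sigma> = N \<inter> span \<sigma>"

text \<open>
  The quotient of the ambient space by \<open>span \<sigma>\<close> is modelled on the orthogonal complement of
  \<open>span \<sigma>\<close>: a coset is represented by its unique member in that complement, and \<open>quot \<sigma>\<close> is the
  quotient map. On \<open>N\<close> its kernel is \<open>N\<^sub>\<sigma>\<close>, so \<open>quot \<sigma> ` N\<close> is \<open>N\<^sup>\<sigma> = N / N\<^sub>\<sigma>\<close>, a lattice
  spanning \<open>N\<^sup>\<sigma>\<^sub>\<real>\<close>.
\<close>

definition quot :: "'a::euclidean_space set \<Rightarrow> 'a \<Rightarrow> 'a" where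
  "quot \<sigma> x = (THE y. y \<in> orthogonal_comp (span \<sigma>) \<and> x - y \<in> span \<sigma>)"

definition quot_lattice :: "'a::euclidean_space set \<Rightarrow> 'a set \<Rightarrow> 'a set" where
  "quot_lattice N \<sigma> = quot \<sigma> ` N"

definition star_fan :: "'a::euclidean_space set set \<Rightarrow> 'a set \<Rightarrow> 'a set set" where
  "star_fan \<Sigma> \<sigma> = (\<lambda>\<zeta>. quot \<sigma> ` \<zeta>) ` {\<zeta>\<in>\<Sigma>. \<sigma> \<subseteq> \<zeta>}"

text \<open>The generator \<open>e\<^sup>\<tau>\<^sub>\<sigma>\<close> of \<open>N\<^sub>\<sigma> / N\<^sub>\<tau>\<close> and a lift of it to \<open>N\<^sub>\<sigma>\<close>.\<close>

definition normal_gen :: "'a::euclidean_space set \<Rightarrow> 'a set \<Rightarrow> 'a set \<Rightarrow> 'a" where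
  "normal_gen N \<tau> \<sigma> =
     (THE v. v \<in> quot \<tau> ` \<sigma> \<and> quot \<tau> ` cone_lattice N \<sigma> = range (\<lambda>k::int. of_int k *\<^sub>R v))"

definition normal_lift :: "'a::euclidean_space set \<Rightarrow> 'a set \<Rightarrow> 'a set \<Rightarrow> 'a" where
  "normal_lift N \<tau> \<sigma> = (SOME v. v \<in> cone_lattice N \<sigma> \<and> quot \<tau> v = normal_gen N \<tau> \<sigma>)"

definition tropical_fan :: "'a::euclidean_space set \<Rightarrow> 'a set set \<Rightarrow> nat \<Rightarrow> bool" where
  "tropical_fan N \<Sigma> d \<longleftrightarrow>
     rational_fan N \<Sigma> \<and> pure_dim \<Sigma> d \<and>
     (\<forall>\<tau>\<in>codim1_cones \<Sigma> d. (\<Sum>\<sigma>\<in>{\<sigma>\<in>cones \<Sigma> d. \<tau> \<subseteq> \<sigma>}. normal_gen N \<tau> \<sigma>) = 0)"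


section \<open>Divisors and tropical modification\<close>

text \<open>
  A function on \<open>|\<Sigma>|\<close> is a function on the ambient space whose values outside \<open>\<Union>\<Sigma>\<close> are ignored.
  Linear forms on a subspace are given by linear forms on the ambient space.
\<close>

definition integral_form :: "'a::euclidean_space set \<Rightarrow> ('a \<Rightarrow> real) \<Rightarrow> bool" where
  "integral_form L l \<longleftrightarrow> linear l \<and> l ` L \<subseteq> \<int>"

definition conewise_integral_linear ::
    "'a::euclidean_space set \<Rightarrow> 'a set set \<Rightarrow> ('a \<Rightarrow> real) \<Rightarrow> bool" where
  "conewise_integral_linear N \<Sigma> f \<longleftrightarrow>
     continuous_on (\<Union>\<Sigma>) f \<and>
     (\<forall>\<sigma>\<in>\<Sigma>. \<exists>l. integral_form (cone_lattice N \<sigma>) l \<and> (\<forall>x\<in>\<sigma>. f x = l x))"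

text \<open>\<open>f\<^sub>\<sigma>\<close>, which is determined on \<open>span \<sigma>\<close>.\<close>

definition cone_form :: "('a::euclidean_space \<Rightarrow> real) \<Rightarrow> 'a set \<Rightarrow> 'a \<Rightarrow> real" where
  "cone_form f \<sigma> = (SOME l. linear l \<and> (\<forall>x\<in>\<sigma>. f x = l x))"

definition ord_div ::
    "'a::euclidean_space set \<Rightarrow> 'a set set \<Rightarrow> nat \<Rightarrow> ('a \<Rightarrow> real) \<Rightarrow> 'a set \<Rightarrow> real" where
  "ord_div N \<Sigma> d f \<tau> =
     - (\<Sum>\<sigma>\<in>{\<sigma>\<in>cones \<Sigma> d. \<tau> \<subseteq> \<sigma>}. cone_form f \<sigma> (normal_lift N \<tau> \<sigma>))
     + cone_form f \<tau> (\<Sum>\<sigma>\<in>{\<sigma>\<in>cones \<Sigma> d. \<tau> \<subseteq> \<sigma>}. normal_lift N \<tau> \<sigma>)"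

definition div_trivial ::
    "'a::euclidean_space set \<Rightarrow> 'a set set \<Rightarrow> nat \<Rightarrow> ('a \<Rightarrow> real) \<Rightarrow> bool" where
  "div_trivial N \<Sigma> d f \<longleftrightarrow> (\<forall>\<tau>\<in>codim1_cones \<Sigma> d. ord_div N \<Sigma> d f \<tau> = 0)"

definition div_reduced ::
    "'a::euclidean_space set \<Rightarrow> 'a set set \<Rightarrow> nat \<Rightarrow> ('a \<Rightarrow> real) \<Rightarrow> bool" where
  "div_reduced N \<Sigma> d f \<longleftrightarrow>
     (\<forall>\<tau>\<in>codim1_cones \<Sigma> d. ord_div N \<Sigma> d f \<tau> \<noteq> 0 \<longrightarrow> ord_div N \<Sigma> d f \<tau> = 1)"

definition div_subfan ::
    "'a::euclidean_space set \<Rightarrow> 'a set set \<Rightarrow> nat \<Rightarrow> ('a \<Rightarrow> real) \<Rightarrow> 'a set set" where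
  "div_subfan N \<Sigma> d f =
     {\<delta>. \<exists>\<tau>\<in>codim1_cones \<Sigma> d. ord_div N \<Sigma> d f \<tau> = 1 \<and> cone_face \<delta> \<tau>}"

definition trop_modification ::
    "'a::euclidean_space set set \<Rightarrow> 'a set set \<Rightarrow> ('a \<Rightarrow> real) \<Rightarrow> ('a \<times> real) set set" where
  "trop_modification \<Sigma> \<Delta> f =
     (\<lambda>\<sigma>. {(x, f x) | x. x \<in> \<sigma>}) ` \<Sigma> \<union>
     (\<lambda>\<delta>. {(x, f x) + t *\<^sub>R (0, 1) | x t. x \<in> \<delta> \<and> 0 \<le> t}) ` \<Delta>"

text \<open>
  Linear functions on \<open>N\<^sup>\<eta>\<^sub>\<real>\<close> are understood with respect to the lattice, that is, as elements of
  the dual of \<open>N\<^sup>\<eta>\<close>. If the linear function in the definition of div-faithfulness were only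
  real, there would be no isomorphism of integral Chow rings in general: for the fan in \<open>\<real>\<^sup>2\<close> with
  rays generated by \<open>(1,0)\<close>, \<open>(1,3)\<close>, \<open>(-2,-3)\<close>, lattice \<open>\<int>\<^sup>2\<close> and \<open>f(x,y) = y/3\<close>, the divisor of
  \<open>f\<close> is trivial, but the degree one part of the Chow ring is \<open>\<int> \<oplus> \<int>/3\<close> before
  and \<open>\<int>\<close> after the modification.
\<close>

definition div_faithful :: "'a::euclidean_space set \<Rightarrow> 'a set set \<Rightarrow> nat \<Rightarrow> bool" where
  "div_faithful N \<Sigma> d \<longleftrightarrow>
     (\<forall>\<eta>\<in>\<Sigma>. \<forall>g.
        conewise_integral_linear (quot_lattice N \<eta>) (star_fan \<Sigma> \<eta>) g \<and>
        div_trivial (quot_lattice N \<eta>) (star_fan \<Sigma> \<eta>) (d - dim \<eta>) g \<longrightarrow>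
        (\<exists>l. integral_form (quot_lattice N \<eta>) l \<and> (\<forall>x\<in>\<Union>(star_fan \<Sigma> \<eta>). g x = l x)))"


section \<open>Chow rings\<close>

text \<open>Integral polynomials in variables of type \<open>'v\<close>; the exponent vectors have type \<open>'v \<Rightarrow>\<^sub>0 nat\<close>.\<close>

type_synonym 'v int_mpoly = "('v \<Rightarrow>\<^sub>0 nat) \<Rightarrow>\<^sub>0 int"

definition mpoly_ring :: "'v set \<Rightarrow> 'v int_mpoly ring" where
  "mpoly_ring V =
     \<lparr>carrier = {p. \<forall>m\<in>Poly_Mapping.keys p. Poly_Mapping.keys m \<subseteq> V},
      mult = (*), one = 1, zero = 0, add = (+)\<rparr>"

definition mvar :: "'v \<Rightarrow> 'v int_mpoly" where
  "mvar v = Poly_Mapping.single (Poly_Mapping.single v 1) 1"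

definition homogeneous :: "nat \<Rightarrow> 'v int_mpoly \<Rightarrow> bool" where
  "homogeneous k p \<longleftrightarrow>
     (\<forall>m\<in>Poly_Mapping.keys p. (\<Sum>v\<in>Poly_Mapping.keys m. Poly_Mapping.lookup m v) = k)"

text \<open>The variables of the Chow ring are the rays themselves.\<close>

definition ray_ring :: "'a::euclidean_space set set \<Rightarrow> 'a set int_mpoly ring" where
  "ray_ring \<Sigma> = mpoly_ring (cones \<Sigma> 1)"

definition non_cone_monomials :: "'a::euclidean_space set set \<Rightarrow> 'a set int_mpoly set" where
  "non_cone_monomials \<Sigma> =
     {\<Prod>\<rho>\<in>S. mvar \<rho> | S. S \<subseteq> cones \<Sigma> 1 \<and> convex_cone hull (\<Union>S) \<notin> \<Sigma>}"

definition linear_relations ::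
    "'a::euclidean_space set \<Rightarrow> 'a set set \<Rightarrow> 'a set int_mpoly set" where
  "linear_relations N \<Sigma> =
     {\<Sum>\<rho>\<in>cones \<Sigma> 1. of_int (m (ray_gen N \<rho>)) * mvar \<rho> | m. m \<in> dual_lattice N}"

definition chow_ideal :: "'a::euclidean_space set \<Rightarrow> 'a set set \<Rightarrow> 'a set int_mpoly set" where
  "chow_ideal N \<Sigma> =
     (Idl\<^bsub>ray_ring \<Sigma>\<^esub> non_cone_monomials \<Sigma>) <+>\<^bsub>ray_ring \<Sigma>\<^esub> (Idl\<^bsub>ray_ring \<Sigma>\<^esub> linear_relations N \<Sigma>)"

definition chow_ring :: "'a::euclidean_space set \<Rightarrow> 'a set set \<Rightarrow> 'a set int_mpoly set ring" where
  "chow_ring N \<Sigma> = ray_ring \<Sigma> Quot chow_ideal N \<Sigma>"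

definition chow_class ::
    "'a::euclidean_space set \<Rightarrow> 'a set set \<Rightarrow> 'a set int_mpoly \<Rightarrow> 'a set int_mpoly set" where
  "chow_class N \<Sigma> p = chow_ideal N \<Sigma> +>\<^bsub>ray_ring \<Sigma>\<^esub> p"

text \<open>\<open>A\<^sup>k(\<Sigma>)\<close>\<close>

definition chow_graded ::
    "'a::euclidean_space set \<Rightarrow> 'a set set \<Rightarrow> nat \<Rightarrow> 'a set int_mpoly set set" where
  "chow_graded N \<Sigma> k = chow_class N \<Sigma> ` {p \<in> carrier (ray_ring \<Sigma>). homogeneous k p}"

definition cone_monomial :: "'a::euclidean_space set set \<Rightarrow> 'a set \<Rightarrow> 'a set int_mpoly" where
  "cone_monomial \<Sigma> \<sigma> = (\<Prod>\<rho>\<in>{\<rho>\<in>cones \<Sigma> 1. cone_face \<rho> \<sigma>}. mvar \<rho>)"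

definition additive_on :: "('b, 'c) ring_scheme \<Rightarrow> 'b set \<Rightarrow> ('b \<Rightarrow> int) \<Rightarrow> bool" where
  "additive_on R A h \<longleftrightarrow> (\<forall>x\<in>A. \<forall>y\<in>A. h (x \<oplus>\<^bsub>R\<^esub> y) = h x + h y)"

definition is_degree_map ::
    "'a::euclidean_space set \<Rightarrow> 'a set set \<Rightarrow> nat \<Rightarrow> ('a set int_mpoly set \<Rightarrow> int) \<Rightarrow> bool" where
  "is_degree_map N \<Sigma> d D \<longleftrightarrow>
     additive_on (chow_ring N \<Sigma>) (chow_graded N \<Sigma> d) D \<and>
     (\<forall>\<sigma>\<in>cones \<Sigma> d. D (chow_class N \<Sigma> (cone_monomial \<Sigma> \<sigma>)) = 1)"

text \<open>
  Degree maps are unique on \<open>A\<^sup>d(\<Sigma>)\<close> but arbitrary elsewhere, so the description below is of the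
  value at \<open>\<alpha>\<close>, meaningful for \<open>\<alpha>\<close> in \<open>A\<^sup>d(\<Sigma>)\<close>, and not of the map \<open>D\<close>.
\<close>

definition chow_deg ::
    "'a::euclidean_space set \<Rightarrow> 'a set set \<Rightarrow> nat \<Rightarrow> 'a set int_mpoly set \<Rightarrow> int" where
  "chow_deg N \<Sigma> d \<alpha> = (THE n. \<exists>D. is_degree_map N \<Sigma> d D \<and> D \<alpha> = n)"

definition chow_pairing ::
    "'a::euclidean_space set \<Rightarrow> 'a set set \<Rightarrow> nat \<Rightarrow>
     'a set int_mpoly set \<Rightarrow> 'a set int_mpoly set \<Rightarrow> int" where
  "chow_pairing N \<Sigma> d \<alpha> \<beta> = chow_deg N \<Sigma> d (\<alpha> \<otimes>\<^bsub>chow_ring N \<Sigma>\<^esub> \<beta>)"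

text \<open>Both induced maps \<open>A \<rightarrow> Hom(B, \<int>)\<close> and \<open>B \<rightarrow> Hom(A, \<int>)\<close> are bijective.\<close>

definition perfect_pairing ::
    "('b, 'c) ring_scheme \<Rightarrow> 'b set \<Rightarrow> 'b set \<Rightarrow> ('b \<Rightarrow> 'b \<Rightarrow> int) \<Rightarrow> bool" where
  "perfect_pairing R A B p \<longleftrightarrow>
     (\<forall>a\<in>A. additive_on R B (p a)) \<and>
     (\<forall>b\<in>B. additive_on R A (\<lambda>a. p a b)) \<and>
     (\<forall>h. additive_on R B h \<longrightarrow> (\<exists>!a. a \<in> A \<and> (\<forall>b\<in>B. p a b = h b))) \<and>
     (\<forall>h. additive_on R A h \<longrightarrow> (\<exists>!b. b \<in> B \<and> (\<forall>a\<in>A. p a b = h a)))"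

definition poincare_duality :: "'a::euclidean_space set \<Rightarrow> 'a set set \<Rightarrow> nat \<Rightarrow> bool" where
  "poincare_duality N \<Sigma> d \<longleftrightarrow>
     (\<forall>k\<le>d. perfect_pairing (chow_ring N \<Sigma>) (chow_graded N \<Sigma> k) (chow_graded N \<Sigma> (d - k))
               (chow_pairing N \<Sigma> d))"

end

(*
  Let F be the element sum_rho f(e_rho) x_rho of Z[x_rho]. Sending x_rho to the variable of its lift
  (e_rho, f(e_rho)), and in the other direction the variable of the vertical ray to -F, gives inverse
  isomorphisms: the linear relation of the second coordinate on N x Z says that F plus the vertical
  variable vanishes. The only relations of the modification without a counterpart on Sigma are
  F x_sigma = 0 for sigma not in Delta. For such sigma, f minus a linear form that agrees with it on
  sigma descends to a conewise linear function on the star of sigma with trivial divisor, so by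
  div-faithfulness f agrees on the star with an element of M; subtracting its linear relation kills
  every coefficient of F in the star.

  For degrees one needs that -F x_delta has degree 1 for a (d-1)-dimensional delta in Delta: after
  subtracting a linear form that agrees with f on delta, -F x_delta becomes the combination of the
  monomials x_sigma, sigma containing delta, whose coefficients sum to ord_delta(f) = 1.
*)
theory Submission
  imports Defs
begin

section \<open>Lattices and integral forms\<close>

text \<open>A linear form that agrees with \<open>f\<close> on a cone has to be integral on all of
  \<open>N\<close>, not only on the lattice points of the span of the cone. It exists because
  \<open>N \<inter> span \<sigma>\<close> is saturated in \<open>N\<close>. The extension is built
  one lattice vector at a time, and discreteness of \<open>N\<close> supplies a complementary
  generator at every step. Divisors on star fans are formed with normal vectors chosen inside the
  quotient. Realising quotients on orthogonal complements makes iterated quotients equal, not merely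
  isomorphic, so orders on a star are compared with orders on \<open>\<Sigma>\<close> by lifting the
  chosen vectors. If \<open>\<Delta>\<close> is empty, no vertical variable exists that could absorb
  \<open>F\<close>; then \<open>F\<close> itself lies in the Chow ideal, by div-faithfulness at the
  zero cone. Degree maps are compared as whole families: composing with the isomorphism or its
  inverse turns degree maps of one fan into degree maps of the other, so the descriptions behind
  \<open>chow_deg\<close> have the same candidates on both sides.\<close>

lemma dual_functional_exists:
  fixes B :: "'a::euclidean_space set"
  assumes "independent B" "b \<in> B"
  shows "\<exists>h::'a \<Rightarrow> real. linear h \<and> h b = 1 \<and> (\<forall>x\<in>span (B - {b}). h x = 0)"
proof -
  obtain h :: "'a \<Rightarrow> real" where h: "linear h" "\<forall>x\<in>B. h x = (if x = b then 1 else 0)"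
    using linear_independent_extend[OF assms(1), of "\<lambda>x. if x = b then 1 else 0"] by blast
  have "h x = 0" if "x \<in> span (B - {b})" for x
    using linear_eq_0_on_span[OF h(1) _ that] h(2) by auto
  with h assms show ?thesis by auto
qed

lemma lattice_add: "is_lattice N \<Longrightarrow> x \<in> N \<Longrightarrow> y \<in> N \<Longrightarrow> x + y \<in> N"
proof -
  assume "is_lattice N" "x \<in> N" "y \<in> N"
  then obtain B c d where "N = range (\<lambda>c::'a \<Rightarrow> int. \<Sum>b\<in>B. of_int (c b) *\<^sub>R b)"
    "x = (\<Sum>b\<in>B. of_int (c b) *\<^sub>R b)" "y = (\<Sum>b\<in>B. of_int (d b) *\<^sub>R b)"
    unfolding is_lattice_def lattice_basis_def by auto
  moreover have "x + y = (\<Sum>b\<in>B. of_int (c b + d b) *\<^sub>R b)"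
    using calculation by (simp add: sum.distrib scaleR_add_left)
  ultimately show ?thesis by (auto intro: image_eqI[where x="\<lambda>b. c b + d b"])
qed

lemma lattice_scale: "is_lattice N \<Longrightarrow> x \<in> N \<Longrightarrow> of_int k *\<^sub>R x \<in> N"
proof -
  assume "is_lattice N" "x \<in> N"
  then obtain B c where N: "N = range (\<lambda>c::'a \<Rightarrow> int. \<Sum>b\<in>B. of_int (c b) *\<^sub>R b)"
    "x = (\<Sum>b\<in>B. of_int (c b) *\<^sub>R b)"
    unfolding is_lattice_def lattice_basis_def by auto
  moreover have "of_int k *\<^sub>R x = (\<Sum>b\<in>B. of_int (k * c b) *\<^sub>R b)"
    using N by (simp add: scaleR_sum_right)
  ultimately show ?thesis by (auto intro: image_eqI[where x="\<lambda>b. k * c b"])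
qed

lemma lattice_zero: "is_lattice N \<Longrightarrow> 0 \<in> N"
proof -
  assume "is_lattice N"
  then obtain B where N: "N = range (\<lambda>c::'a \<Rightarrow> int. \<Sum>b\<in>B. of_int (c b) *\<^sub>R b)"
    unfolding is_lattice_def lattice_basis_def by auto
  show ?thesis unfolding N by (rule image_eqI[where x="\<lambda>_. 0"]) auto
qed

lemma lattice_uminus: "is_lattice N \<Longrightarrow> x \<in> N \<Longrightarrow> - x \<in> N"
  using lattice_scale[of N x "-1"] by simp

lemma lattice_diff: "is_lattice N \<Longrightarrow> x \<in> N \<Longrightarrow> y \<in> N \<Longrightarrow> x - y \<in> N"
  using lattice_add[of N x "-y"] lattice_uminus[of N y] by simp

lemma lattice_scale_nat: "is_lattice N \<Longrightarrow> x \<in> N \<Longrightarrow> of_nat k *\<^sub>R x \<in> N"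
  using lattice_scale[of N x "int k"] by simp

lemma lattice_sum: "is_lattice N \<Longrightarrow> (\<And>i. i \<in> I \<Longrightarrow> x i \<in> N) \<Longrightarrow> sum x I \<in> N"
  by (induction I rule: infinite_finite_induct) (auto intro: lattice_zero lattice_add)

text \<open>Each coordinate with respect to a lattice basis is a linear functional, hence bounded by
  a multiple of the norm, so the integral coordinates of the points in question lie in a finite
  box.\<close>

lemma bounded_lattice_points_finite:
  fixes N :: "'a::euclidean_space set"
  assumes "is_lattice N"
  shows "finite {x\<in>N. norm x \<le> R}"
proof -
  obtain B where B: "independent B" and N: "N = range (\<lambda>c::'a \<Rightarrow> int. \<Sum>b\<in>B. of_int (c b) *\<^sub>R b)"
    using assms unfolding is_lattice_def lattice_basis_def by auto
  have fB: "finite B" using B by (rule independent_imp_finite)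
  have "\<forall>b\<in>B. \<exists>h::'a \<Rightarrow> real. linear h \<and> h b = 1 \<and> (\<forall>x\<in>span (B - {b}). h x = 0)"
    using dual_functional_exists[OF B] by blast
  then obtain h :: "'a \<Rightarrow> 'a \<Rightarrow> real" where
    h: "\<And>b. b \<in> B \<Longrightarrow> linear (h b)" "\<And>b. b \<in> B \<Longrightarrow> h b b = 1"
       "\<And>b x. b \<in> B \<Longrightarrow> x \<in> span (B - {b}) \<Longrightarrow> h b x = 0"
    by metis
  have coord: "h b (\<Sum>b\<in>B. of_int (c b) *\<^sub>R b) = of_int (c b)" if b: "b \<in> B" for b and c :: "'a \<Rightarrow> int"
  proof -
    have "h b (\<Sum>b\<in>B. of_int (c b) *\<^sub>R b) = (\<Sum>b'\<in>B. of_int (c b') * h b b')"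
      using h(1)[OF b] by (simp add: linear_sum linear_cmul)
    also have "\<dots> = (\<Sum>b'\<in>B. if b' = b then of_int (c b) else 0)"
    proof (rule sum.cong)
      fix x assume "x \<in> B"
      then show "of_int (c x) * h b x = (if x = b then of_int (c b) else 0)"
        using h(2)[OF b] h(3)[OF b, of x] by (cases "x = b") (auto intro: span_base)
    qed simp
    finally show ?thesis using b fB by simp
  qed
  have "\<forall>b\<in>B. \<exists>K. \<forall>x. \<bar>h b x\<bar> \<le> K * norm x"
    using h(1) by (metis linear_bounded real_norm_def)
  then obtain K where K: "\<And>b x. b \<in> B \<Longrightarrow> \<bar>h b x\<bar> \<le> K b * norm x" by metis
  define M where "M b = \<lceil>\<bar>K b\<bar> * \<bar>R\<bar>\<rceil>" for b
  have "{x\<in>N. norm x \<le> R} \<subseteq> (\<lambda>c. \<Sum>b\<in>B. of_int (c b) *\<^sub>R b) ` (PiE B (\<lambda>b. {- M b .. M b}))"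
  proof
    fix x assume x: "x \<in> {x\<in>N. norm x \<le> R}"
    then obtain c where c: "x = (\<Sum>b\<in>B. of_int (c b :: int) *\<^sub>R b)" using N by auto
    have "\<bar>c b\<bar> \<le> M b" if b: "b \<in> B" for b
    proof -
      have "of_int \<bar>c b\<bar> \<le> K b * norm x" using K[OF b, of x] coord[OF b] c by simp
      also have "\<dots> \<le> \<bar>K b\<bar> * \<bar>R\<bar>" using x by (intro mult_mono) auto
      finally show ?thesis unfolding M_def by linarith
    qed
    then have "restrict c B \<in> PiE B (\<lambda>b. {- M b .. M b})" by (auto simp: abs_le_iff) (smt (verit))
    moreover have "x = (\<Sum>b\<in>B. of_int (restrict c B b) *\<^sub>R b)" using c by auto
    ultimately show "x \<in> (\<lambda>c. \<Sum>b\<in>B. of_int (c b) *\<^sub>R b) ` (PiE B (\<lambda>b. {- M b .. M b}))"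
      by (rule image_eqI[where x="restrict c B", rotated])
  qed
  then show ?thesis
    by (rule finite_subset) (intro finite_imageI finite_PiE fB, auto)
qed

text \<open>
  The coefficients of \<open>b\<close> in the lattice points of \<open>span (insert b S)\<close> form a discrete group,
  because subtracting integral combinations of \<open>S\<close> brings representatives into a bounded set.
\<close>

lemma lattice_step:
  fixes N :: "'a::euclidean_space set"
  assumes N: "is_lattice N" and S: "S \<subseteq> N" and b: "b \<in> N" "b \<notin> span S"
  shows "\<exists>v t. v \<in> N \<and> 0 < t \<and> v - t *\<^sub>R b \<in> span S \<and>
     (\<forall>x\<in>N \<inter> span (insert b S). \<exists>k. x - of_int k *\<^sub>R v \<in> span S)"
proof -
  obtain T where T: "T \<subseteq> S" "independent T" "span T = span S"
    by (metis basis_exists span_subspace subspace_span span_mono span_superset subset_antisym span_minimal)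
  have fT: "finite T" using T(2) by (rule independent_imp_finite)
  have ind: "independent (insert b T)" using b T by (simp add: independent_insert)
  have bT: "b \<notin> T" using b T(3) span_base by blast
  obtain h :: "'a \<Rightarrow> real" where h: "linear h" "h b = 1" "\<And>x. x \<in> span S \<Longrightarrow> h x = 0"
    using dual_functional_exists[OF ind, of b] bT T(3) by auto
  have dec: "x - h x *\<^sub>R b \<in> span S" if xs: "x \<in> span (insert b S)" for x
  proof -
    obtain k where k: "x - k *\<^sub>R b \<in> span S" using xs span_breakdown_eq[of x b S] by auto
    have "h (x - k *\<^sub>R b) = 0" using k h(3) by blast
    then have "h x = k" using h by (simp add: linear_diff linear_cmul)
    with k show ?thesis by simp
  qed
  \<comment> \<open>Once integral combinations of \<open>T\<close> are subtracted, only fractional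
    parts along \<open>T\<close> and a \<open>b\<close>-coefficient between 0 and 1 remain;
    \<open>R\<close> bounds the norm of such a vector.\<close>
  define R where "R = norm b + (\<Sum>s\<in>T. norm s)"
  have reduce: "\<exists>y. y \<in> N \<and> x - y \<in> span S \<and> norm y \<le> R"
    if x: "x \<in> N" "x \<in> span (insert b S)" "0 \<le> h x" "h x \<le> 1" for x
  proof -
    have "x - h x *\<^sub>R b \<in> span T" using dec[OF x(2)] T by simp
    then obtain u where u: "x - h x *\<^sub>R b = (\<Sum>s\<in>T. u s *\<^sub>R s)"
      using span_finite[OF fT] by auto
    define z where "z = (\<Sum>s\<in>T. of_int \<lfloor>u s\<rfloor> *\<^sub>R s)"
    have zN: "z \<in> N" unfolding z_def using T S N by (intro lattice_sum lattice_scale) auto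
    have zS: "z \<in> span S" unfolding z_def using T(1)
      by (intro span_sum span_scale span_base) auto
    have "x - z = h x *\<^sub>R b + (\<Sum>s\<in>T. (u s - of_int \<lfloor>u s\<rfloor>) *\<^sub>R s)"
      using u unfolding z_def by (simp add: scaleR_diff_left sum_subtractf algebra_simps)
    also have "norm \<dots> \<le> norm (h x *\<^sub>R b) + (\<Sum>s\<in>T. norm ((u s - of_int \<lfloor>u s\<rfloor>) *\<^sub>R s))"
      by (rule order_trans[OF norm_triangle_ineq add_left_mono[OF norm_sum]])
    also have "\<dots> \<le> R" unfolding R_def
    proof (intro add_mono sum_mono)
      show "norm (h x *\<^sub>R b) \<le> norm b" using x by (simp add: mult_left_le_one_le)
      show "norm ((u s - of_int \<lfloor>u s\<rfloor>) *\<^sub>R s) \<le> norm s" for s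
      proof -
        have "\<bar>u s - of_int \<lfloor>u s\<rfloor>\<bar> \<le> 1" by linarith
        then show ?thesis by (simp add: mult_left_le_one_le)
      qed
    qed
    finally have "norm (x - z) \<le> R" .
    moreover have "x - (x - z) \<in> span S" using zS by simp
    ultimately show ?thesis using lattice_diff[OF N x(1) zN] by blast
  qed
  define P where "P = {y\<in>N. norm y \<le> R} \<inter> {y \<in> span (insert b S). 0 < h y}"
  have fP: "finite P" unfolding P_def using bounded_lattice_points_finite[OF N] by blast
  have "b \<in> P" unfolding P_def R_def using b h(2) fT
    by (auto intro: span_base sum_nonneg)
  then have neP: "P \<noteq> {}" by auto
  \<comment> \<open>The candidate for the generator is a point of \<open>P\<close> with least
    \<open>b\<close>-coefficient. As \<open>b\<close> itself lies in \<open>P\<close>, this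
    coefficient is at most 1, so remainders of division by it stay in the range where
    \<open>reduce\<close> applies.\<close>
  obtain v where v: "v \<in> P" and vmin: "\<And>y. y \<in> P \<Longrightarrow> h v \<le> h y"
    using fP neP by (meson arg_min_if_finite linorder_not_less)
  have hv: "0 < h v" "v \<in> N" "v \<in> span (insert b S)" using v unfolding P_def by auto
  have hv1: "h v \<le> 1" using vmin[OF \<open>b \<in> P\<close>] h(2) by simp
  have "\<exists>k. x - of_int k *\<^sub>R v \<in> span S" if x: "x \<in> N \<inter> span (insert b S)" for x
  proof -
    define k where "k = \<lfloor>h x / h v\<rfloor>"
    define y where "y = x - of_int k *\<^sub>R v"
    have yN: "y \<in> N" unfolding y_def using x hv N by (auto intro: lattice_diff lattice_scale)
    have yS: "y \<in> span (insert b S)" unfolding y_def using x hv by (auto intro: span_diff span_scale)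
    have hy: "h y = h x - of_int k * h v" unfolding y_def using h by (simp add: linear_diff linear_cmul)
    have "of_int k \<le> h x / h v" "h x / h v < of_int k + 1" unfolding k_def by linarith+
    then have "of_int k * h v \<le> h x" "h x < (of_int k + 1) * h v"
      using hv(1) by (simp_all add: field_simps)
    then have hy2: "0 \<le> h y" "h y < h v" using hy by (simp_all add: algebra_simps)
    \<comment> \<open>The remainder \<open>y\<close> may be long and so need not belong to
      \<open>P\<close>. Its bounded representative \<open>w\<close> has the same value under
      \<open>h\<close>, which minimality then forces to be 0.\<close>
    obtain w where w: "w \<in> N" "y - w \<in> span S" "norm w \<le> R" using reduce[OF yN yS] hy2 hv1 by force
    have "h (y - w) = 0" using w h by blast
    then have hw: "h w = h y" using h by (simp add: linear_diff)
    have "w = y - (y - w)" by simp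
    moreover have "y - w \<in> span (insert b S)" using w(2) span_mono[of S "insert b S"] by auto
    ultimately have wS: "w \<in> span (insert b S)" using span_diff[OF yS] by metis
    have "h y = 0"
    proof (rule ccontr)
      assume "h y \<noteq> 0"
      then have "w \<in> P" unfolding P_def using w hw wS hy2 by auto
      then show False using vmin hw hy2 by force
    qed
    then show ?thesis using dec[OF yS] unfolding y_def by auto
  qed
  then show ?thesis using hv dec[OF hv(3)] by blast
qed

text \<open>If \<open>b\<close> is new, the vector \<open>v\<close> of \<open>lattice_step\<close>
  generates the lattice points of \<open>span (insert b S)\<close> modulo those of
  \<open>span S\<close>, so any integral value on \<open>v\<close> gives an extension; the value 0
  is chosen.\<close>

lemma integral_form_extend_step:
  fixes N :: "'a::euclidean_space set"
  assumes N: "is_lattice N" and S: "S \<subseteq> N" and b: "b \<in> N"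
    and l: "linear l" "l ` (N \<inter> span S) \<subseteq> \<int>"
  shows "\<exists>l'. linear l' \<and> l' ` (N \<inter> span (insert b S)) \<subseteq> (\<int>::real set) \<and> (\<forall>x\<in>span S. l' x = l x)"
proof (cases "b \<in> span S")
  case True
  then have "span (insert b S) = span S" by (simp add: span_redundant)
  then show ?thesis using l by auto
next
  case False
  obtain v t where v: "v \<in> N" "0 < t" "v - t *\<^sub>R b \<in> span S"
    "\<And>x. x \<in> N \<Longrightarrow> x \<in> span (insert b S) \<Longrightarrow> \<exists>k. x - of_int k *\<^sub>R v \<in> span S"
    using lattice_step[OF N S b False] by blast
  have vS: "v \<notin> span S"
  proof
    assume "v \<in> span S"
    then have "v - (v - t *\<^sub>R b) \<in> span S" using v(3) by (rule span_diff)
    then have "(1/t) *\<^sub>R (t *\<^sub>R b) \<in> span S" by (subst (asm) diff_diff_eq2) (rule span_scale, simp)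
    moreover have "(1/t) *\<^sub>R (t *\<^sub>R b) = b" using v(2) by simp
    ultimately show False using False by simp
  qed
  obtain T where T: "T \<subseteq> S" "independent T" "span T = span S"
    by (metis basis_exists span_subspace subspace_span span_mono span_superset subset_antisym span_minimal)
  have "independent (insert v T)" using vS T by (simp add: independent_insert)
  moreover have "v \<notin> T" using vS T(3) span_base by blast
  ultimately obtain h :: "'a \<Rightarrow> real" where h: "linear h" "h v = 1" "\<And>x. x \<in> span S \<Longrightarrow> h x = 0"
    using dual_functional_exists[of "insert v T" v] T(3) by auto
  \<comment> \<open>The form \<open>l\<close> lives on the whole space already; correcting it by the
    coordinate \<open>h\<close> of \<open>v\<close> kills \<open>v\<close> and changes nothing on
    \<open>span S\<close>.\<close>
  define l' where "l' x = l x - l v * h x" for x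
  have lin: "linear l'" unfolding l'_def using l(1) h(1)
    by (auto intro!: linear_compose_sub linear_compose_scale_right[of h, unfolded real_scaleR_def])
  have l'v: "l' v = 0" unfolding l'_def using h by simp
  have eq: "l' x = l x" if "x \<in> span S" for x unfolding l'_def using h(3)[OF that] by simp
  have "l' x \<in> \<int>" if x: "x \<in> N" "x \<in> span (insert b S)" for x
  proof -
    obtain k where k: "x - of_int k *\<^sub>R v \<in> span S" using v(4)[OF x] by blast
    have "l' x = l' (x - of_int k *\<^sub>R v)" using lin l'v by (simp add: linear_diff linear_cmul)
    also have "\<dots> = l (x - of_int k *\<^sub>R v)" using eq k by blast
    also have "\<dots> \<in> \<int>" using l(2) k x v(1) N by (auto intro: lattice_diff lattice_scale)
    finally show ?thesis .
  qed
  then show ?thesis using lin eq by blast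
qed

text \<open>Vectors of a basis of \<open>N\<close> are adjoined one at a time. What makes this
  possible is integrality on all lattice points of \<open>span S\<close>, rather than on the group
  generated by \<open>S\<close>: the quotient of \<open>N\<close> by
  \<open>N \<inter> span S\<close> is torsion-free.\<close>

lemma integral_form_extend:
  fixes N :: "'a::euclidean_space set"
  assumes N: "is_lattice N" and S: "S \<subseteq> N"
    and l: "linear l" "l ` (N \<inter> span S) \<subseteq> \<int>"
  shows "\<exists>m. integral_form N m \<and> (\<forall>x\<in>span S. m x = l x)"
proof -
  obtain B where B: "independent B" and NB: "N = range (\<lambda>c::'a \<Rightarrow> int. \<Sum>b\<in>B. of_int (c b) *\<^sub>R b)"
    using N unfolding is_lattice_def lattice_basis_def by auto
  have fB: "finite B" using B by (rule independent_imp_finite)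
  have BN: "B \<subseteq> N"
  proof
    fix b assume "b \<in> B"
    then have "b = (\<Sum>b'\<in>B. of_int ((if b' = b then 1 else 0) :: int) *\<^sub>R b')"
      using fB by (simp add: if_distrib if_distribR cong: if_cong)
    then show "b \<in> N" unfolding NB by (rule image_eqI[where x="\<lambda>b'. if b' = b then 1 else 0"]) auto
  qed
  have "\<exists>m. linear m \<and> m ` (N \<inter> span (A \<union> S)) \<subseteq> (\<int>::real set) \<and> (\<forall>x\<in>span S. m x = l x)"
    if "A \<subseteq> B" for A
    using finite_subset[OF that fB] that
  proof (induction A rule: finite_induct)
    case empty
    then show ?case using l by auto
  next
    case (insert b A)
    then obtain m where m: "linear m" "m ` (N \<inter> span (A \<union> S)) \<subseteq> (\<int>::real set)" "\<forall>x\<in>span S. m x = l x"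
      by auto
    have "A \<union> S \<subseteq> N" "b \<in> N" using insert BN S by auto
    from integral_form_extend_step[OF N this m(1,2)]
    obtain l' where l': "linear l'" "l' ` (N \<inter> span (insert b (A \<union> S))) \<subseteq> (\<int>::real set)"
      "\<forall>x\<in>span (A \<union> S). l' x = m x" by blast
    have "\<forall>x\<in>span S. l' x = l x" using l'(3) m(3) span_mono[of S "A \<union> S"] by auto
    then show ?case using l' by auto
  qed
  from this[of B] obtain m where m: "linear m" "m ` (N \<inter> span (B \<union> S)) \<subseteq> (\<int>::real set)"
    "\<forall>x\<in>span S. m x = l x" by auto
  have "N \<subseteq> span (B \<union> S)" unfolding NB
    by (auto intro!: span_sum span_scale intro: span_base)
  then have "N \<inter> span (B \<union> S) = N" by auto
  then show ?thesis using m unfolding integral_form_def by auto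
qed

section \<open>Cones and star fans\<close>

lemma orth_compD: "x \<in> orthogonal_comp S \<Longrightarrow> y \<in> S \<Longrightarrow> x \<bullet> y = 0"
  unfolding orthogonal_comp_def orthogonal_def by (auto simp: inner_commute)

lemma orth_comp_spanI:
  "(\<And>y. y \<in> S \<Longrightarrow> x \<bullet> y = 0) \<Longrightarrow> x \<in> orthogonal_comp (span S)"
  unfolding orthogonal_comp_def
  using orthogonal_to_span[of _ S x] by (auto simp: orthogonal_def inner_commute[of x])

lemma quot_eqI:
  assumes "y \<in> orthogonal_comp (span \<sigma>)" "x - y \<in> span \<sigma>"
  shows "quot \<sigma> x = y"
  unfolding quot_def
proof (rule the_equality)
  fix z assume z: "z \<in> orthogonal_comp (span \<sigma>) \<and> x - z \<in> span \<sigma>"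
  have "z - y = (x - y) - (x - z)" by simp
  then have "z - y \<in> span \<sigma>" using assms z by (metis span_diff)
  moreover have "z - y \<in> orthogonal_comp (span \<sigma>)"
    using assms z by (intro subspace_diff subspace_orthogonal_comp) auto
  ultimately have "(z - y) \<bullet> (z - y) = 0" using orth_compD by blast
  then show "z = y" by simp
qed (use assms in auto)

lemma quot_decomp:
  shows quot_orth: "quot \<sigma> x \<in> orthogonal_comp (span \<sigma>)" and quot_diff_span: "x - quot \<sigma> x \<in> span \<sigma>"
proof -
  obtain y z where yz: "y \<in> span \<sigma>" "\<And>w. w \<in> span \<sigma> \<Longrightarrow> orthogonal z w" "x = y + z"
    using orthogonal_subspace_decomp_exists[of \<sigma> x] by blast
  have "z \<in> orthogonal_comp (span \<sigma>)"
    unfolding orthogonal_comp_def using yz(2) by (auto simp: orthogonal_commute)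
  moreover have "x - z \<in> span \<sigma>" using yz by simp
  ultimately have "quot \<sigma> x = z" by (rule quot_eqI)
  with \<open>z \<in> _\<close> \<open>x - z \<in> _\<close> show "quot \<sigma> x \<in> orthogonal_comp (span \<sigma>)" "x - quot \<sigma> x \<in> span \<sigma>" by auto
qed

lemma linear_quot: "linear (quot \<sigma>)"
proof (rule linearI)
  fix x y :: 'a and c :: real
  have "(x + y) - (quot \<sigma> x + quot \<sigma> y) = (x - quot \<sigma> x) + (y - quot \<sigma> y)" by simp
  then have "(x + y) - (quot \<sigma> x + quot \<sigma> y) \<in> span \<sigma>" by (metis span_add quot_diff_span)
  then show "quot \<sigma> (x + y) = quot \<sigma> x + quot \<sigma> y"
    by (intro quot_eqI subspace_add subspace_orthogonal_comp quot_orth)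
  have "c *\<^sub>R x - c *\<^sub>R quot \<sigma> x = c *\<^sub>R (x - quot \<sigma> x)" by (simp add: scaleR_diff_right)
  then have "c *\<^sub>R x - c *\<^sub>R quot \<sigma> x \<in> span \<sigma>" by (metis span_scale quot_diff_span)
  then show "quot \<sigma> (c *\<^sub>R x) = c *\<^sub>R quot \<sigma> x"
    by (intro quot_eqI subspace_scale subspace_orthogonal_comp quot_orth)
qed

lemmas quot_add = linear_add[OF linear_quot]
lemmas quot_diff = linear_diff[OF linear_quot]
lemmas quot_scale = linear_cmul[OF linear_quot]
lemmas quot_sum = linear_sum[OF linear_quot]

lemma quot_zero_iff: "quot \<sigma> x = 0 \<longleftrightarrow> x \<in> span \<sigma>"
proof
  assume "quot \<sigma> x = 0" then show "x \<in> span \<sigma>" using quot_diff_span[of x \<sigma>] by simp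
next
  assume "x \<in> span \<sigma>"
  then show "quot \<sigma> x = 0" by (intro quot_eqI) (auto simp: subspace_0 subspace_orthogonal_comp)
qed

lemma quot_eq_iff: "quot \<sigma> x = quot \<sigma> y \<longleftrightarrow> x - y \<in> span \<sigma>"
  using quot_zero_iff[of \<sigma> "x - y"] by (simp add: quot_diff)

text \<open>The complement of \<open>span \<tau>\<close> lies inside the complement of
  \<open>span \<eta>\<close> and is there the complement of the image of \<open>\<tau>\<close>.
  Hence quotients of quotients coincide as vectors, and star fans need no identifications.\<close>

lemma quot_quot:
  assumes "\<eta> \<subseteq> \<tau>"
  shows "quot (quot \<eta> ` \<tau>) (quot \<eta> x) = quot \<tau> x"
proof (rule quot_eqI)
  have sub: "span \<eta> \<subseteq> span \<tau>" using assms by (rule span_mono)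
  show "quot \<tau> x \<in> orthogonal_comp (span (quot \<eta> ` \<tau>))"
  proof (rule orth_comp_spanI)
    fix y assume "y \<in> quot \<eta> ` \<tau>"
    then obtain t where t: "t \<in> \<tau>" "y = quot \<eta> t" by auto
    have "y = t - (t - quot \<eta> t)" using t by simp
    then have "y \<in> span \<tau>" using t(1) quot_diff_span sub by (metis span_base span_diff subsetD)
    then show "quot \<tau> x \<bullet> y = 0" using orth_compD quot_orth by blast
  qed
  have "quot \<eta> (quot \<tau> x) = quot \<tau> x"
  proof (rule quot_eqI)
    show "quot \<tau> x \<in> orthogonal_comp (span \<eta>)"
      using quot_orth[of \<tau> x] orthogonal_comp_anti_mono[OF sub] by blast
  qed (simp add: span_zero)
  then have "quot \<eta> x - quot \<tau> x = quot \<eta> (x - quot \<tau> x)" by (simp add: quot_diff)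
  also have "\<dots> \<in> quot \<eta> ` span \<tau>" using quot_diff_span by blast
  finally show "quot \<eta> x - quot \<tau> x \<in> span (quot \<eta> ` \<tau>)" by (simp add: linear_span_image[OF linear_quot])
qed

text \<open>The span of \<open>\<tau>\<close> is the orthogonal sum of \<open>span \<eta>\<close>
  and the span of the quotient image.\<close>

lemma dim_quot:
  assumes "\<eta> \<subseteq> \<tau>"
  shows "dim \<tau> = dim \<eta> + dim (quot \<eta> ` \<tau>)"
proof -
  have "span (\<eta> \<union> quot \<eta> ` \<tau>) = span \<tau>"
  proof (rule subset_antisym)
    have "quot \<eta> t \<in> span \<tau>" if "t \<in> \<tau>" for t
    proof -
      have "quot \<eta> t = t - (t - quot \<eta> t)" by simp
      then show ?thesis using that quot_diff_span span_mono[OF assms] by (metis span_base span_diff subsetD)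
    qed
    then show "span (\<eta> \<union> quot \<eta> ` \<tau>) \<subseteq> span \<tau>"
      using assms by (intro span_minimal) (auto intro: span_base)
    have "t \<in> span (\<eta> \<union> quot \<eta> ` \<tau>)" if "t \<in> \<tau>" for t
    proof -
      have "t = (t - quot \<eta> t) + quot \<eta> t" by simp
      moreover have "t - quot \<eta> t \<in> span (\<eta> \<union> quot \<eta> ` \<tau>)"
        using quot_diff_span span_mono[of \<eta> "\<eta> \<union> quot \<eta> ` \<tau>"] by blast
      ultimately show ?thesis using that by (metis UnCI imageI span_add span_base)
    qed
    then show "span \<tau> \<subseteq> span (\<eta> \<union> quot \<eta> ` \<tau>)" by (intro span_minimal) auto
  qed
  have "dim (\<eta> \<union> quot \<eta> ` \<tau>) = dim \<eta> + dim (quot \<eta> ` \<tau>)"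
  proof (rule dim_orthogonal_sum)
    fix x y assume "x \<in> \<eta>" "y \<in> quot \<eta> ` \<tau>"
    then obtain t where t: "y = quot \<eta> t" by auto
    have "quot \<eta> t \<bullet> x = 0" by (rule orth_compD[OF quot_orth span_base]) fact
    then show "x \<bullet> y = 0" using t by (simp add: inner_commute)
  qed
  with \<open>span (\<eta> \<union> quot \<eta> ` \<tau>) = span \<tau>\<close> show ?thesis
    using dim_span[of "\<eta> \<union> quot \<eta> ` \<tau>"] dim_span[of \<tau>] by simp
qed


section \<open>Convex cones, their spans and their faces\<close>

lemma span_convex_cone_hull: "span (convex_cone hull S) = span S"
proof (rule subset_antisym)
  have "convex_cone hull S \<subseteq> span S" by (rule hull_minimal) (simp_all add: span_superset convex_cone_span)
  then show "span (convex_cone hull S) \<subseteq> span S" by (rule span_minimal[OF _ subspace_span])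
  show "span S \<subseteq> span (convex_cone hull S)" by (rule span_mono[OF hull_subset])
qed

lemma span_convex_cone_diff:
  assumes "convex_cone C" "x \<in> span C"
  shows "\<exists>a\<in>C. \<exists>b\<in>C. x = a - b"
  using assms(2)
proof (induction rule: span_induct_alt)
  case base
  then show ?case using convex_cone_contains_0[OF assms(1)] by (metis diff_zero)
next
  case (step c x y)
  then obtain a b where ab: "a \<in> C" "b \<in> C" "y = a - b" by auto
  show ?case
  proof (cases "c \<ge> 0")
    case True
    then have "c *\<^sub>R x + a \<in> C" using ab step assms(1) by (auto simp: convex_cone_iff)
    moreover have "c *\<^sub>R x + y = (c *\<^sub>R x + a) - b" using ab by simp
    ultimately show ?thesis using ab by blast
  next
    case False
    then have "(-c) *\<^sub>R x \<in> C" using convex_cone_scaleR[OF assms(1), of "-c" x] step by simp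
    then have "(-c) *\<^sub>R x + b \<in> C" using ab(2) by (rule convex_cone_add[OF assms(1)])
    moreover have "c *\<^sub>R x + y = a - ((-c) *\<^sub>R x + b)" using ab by simp
    ultimately show ?thesis using ab by blast
  qed
qed

text \<open>Faces are defined through open segments. The sum \<open>x + y\<close> is the midpoint of
  \<open>2 *\<^sub>R x\<close> and \<open>2 *\<^sub>R y\<close>, which is interior to their segment
  unless \<open>x = y\<close>; that degenerate case is direct.\<close>

lemma face_of_cone_sumD:
  assumes "convex_cone C" "convex_cone F" "F face_of C" "x \<in> C" "y \<in> C" "x + y \<in> F"
  shows "x \<in> F"
proof -
  have "2 *\<^sub>R x \<in> F"
  proof (cases "x = y")
    case True
    then show ?thesis using assms(6) by (simp add: scaleR_2)
  next
    case False
    then have "midpoint (2 *\<^sub>R x) (2 *\<^sub>R y) \<in> open_segment (2 *\<^sub>R x) (2 *\<^sub>R y)" by simp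
    moreover have "midpoint (2 *\<^sub>R x) (2 *\<^sub>R y) = x + y"
      by (simp add: midpoint_def scaleR_add_right)
    moreover have "2 *\<^sub>R x \<in> C" "2 *\<^sub>R y \<in> C" using assms by (auto simp: convex_cone_iff)
    ultimately show ?thesis using assms(3,6) unfolding face_of_def by metis
  qed
  from convex_cone_scaleR[OF assms(2) _ this, of "1/2"] show ?thesis by simp
qed

text \<open>A face of a convex set is cut out by its affine hull, and the affine hull of a cone is
  its span because it passes through the origin.\<close>

lemma face_of_cone_Int_span:
  fixes C :: "'a::euclidean_space set"
  assumes "convex_cone C" "convex_cone F" "F face_of C"
  shows "C \<inter> span F = F"
proof -
  have "convex C" using assms(1) by (simp add: convex_cone_def)
  then have "F = affine hull F \<inter> C" using assms(3) by (rule face_of_imp_eq_affine_Int)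
  moreover have "affine hull F = span F"
    by (rule affine_hull_span_0) (rule hull_inc[OF convex_cone_contains_0[OF assms(2)]])
  ultimately show ?thesis by auto
qed

lemma zero_face_of_strongly_convex:
  assumes "convex_cone C" "strongly_convex C"
  shows "{0} face_of C"
proof -
  have "a = 0 \<and> b = 0" if ab: "a \<in> C" "b \<in> C" "0 \<in> open_segment a b" for a b
  proof -
    obtain u where u: "0 < u" "u < 1" "0 = (1 - u) *\<^sub>R a + u *\<^sub>R b" "a \<noteq> b"
      using ab(3) unfolding in_segment by auto
    have "(1 - u) *\<^sub>R a \<in> C" "u *\<^sub>R b \<in> C" using ab u assms(1) by (auto simp: convex_cone_iff)
    moreover have "(1 - u) *\<^sub>R a = - (u *\<^sub>R b)" using u(3) by (simp add: eq_neg_iff_add_eq_0)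
    ultimately have "(1 - u) *\<^sub>R a \<in> C \<inter> uminus ` C" by auto
    then have "(1 - u) *\<^sub>R a = 0" using assms(2) unfolding strongly_convex_def by auto
    then show ?thesis using u by auto
  qed
  then show ?thesis using convex_cone_contains_0[OF assms(1)] unfolding face_of_def by auto
qed

text \<open>\<open>f\<^sub>\<sigma>\<close> agrees with any linear form representing \<open>f\<close>, but only on \<open>span \<sigma>\<close>.\<close>

lemma cone_form_eq:
  assumes "linear l" "\<And>x. x \<in> \<sigma> \<Longrightarrow> f x = l x" "x \<in> span \<sigma>"
  shows "cone_form f \<sigma> x = l x"
proof -
  have "linear (cone_form f \<sigma>) \<and> (\<forall>x\<in>\<sigma>. f x = cone_form f \<sigma> x)"
    unfolding cone_form_def by (rule someI[of _ l]) (use assms in auto)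
  then show ?thesis using linear_eq_on_span[of "cone_form f \<sigma>" l \<sigma> x] assms by auto
qed

text \<open>Justifies the definite description in \<open>ray_gen\<close>: each vector is a natural
  multiple of the other, so unless they vanish the two factors have product 1.\<close>

lemma range_nat_scale_unique:
  fixes v w :: "'a::real_vector"
  assumes "range (\<lambda>k::nat. of_nat k *\<^sub>R v) = range (\<lambda>k::nat. of_nat k *\<^sub>R w)"
  shows "v = w"
proof -
  have "v \<in> range (\<lambda>k::nat. of_nat k *\<^sub>R v)" "w \<in> range (\<lambda>k::nat. of_nat k *\<^sub>R w)"
    by (rule range_eqI[of _ _ 1]; simp)+
  then have "v \<in> range (\<lambda>k::nat. of_nat k *\<^sub>R w)" "w \<in> range (\<lambda>k::nat. of_nat k *\<^sub>R v)" using assms by blast+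
  then obtain j k :: nat where jk: "v = of_nat k *\<^sub>R w" "w = of_nat j *\<^sub>R v" by blast
  show ?thesis
  proof (cases "w = 0")
    case True then show ?thesis using jk(1) by simp
  next
    case False
    have "of_nat j *\<^sub>R (of_nat k *\<^sub>R w) = w" by (simp only: jk(1)[symmetric] jk(2)[symmetric])
    then have "(1 - of_nat (j * k)) *\<^sub>R w = 0" by (simp add: scaleR_diff_left)
    then have "real (j * k) = 1" using False by simp
    then have "j * k = 1" by linarith
    then have "k = 1" by simp
    then show ?thesis using jk(1) by simp
  qed
qed

lemma ray_gen_eqI: "\<rho> \<inter> N = range (\<lambda>k::nat. of_nat k *\<^sub>R v) \<Longrightarrow> ray_gen N \<rho> = v"
  unfolding ray_gen_def using range_nat_scale_unique by (intro the_equality) auto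

section \<open>Fans in a lattice, normal generators and ray generators\<close>

locale lattice_fan =
  fixes N :: "'a::euclidean_space set" and \<Sigma> :: "'a set set"
  assumes lattice: "is_lattice N" and fan: "rational_fan N \<Sigma>"
begin

lemma finite_fan: "finite \<Sigma>" and fan_nonempty: "\<Sigma> \<noteq> {}"
  using fan unfolding rational_fan_def by auto

lemma cone_generators:
  assumes "\<sigma> \<in> \<Sigma>"
  obtains S where "finite S" "S \<subseteq> N" "\<sigma> = convex_cone hull S" "span S = span \<sigma>" "S \<subseteq> \<sigma>"
proof -
  obtain S where "finite S" "S \<subseteq> N" "\<sigma> = convex_cone hull S"
    using assms fan unfolding rational_fan_def rational_cone_def by blast
  then show thesis using that[of S] span_convex_cone_hull[of S] hull_subset[of S convex_cone] by auto
qed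

lemma convex_cone_fan: "\<sigma> \<in> \<Sigma> \<Longrightarrow> convex_cone \<sigma>"
  by (erule cone_generators) (simp add: convex_cone_convex_cone_hull)

lemma cone_zero: "\<sigma> \<in> \<Sigma> \<Longrightarrow> 0 \<in> \<sigma>"
  by (rule convex_cone_contains_0[OF convex_cone_fan])

lemma cone_add: "\<sigma> \<in> \<Sigma> \<Longrightarrow> x \<in> \<sigma> \<Longrightarrow> y \<in> \<sigma> \<Longrightarrow> x + y \<in> \<sigma>"
  by (rule convex_cone_add[OF convex_cone_fan])

lemma cone_scale: "\<sigma> \<in> \<Sigma> \<Longrightarrow> x \<in> \<sigma> \<Longrightarrow> 0 \<le> c \<Longrightarrow> c *\<^sub>R x \<in> \<sigma>"
  by (rule convex_cone_scaleR[OF convex_cone_fan])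

lemma strongly_convex_fan: "\<sigma> \<in> \<Sigma> \<Longrightarrow> strongly_convex \<sigma>"
  using fan unfolding rational_fan_def by auto

lemma cone_uminus_cancel: "\<sigma> \<in> \<Sigma> \<Longrightarrow> x \<in> \<sigma> \<Longrightarrow> - x \<in> \<sigma> \<Longrightarrow> x = 0"
  using strongly_convex_fan[of \<sigma>] unfolding strongly_convex_def by force

lemma zero_cone: "{0} \<in> \<Sigma>"
proof -
  obtain \<sigma> where "\<sigma> \<in> \<Sigma>" using fan_nonempty by auto
  moreover from this have "cone_face {0} \<sigma>" unfolding cone_face_def
    using zero_face_of_strongly_convex convex_cone_fan strongly_convex_fan by auto
  ultimately show ?thesis using fan unfolding rational_fan_def by auto
qed

lemma fan_face: "\<sigma> \<in> \<Sigma> \<Longrightarrow> cone_face \<tau> \<sigma> \<Longrightarrow> \<tau> \<in> \<Sigma>"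
  using fan unfolding rational_fan_def by auto

lemma fan_Int_face: "\<sigma> \<in> \<Sigma> \<Longrightarrow> \<tau> \<in> \<Sigma> \<Longrightarrow> cone_face (\<sigma> \<inter> \<tau>) \<sigma>"
  using fan unfolding rational_fan_def by auto

lemma fan_Int: "\<sigma> \<in> \<Sigma> \<Longrightarrow> \<tau> \<in> \<Sigma> \<Longrightarrow> \<sigma> \<inter> \<tau> \<in> \<Sigma>"
  using fan_face fan_Int_face by blast

lemma cone_face_iff: "\<sigma> \<in> \<Sigma> \<Longrightarrow> \<tau> \<in> \<Sigma> \<Longrightarrow> cone_face \<tau> \<sigma> \<longleftrightarrow> \<tau> \<subseteq> \<sigma>"
  using fan_Int_face[of \<sigma> \<tau>] by (metis cone_face_def face_of_imp_subset inf.absorb2)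

lemma cone_Int_span: "\<sigma> \<in> \<Sigma> \<Longrightarrow> \<tau> \<in> \<Sigma> \<Longrightarrow> \<tau> \<subseteq> \<sigma> \<Longrightarrow> \<sigma> \<inter> span \<tau> = \<tau>"
  by (rule face_of_cone_Int_span) (use cone_face_iff[of \<sigma> \<tau>] in \<open>auto simp: cone_face_def convex_cone_fan\<close>)

lemma cone_sumD: "\<sigma> \<in> \<Sigma> \<Longrightarrow> \<tau> \<in> \<Sigma> \<Longrightarrow> \<tau> \<subseteq> \<sigma> \<Longrightarrow> x \<in> \<sigma> \<Longrightarrow> y \<in> \<sigma> \<Longrightarrow> x + y \<in> \<tau> \<Longrightarrow> x \<in> \<tau>"
  by (rule face_of_cone_sumD[of \<sigma> \<tau> x y])
    (use cone_face_iff[of \<sigma> \<tau>] in \<open>auto simp: cone_face_def convex_cone_fan\<close>)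

lemma span_cone_diff: "\<sigma> \<in> \<Sigma> \<Longrightarrow> x \<in> span \<sigma> \<Longrightarrow> \<exists>a\<in>\<sigma>. \<exists>b\<in>\<sigma>. x = a - b"
  by (rule span_convex_cone_diff[OF convex_cone_fan])

text \<open>Linear images of closed sets need not be closed, but a finitely generated cone has a
  finitely generated image. Needed to glue continuous functions along the cones of a star
  fan.\<close>

lemma closed_cone_image:
  assumes "\<sigma> \<in> \<Sigma>" "linear (h :: 'a \<Rightarrow> 'b::euclidean_space)"
  shows "closed (h ` \<sigma>)"
proof -
  obtain S where S: "finite S" "S \<subseteq> N" "\<sigma> = convex_cone hull S" "span S = span \<sigma>" "S \<subseteq> \<sigma>"
    by (rule cone_generators[OF assms(1)])
  have "closed (convex_cone hull (h ` S))" using S(1) by (intro closed_convex_cone_hull finite_imageI)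
  then show ?thesis unfolding S(3) convex_cone_hull_linear_image[OF assms(2)] .
qed

text \<open>If \<open>x\<close> in \<open>\<sigma>\<close> and \<open>y\<close> in
  \<open>\<tau>\<close> have the same image, their difference is \<open>a - b\<close> with
  \<open>a\<close>, \<open>b\<close> in \<open>\<eta>\<close>, so \<open>x + b = y + a\<close> lies
  in \<open>\<sigma> \<inter> \<tau>\<close>. This is a face of \<open>\<sigma>\<close> and
  therefore contains the summand \<open>x\<close>.\<close>

lemma quot_image_subset:
  assumes "\<eta> \<in> \<Sigma>" "\<sigma> \<in> \<Sigma>" "\<tau> \<in> \<Sigma>" "\<eta> \<subseteq> \<sigma>" "\<eta> \<subseteq> \<tau>" "quot \<eta> ` \<sigma> \<subseteq> quot \<eta> ` \<tau>"
  shows "\<sigma> \<subseteq> \<tau>"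
proof
  fix x assume x: "x \<in> \<sigma>"
  then obtain y where y: "y \<in> \<tau>" "quot \<eta> x = quot \<eta> y" using assms by blast
  then obtain a b where ab: "a \<in> \<eta>" "b \<in> \<eta>" "x - y = a - b"
    using span_cone_diff assms(1) quot_eq_iff by blast
  then have eq: "x + b = y + a" by (simp add: algebra_simps)
  have "x + b \<in> \<sigma>" "y + a \<in> \<tau>" using x y ab assms by (auto intro: cone_add)
  then have "x + b \<in> \<sigma> \<inter> \<tau>" using eq by simp
  then have "x \<in> \<sigma> \<inter> \<tau>"
    using cone_sumD[of \<sigma> "\<sigma> \<inter> \<tau>" x b] x ab assms fan_Int by auto
  then show "x \<in> \<tau>" by simp
qed

lemma cone_diff_span_eq:
  assumes "\<sigma> \<in> \<Sigma>" "\<tau> \<in> \<Sigma>" "\<tau> \<subseteq> \<sigma>" "dim \<sigma> = dim \<tau> + 1" "b \<in> \<sigma>" "b \<notin> \<tau>"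
  shows "b \<notin> span \<tau>" "span (insert b \<tau>) = span \<sigma>"
proof -
  show b: "b \<notin> span \<tau>" using cone_Int_span assms by blast
  have "dim (insert b \<tau>) = dim \<sigma>" using b assms(4) by (simp add: dim_insert)
  moreover have "span (insert b \<tau>) \<subseteq> span \<sigma>" using assms by (intro span_mono) auto
  ultimately show "span (insert b \<tau>) = span \<sigma>"
    by (intro subspace_dim_equal) (auto simp: dim_span)
qed

text \<open>The description behind \<open>normal_gen\<close>, read as a property of a vector
  upstairs, so that concrete vectors such as ray generators can be tested against it.\<close>

definition is_normal_lift :: "'a set \<Rightarrow> 'a set \<Rightarrow> 'a \<Rightarrow> bool" where
  "is_normal_lift \<tau> \<sigma> v \<longleftrightarrow> v \<in> cone_lattice N \<sigma> \<and> quot \<tau> v \<in> quot \<tau> ` \<sigma> \<and>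
     quot \<tau> ` cone_lattice N \<sigma> = range (\<lambda>k::int. of_int k *\<^sub>R quot \<tau> v)"

text \<open>Apply \<open>lattice_step\<close> to generators of \<open>\<tau>\<close> and a generator
  \<open>b\<close> of \<open>\<sigma>\<close> outside \<open>\<tau>\<close>, which exists by
  dimension. The resulting vector is a positive multiple of \<open>b\<close> modulo
  \<open>span \<tau>\<close>, hence maps into the image of \<open>\<sigma>\<close>, and it generates
  the lattice of \<open>\<sigma>\<close> modulo \<open>span \<tau>\<close>.\<close>

lemma is_normal_lift_exists:
  assumes "\<sigma> \<in> \<Sigma>" "\<tau> \<in> \<Sigma>" "\<tau> \<subseteq> \<sigma>" "dim \<sigma> = dim \<tau> + 1"
  shows "\<exists>v. is_normal_lift \<tau> \<sigma> v"
proof -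
  obtain S where Sf: "finite S" and S: "S \<subseteq> N" and Sh: "\<sigma> = convex_cone hull S" and Ss: "span S = span \<sigma>" "S \<subseteq> \<sigma>"
    by (rule cone_generators[OF assms(1)])
  note S = S Ss
  obtain T where Tf: "finite T" and T: "T \<subseteq> N" and Th: "\<tau> = convex_cone hull T" and Ts: "span T = span \<tau>" "T \<subseteq> \<tau>"
    by (rule cone_generators[OF assms(2)])
  note T = T Ts
  have "\<not> S \<subseteq> \<tau>"
  proof
    assume "S \<subseteq> \<tau>"
    then have "dim S \<le> dim \<tau>" by (rule dim_subset)
    then have "dim \<sigma> \<le> dim \<tau>" using S(2) dim_span[of S] dim_span[of \<sigma>] by simp
    then show False using assms by simp
  qed
  then obtain b where b: "b \<in> S" "b \<notin> \<tau>" by auto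
  then have bs: "b \<in> \<sigma>" "b \<in> N" using S by auto
  note spb = cone_diff_span_eq[OF assms bs(1) b(2)]
  have spT: "span (insert b T) = span \<sigma>"
    using spb(2) T(2) span_insert[of b T] span_insert[of b \<tau>] by simp
  obtain v t where v: "v \<in> N" "0 < t" "v - t *\<^sub>R b \<in> span T"
    "\<forall>x\<in>N \<inter> span (insert b T). \<exists>k. x - of_int k *\<^sub>R v \<in> span T"
    using lattice_step[OF lattice T(1) bs(2)] spb(1) T(2) by auto
  have qv: "quot \<tau> v = quot \<tau> (t *\<^sub>R b)" using v(3) T(2) by (simp add: quot_eq_iff)
  have "v = (v - t *\<^sub>R b) + t *\<^sub>R b" by simp
  moreover have "v - t *\<^sub>R b \<in> span \<sigma>" using v(3) T(2) span_mono[OF assms(3)] by auto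
  moreover have "t *\<^sub>R b \<in> span \<sigma>" using bs(1) by (simp add: span_base span_scale)
  ultimately have vs: "v \<in> span \<sigma>" by (metis span_add)
  have "quot \<tau> ` cone_lattice N \<sigma> = range (\<lambda>k::int. of_int k *\<^sub>R quot \<tau> v)"
  proof (intro subset_antisym subsetI)
    fix y assume "y \<in> quot \<tau> ` cone_lattice N \<sigma>"
    then obtain x where x: "x \<in> N" "x \<in> span \<sigma>" "y = quot \<tau> x" unfolding cone_lattice_def by auto
    then have "\<exists>k. x - of_int k *\<^sub>R v \<in> span T" using bspec[OF v(4), of x] spT by simp
    then obtain k where "x - of_int k *\<^sub>R v \<in> span \<tau>" using T(2) by auto
    then have "y = of_int k *\<^sub>R quot \<tau> v" using x by (simp add: quot_eq_iff flip: quot_scale)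
    then show "y \<in> range (\<lambda>k::int. of_int k *\<^sub>R quot \<tau> v)" by (rule range_eqI)
  next
    fix y assume "y \<in> range (\<lambda>k::int. of_int k *\<^sub>R quot \<tau> v)"
    then obtain k :: int where "y = quot \<tau> (of_int k *\<^sub>R v)" by (auto simp: quot_scale)
    moreover have "of_int k *\<^sub>R v \<in> cone_lattice N \<sigma>" unfolding cone_lattice_def
      using v(1) vs lattice by (auto intro: lattice_scale span_scale)
    ultimately show "y \<in> quot \<tau> ` cone_lattice N \<sigma>" by simp
  qed
  moreover have "t *\<^sub>R b \<in> \<sigma>" using assms(1) bs(1) v(2) by (simp add: cone_scale)
  ultimately have "is_normal_lift \<tau> \<sigma> v"
    unfolding is_normal_lift_def cone_lattice_def using v(1) vs qv by auto
  then show ?thesis by blast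
qed

text \<open>Two candidates are integral multiples of each other, so they differ at most by a sign.
  The sign is fixed by \<open>half\<close>: if \<open>x\<close> and \<open>y\<close> in
  \<open>\<sigma>\<close> are opposite modulo \<open>span \<tau>\<close>, then \<open>x + y\<close>
  lies in \<open>\<sigma> \<inter> span \<tau> = \<tau>\<close>, and the face \<open>\<tau>\<close>
  contains \<open>x\<close>.\<close>

lemma normal_gen_eq:
  assumes "\<sigma> \<in> \<Sigma>" "\<tau> \<in> \<Sigma>" "\<tau> \<subseteq> \<sigma>" and v: "is_normal_lift \<tau> \<sigma> v"
  shows "normal_gen N \<tau> \<sigma> = quot \<tau> v"
  unfolding normal_gen_def
proof (rule the_equality)
  show "quot \<tau> v \<in> quot \<tau> ` \<sigma> \<and> quot \<tau> ` cone_lattice N \<sigma> = range (\<lambda>k::int. of_int k *\<^sub>R quot \<tau> v)"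
    using v unfolding is_normal_lift_def by auto
  fix w assume w: "w \<in> quot \<tau> ` \<sigma> \<and> quot \<tau> ` cone_lattice N \<sigma> = range (\<lambda>k::int. of_int k *\<^sub>R w)"
  define q where "q = quot \<tau> v"
  have eq: "range (\<lambda>k::int. of_int k *\<^sub>R w) = range (\<lambda>k::int. of_int k *\<^sub>R q)"
    using v w unfolding is_normal_lift_def q_def by auto
  have "w \<in> range (\<lambda>k::int. of_int k *\<^sub>R w)" "q \<in> range (\<lambda>k::int. of_int k *\<^sub>R q)"
    by (rule range_eqI[of _ _ 1]; simp)+
  then have "w \<in> range (\<lambda>k::int. of_int k *\<^sub>R q)" "q \<in> range (\<lambda>k::int. of_int k *\<^sub>R w)" using eq by blast+
  then obtain j k :: int where jk: "w = of_int k *\<^sub>R q" "q = of_int j *\<^sub>R w" by blast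
  have half: "x \<in> \<tau>" if "x \<in> \<sigma>" "y \<in> \<sigma>" "quot \<tau> x = - quot \<tau> y" for x y
  proof -
    have "x + y \<in> span \<tau>" using that(3) by (simp add: quot_add flip: quot_zero_iff)
    then have "x + y \<in> \<tau>" using cone_Int_span cone_add that assms by blast
    then show ?thesis using cone_sumD that assms by blast
  qed
  show "w = quot \<tau> v" unfolding q_def[symmetric]
  proof (cases "q = 0")
    case True
    then show "w = q" using jk(1) by simp
  next
    case False
    have "of_int j *\<^sub>R (of_int k *\<^sub>R q) = q" by (simp only: jk(1)[symmetric] jk(2)[symmetric])
    then have "(1 - of_int (j * k)) *\<^sub>R q = 0" by (simp add: scaleR_diff_left)
    then have "real_of_int (j * k) = 1" using False by simp
    then have "j * k = 1" by linarith
    then consider "k = 1" | "k = -1" by (metis zmult_eq_1_iff)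
    then show "w = q"
    proof cases
      case 2
      obtain x y where xy: "x \<in> \<sigma>" "y \<in> \<sigma>" "q = quot \<tau> x" "w = quot \<tau> y"
        using v w unfolding is_normal_lift_def q_def by auto
      have "quot \<tau> x = - quot \<tau> y" using jk(1) 2 by (simp add: xy(3,4)[symmetric])
      then have "x \<in> \<tau>" using half xy by blast
      then have "q = 0" using xy by (simp add: quot_zero_iff span_base)
      with False show ?thesis by simp
    qed (use jk(1) in simp)
  qed
qed

lemma normal_lift:
  assumes "\<sigma> \<in> \<Sigma>" "\<tau> \<in> \<Sigma>" "\<tau> \<subseteq> \<sigma>" "dim \<sigma> = dim \<tau> + 1"
  shows "normal_lift N \<tau> \<sigma> \<in> cone_lattice N \<sigma>" "quot \<tau> (normal_lift N \<tau> \<sigma>) = normal_gen N \<tau> \<sigma>"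
proof -
  obtain v where "is_normal_lift \<tau> \<sigma> v" using is_normal_lift_exists[OF assms] by blast
  then have "v \<in> cone_lattice N \<sigma> \<and> quot \<tau> v = normal_gen N \<tau> \<sigma>"
    using normal_gen_eq[OF assms(1-3), of v] is_normal_lift_def by auto
  then have "normal_lift N \<tau> \<sigma> \<in> cone_lattice N \<sigma> \<and> quot \<tau> (normal_lift N \<tau> \<sigma>) = normal_gen N \<tau> \<sigma>"
    unfolding normal_lift_def by (rule someI)
  then show "normal_lift N \<tau> \<sigma> \<in> cone_lattice N \<sigma>" "quot \<tau> (normal_lift N \<tau> \<sigma>) = normal_gen N \<tau> \<sigma>"
    by auto
qed

text \<open>A ray generator is a normal generator over the zero cone, where the quotient map is the
  identity. It is non-zero since the ray has dimension 1, and negative multiples are excluded by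
  strong convexity.\<close>

lemma ray_gen:
  assumes "\<rho> \<in> cones \<Sigma> 1"
  shows "\<rho> \<inter> N = range (\<lambda>k::nat. of_nat k *\<^sub>R ray_gen N \<rho>)"
proof -
  have \<rho>: "\<rho> \<in> \<Sigma>" "dim \<rho> = 1" using assms unfolding cones_def by auto
  have q0: "quot {0} x = x" for x :: 'a by (rule quot_eqI) auto
  obtain v where "is_normal_lift {0} \<rho> v"
    using is_normal_lift_exists[OF \<rho>(1) zero_cone] \<rho> cone_zero[OF \<rho>(1)] by auto
  then have v: "v \<in> \<rho>" "v \<in> N" "N \<inter> span \<rho> = range (\<lambda>k::int. of_int k *\<^sub>R v)"
    unfolding is_normal_lift_def q0 cone_lattice_def by auto
  obtain S where Sf: "finite S" and S: "S \<subseteq> N" and Sh: "\<rho> = convex_cone hull S" and Ss: "span S = span \<rho>" "S \<subseteq> \<rho>"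
    by (rule cone_generators[OF \<rho>(1)])
  note S = S Ss
  have v0: "v \<noteq> 0"
  proof
    assume "v = 0"
    then have "N \<inter> span \<rho> = {0}" using v(3) by auto
    then have "S \<subseteq> {0}" using S span_superset[of S] by auto
    then have "dim S = 0" by simp
    moreover have "dim S = dim \<rho>" using S(2) dim_span[of S] dim_span[of \<rho>] by simp
    ultimately show False using \<rho>(2) by linarith
  qed
  have "\<rho> \<inter> N = range (\<lambda>k::nat. of_nat k *\<^sub>R v)"
  proof (intro subset_antisym subsetI)
    fix x assume x: "x \<in> \<rho> \<inter> N"
    then have "x \<in> N \<inter> span \<rho>" by (simp add: span_base)
    then obtain k :: int where k: "x = of_int k *\<^sub>R v" using v(3) by auto
    have "k \<ge> 0"
    proof (rule ccontr)
      assume neg: "\<not> k \<ge> 0"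
      then have "(1 / (- of_int k)) *\<^sub>R x \<in> \<rho>" using x \<rho>(1) by (intro cone_scale) auto
      moreover have "(1 / (- of_int k)) *\<^sub>R x = - v" using neg k by simp
      ultimately show False using cone_uminus_cancel[OF \<rho>(1) v(1)] v0 by simp
    qed
    then have "x = of_nat (nat k) *\<^sub>R v" using k by simp
    then show "x \<in> range (\<lambda>k::nat. of_nat k *\<^sub>R v)" by blast
  next
    fix x assume "x \<in> range (\<lambda>k::nat. of_nat k *\<^sub>R v)"
    then show "x \<in> \<rho> \<inter> N" using v \<rho>(1) lattice by (auto intro: cone_scale lattice_scale_nat)
  qed
  moreover from this have "ray_gen N \<rho> = v" by (rule ray_gen_eqI)
  ultimately show ?thesis by simp
qed


end

text \<open>\<open>cone_form\<close> is chosen among all real linear forms representing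
  \<open>f\<close> and may take non-integral values off the span of the cone; on
  \<open>cone_lattice N \<sigma>\<close> it agrees with an integral representative.\<close>

lemma conewise_linear_form:
  assumes "conewise_integral_linear N \<Sigma> f" "\<sigma> \<in> \<Sigma>"
  shows "linear (cone_form f \<sigma>)" and "x \<in> \<sigma> \<Longrightarrow> cone_form f \<sigma> x = f x"
    and "x \<in> cone_lattice N \<sigma> \<Longrightarrow> cone_form f \<sigma> x \<in> \<int>"
proof -
  obtain l where l: "linear l" "l ` cone_lattice N \<sigma> \<subseteq> \<int>" "\<forall>x\<in>\<sigma>. f x = l x"
    using assms unfolding conewise_integral_linear_def integral_form_def by blast
  have "linear (cone_form f \<sigma>) \<and> (\<forall>x\<in>\<sigma>. f x = cone_form f \<sigma> x)"
    unfolding cone_form_def by (rule someI[of _ l]) (use l in auto)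
  then show "linear (cone_form f \<sigma>)" "x \<in> \<sigma> \<Longrightarrow> cone_form f \<sigma> x = f x" by auto
  assume "x \<in> cone_lattice N \<sigma>"
  moreover from this have "cone_form f \<sigma> x = l x"
    by (intro cone_form_eq) (use l in \<open>auto simp: cone_lattice_def\<close>)
  ultimately show "cone_form f \<sigma> x \<in> \<int>" using l(2) by auto
qed

section \<open>Orders of conewise linear functions on a fan and on its stars\<close>

locale tropical = lattice_fan N \<Sigma> for N :: "'a::euclidean_space set" and \<Sigma> +
  fixes d :: nat and f :: "'a \<Rightarrow> real"
  assumes trop: "tropical_fan N \<Sigma> d" and conewise: "conewise_integral_linear N \<Sigma> f"
begin

lemmas linear_cone_form = conewise_linear_form(1)[OF conewise]
lemmas cone_form_in = conewise_linear_form(2)[OF conewise]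
lemmas cone_form_int = conewise_linear_form(3)[OF conewise]

lemma cone_form_subset:
  assumes "\<sigma> \<in> \<Sigma>" "\<tau> \<in> \<Sigma>" "\<tau> \<subseteq> \<sigma>" "x \<in> span \<tau>"
  shows "cone_form f \<sigma> x = cone_form f \<tau> x"
  by (rule cone_form_eq[symmetric])
    (use assms linear_cone_form cone_form_in in \<open>auto simp: subset_iff\<close>)

text \<open>This is the balancing condition, carried from the normal generators to arbitrary lifts
  of them.\<close>

lemma normal_lifts_sum_in_span:
  assumes \<tau>: "\<tau> \<in> codim1_cones \<Sigma> d"
    and u: "\<And>\<sigma>. \<sigma> \<in> cones \<Sigma> d \<Longrightarrow> \<tau> \<subseteq> \<sigma> \<Longrightarrow> quot \<tau> (u \<sigma>) = normal_gen N \<tau> \<sigma>"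
  shows "(\<Sum>\<sigma>\<in>{\<sigma>\<in>cones \<Sigma> d. \<tau> \<subseteq> \<sigma>}. u \<sigma>) \<in> span \<tau>"
proof -
  have "quot \<tau> (\<Sum>\<sigma>\<in>{\<sigma>\<in>cones \<Sigma> d. \<tau> \<subseteq> \<sigma>}. u \<sigma>)
      = (\<Sum>\<sigma>\<in>{\<sigma>\<in>cones \<Sigma> d. \<tau> \<subseteq> \<sigma>}. normal_gen N \<tau> \<sigma>)"
    unfolding quot_sum by (rule sum.cong) (use u in auto)
  also have "\<dots> = 0" using trop \<tau> unfolding tropical_fan_def by auto
  finally show ?thesis by (simp add: quot_zero_iff)
qed

text \<open>Two invariances at once. Changing a lift moves it within \<open>span \<tau>\<close>,
  where the forms of \<open>\<sigma>\<close> and \<open>\<tau>\<close> agree, so both sums of the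
  order change equally. A globally linear \<open>m\<close> contributes opposite amounts to the two
  sums.\<close>

lemma ord_div_eq:
  assumes \<tau>: "\<tau> \<in> codim1_cones \<Sigma> d" and m: "linear m"
    and u: "\<And>\<sigma>. \<sigma> \<in> cones \<Sigma> d \<Longrightarrow> \<tau> \<subseteq> \<sigma> \<Longrightarrow> quot \<tau> (u \<sigma>) = normal_gen N \<tau> \<sigma>"
  shows "ord_div N \<Sigma> d f \<tau> =
    - (\<Sum>\<sigma>\<in>{\<sigma>\<in>cones \<Sigma> d. \<tau> \<subseteq> \<sigma>}. cone_form f \<sigma> (u \<sigma>) - m (u \<sigma>))
    + (cone_form f \<tau> (\<Sum>\<sigma>\<in>{\<sigma>\<in>cones \<Sigma> d. \<tau> \<subseteq> \<sigma>}. u \<sigma>) - m (\<Sum>\<sigma>\<in>{\<sigma>\<in>cones \<Sigma> d. \<tau> \<subseteq> \<sigma>}. u \<sigma>))"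
proof -
  define A where "A = {\<sigma>\<in>cones \<Sigma> d. \<tau> \<subseteq> \<sigma>}"
  let ?n = "normal_lift N \<tau>"
  have \<tau>\<Sigma>: "\<tau> \<in> \<Sigma>" using \<tau> unfolding codim1_cones_def by auto
  have "cone_form f \<sigma> (?n \<sigma>) = cone_form f \<sigma> (u \<sigma>) + (cone_form f \<tau> (?n \<sigma> - u \<sigma>))" if "\<sigma> \<in> A" for \<sigma>
  proof -
    have \<sigma>: "\<sigma> \<in> \<Sigma>" "\<tau> \<subseteq> \<sigma>" "dim \<sigma> = dim \<tau> + 1"
      using that \<tau> unfolding A_def cones_def codim1_cones_def by auto
    have "quot \<tau> (?n \<sigma>) = quot \<tau> (u \<sigma>)"
      using normal_lift(2)[OF \<sigma>(1) \<tau>\<Sigma> \<sigma>(2,3)] u that unfolding A_def by auto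
    then have "?n \<sigma> - u \<sigma> \<in> span \<tau>" by (simp add: quot_eq_iff)
    then have "cone_form f \<tau> (?n \<sigma> - u \<sigma>) = cone_form f \<sigma> (?n \<sigma> - u \<sigma>)"
      using cone_form_subset \<sigma> \<tau>\<Sigma> by metis
    then show ?thesis using linear_diff[OF linear_cone_form[OF \<sigma>(1)]] by simp
  qed
  then have "(\<Sum>\<sigma>\<in>A. cone_form f \<sigma> (?n \<sigma>))
      = (\<Sum>\<sigma>\<in>A. cone_form f \<sigma> (u \<sigma>)) + (\<Sum>\<sigma>\<in>A. cone_form f \<tau> (?n \<sigma>)) - (\<Sum>\<sigma>\<in>A. cone_form f \<tau> (u \<sigma>))"
    using linear_diff[OF linear_cone_form[OF \<tau>\<Sigma>]] by (simp add: sum.distrib sum_subtractf)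
  moreover have "cone_form f \<tau> (\<Sum>\<sigma>\<in>A. x \<sigma>) = (\<Sum>\<sigma>\<in>A. cone_form f \<tau> (x \<sigma>))" for x
    by (rule linear_sum[OF linear_cone_form[OF \<tau>\<Sigma>]])
  moreover have "m (\<Sum>\<sigma>\<in>A. u \<sigma>) = (\<Sum>\<sigma>\<in>A. m (u \<sigma>))" by (rule linear_sum[OF m])
  ultimately show ?thesis unfolding ord_div_def A_def[symmetric] by (simp add: sum_subtractf)
qed

lemma dim_le:
  assumes "\<sigma> \<in> \<Sigma>" shows "dim \<sigma> \<le> d"
proof -
  obtain \<zeta> where \<zeta>: "\<zeta> \<in> \<Sigma>" "\<sigma> \<subseteq> \<zeta>" "\<forall>\<xi>\<in>\<Sigma>. \<zeta> \<subseteq> \<xi> \<longrightarrow> \<zeta> = \<xi>"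
    using finite_has_maximal2[OF finite_fan assms] by blast
  then have "dim \<zeta> = d" using trop unfolding tropical_fan_def pure_dim_def by metis
  then show ?thesis using dim_subset[OF \<zeta>(2)] by simp
qed

text \<open>Used to reindex sums over the star by sums over \<open>\<Sigma>\<close>. Passing to
  images reflects inclusions by \<open>quot_image_subset\<close>, hence is injective, and lowers
  dimensions by \<open>dim \<eta>\<close>.\<close>

lemma star_cones_containing:
  assumes \<eta>: "\<eta> \<in> \<Sigma>" and \<tau>: "\<tau> \<in> \<Sigma>" "\<eta> \<subseteq> \<tau>"
  shows "{\<sigma>' \<in> cones (star_fan \<Sigma> \<eta>) (d - dim \<eta>). quot \<eta> ` \<tau> \<subseteq> \<sigma>'}
      = (\<lambda>\<sigma>. quot \<eta> ` \<sigma>) ` {\<sigma> \<in> cones \<Sigma> d. \<tau> \<subseteq> \<sigma>}"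
    and "inj_on (\<lambda>\<sigma>. quot \<eta> ` \<sigma>) {\<sigma> \<in> cones \<Sigma> d. \<tau> \<subseteq> \<sigma>}"
proof -
  show "inj_on (\<lambda>\<sigma>. quot \<eta> ` \<sigma>) {\<sigma> \<in> cones \<Sigma> d. \<tau> \<subseteq> \<sigma>}"
  proof (rule inj_onI)
    fix \<sigma> \<zeta> assume a: "\<sigma> \<in> {\<sigma> \<in> cones \<Sigma> d. \<tau> \<subseteq> \<sigma>}" "\<zeta> \<in> {\<sigma> \<in> cones \<Sigma> d. \<tau> \<subseteq> \<sigma>}"
      "quot \<eta> ` \<sigma> = quot \<eta> ` \<zeta>"
    then have "\<sigma> \<in> \<Sigma>" "\<zeta> \<in> \<Sigma>" "\<eta> \<subseteq> \<sigma>" "\<eta> \<subseteq> \<zeta>" using \<tau> unfolding cones_def by auto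
    then have "\<sigma> \<subseteq> \<zeta>" "\<zeta> \<subseteq> \<sigma>" using quot_image_subset[OF \<eta>] a(3) by simp_all
    then show "\<sigma> = \<zeta>" by (rule subset_antisym)
  qed
  show "{\<sigma>' \<in> cones (star_fan \<Sigma> \<eta>) (d - dim \<eta>). quot \<eta> ` \<tau> \<subseteq> \<sigma>'}
      = (\<lambda>\<sigma>. quot \<eta> ` \<sigma>) ` {\<sigma> \<in> cones \<Sigma> d. \<tau> \<subseteq> \<sigma>}"
  proof (intro subset_antisym subsetI)
    fix \<sigma>' assume "\<sigma>' \<in> {\<sigma>' \<in> cones (star_fan \<Sigma> \<eta>) (d - dim \<eta>). quot \<eta> ` \<tau> \<subseteq> \<sigma>'}"
    then obtain \<sigma> where \<sigma>: "\<sigma> \<in> \<Sigma>" "\<eta> \<subseteq> \<sigma>" "\<sigma>' = quot \<eta> ` \<sigma>" "dim \<sigma>' = d - dim \<eta>" "quot \<eta> ` \<tau> \<subseteq> \<sigma>'"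
      unfolding cones_def star_fan_def by auto
    \<comment> \<open>\<open>dim \<eta> \<le> d\<close> excludes truncation in the natural number
      \<open>d - dim \<eta>\<close>.\<close>
    have "dim \<sigma> = d" using dim_quot[OF \<sigma>(2)] \<sigma>(3,4) dim_le[OF \<eta>] by simp
    moreover have "\<tau> \<subseteq> \<sigma>" using quot_image_subset[OF \<eta> \<tau>(1) \<sigma>(1) \<tau>(2) \<sigma>(2)] \<sigma>(3,5) by simp
    ultimately show "\<sigma>' \<in> (\<lambda>\<sigma>. quot \<eta> ` \<sigma>) ` {\<sigma> \<in> cones \<Sigma> d. \<tau> \<subseteq> \<sigma>}"
      using \<sigma> unfolding cones_def by auto
  next
    fix \<sigma>' assume "\<sigma>' \<in> (\<lambda>\<sigma>. quot \<eta> ` \<sigma>) ` {\<sigma> \<in> cones \<Sigma> d. \<tau> \<subseteq> \<sigma>}"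
    then obtain \<sigma> where \<sigma>: "\<sigma> \<in> \<Sigma>" "dim \<sigma> = d" "\<tau> \<subseteq> \<sigma>" "\<sigma>' = quot \<eta> ` \<sigma>" unfolding cones_def by auto
    have "\<eta> \<subseteq> \<sigma>" using \<sigma>(3) \<tau>(2) by auto
    then have "dim \<sigma>' = d - dim \<eta>" using dim_quot[of \<eta> \<sigma>] \<sigma>(2,4) by simp
    then show "\<sigma>' \<in> {\<sigma>' \<in> cones (star_fan \<Sigma> \<eta>) (d - dim \<eta>). quot \<eta> ` \<tau> \<subseteq> \<sigma>'}"
      unfolding cones_def star_fan_def using \<sigma> \<open>\<eta> \<subseteq> \<sigma>\<close> by auto
  qed
qed

text \<open>Since \<open>span \<eta>\<close> is contained in \<open>span \<sigma>\<close>,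
  membership of a lattice vector in \<open>span \<sigma>\<close> depends only on its class modulo
  \<open>span \<eta>\<close>.\<close>

lemma cone_lattice_quot:
  assumes "\<eta> \<subseteq> \<sigma>"
  shows "cone_lattice (quot_lattice N \<eta>) (quot \<eta> ` \<sigma>) = quot \<eta> ` cone_lattice N \<sigma>"
proof -
  have "n \<in> span \<sigma>" if n: "quot \<eta> n \<in> span (quot \<eta> ` \<sigma>)" for n
  proof -
    obtain z where z: "z \<in> span \<sigma>" "quot \<eta> n = quot \<eta> z"
      using n unfolding linear_span_image[OF linear_quot] by auto
    then have "n - z \<in> span \<sigma>" using span_mono[OF assms] by (auto simp: quot_eq_iff)
    then have "(n - z) + z \<in> span \<sigma>" using z(1) by (rule span_add)
    then show ?thesis by simp
  qed
  moreover have "quot \<eta> n \<in> span (quot \<eta> ` \<sigma>)" if "n \<in> span \<sigma>" for n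
    using that unfolding linear_span_image[OF linear_quot] by (rule imageI)
  ultimately show ?thesis unfolding cone_lattice_def quot_lattice_def by blast
qed

text \<open>By \<open>quot_quot\<close> both sides are definite descriptions with literally the same
  defining condition.\<close>

lemma normal_gen_quot:
  assumes "\<eta> \<subseteq> \<tau>" "\<tau> \<subseteq> \<sigma>"
  shows "normal_gen (quot_lattice N \<eta>) (quot \<eta> ` \<tau>) (quot \<eta> ` \<sigma>) = normal_gen N \<tau> \<sigma>"
proof -
  have "\<eta> \<subseteq> \<sigma>" using assms by auto
  then show ?thesis unfolding normal_gen_def
    by (simp add: cone_lattice_quot image_image quot_quot[OF assms(1)])
qed

text \<open>The difference of \<open>f\<close> and \<open>m\<close> vanishes on
  \<open>\<eta>\<close>, so on each cone containing \<open>\<eta>\<close> its linear form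
  \<open>h\<close> is constant on cosets of \<open>span \<eta>\<close> and descends to the star.
  Orders are preserved because \<open>ord_div_eq\<close> allows both the subtraction of
  \<open>m\<close> and a change of lifts.\<close>

lemma star_function:
  assumes \<eta>: "\<eta> \<in> \<Sigma>" and m: "integral_form N m" and mf: "\<And>x. x \<in> \<eta> \<Longrightarrow> m x = f x"
  obtains g where "conewise_integral_linear (quot_lattice N \<eta>) (star_fan \<Sigma> \<eta>) g"
    and "\<And>\<zeta> x. \<zeta> \<in> \<Sigma> \<Longrightarrow> \<eta> \<subseteq> \<zeta> \<Longrightarrow> x \<in> \<zeta> \<Longrightarrow> g (quot \<eta> x) = f x - m x"
    and "\<And>\<tau>. quot \<eta> ` \<tau> \<in> codim1_cones (star_fan \<Sigma> \<eta>) (d - dim \<eta>) \<Longrightarrow> \<tau> \<in> \<Sigma> \<Longrightarrow> \<eta> \<subseteq> \<tau> \<Longrightarrow>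
       \<tau> \<in> codim1_cones \<Sigma> d \<and>
       ord_div (quot_lattice N \<eta>) (star_fan \<Sigma> \<eta>) (d - dim \<eta>) g (quot \<eta> ` \<tau>) = ord_div N \<Sigma> d f \<tau>"
proof -
  have lm: "linear m" and mN: "\<And>x. x \<in> N \<Longrightarrow> m x \<in> \<int>" using m unfolding integral_form_def by auto
  define h where "h \<zeta> x = cone_form f \<zeta> x - m x" for \<zeta> x
  have lh: "linear (h \<zeta>)" if "\<zeta> \<in> \<Sigma>" for \<zeta>
    unfolding h_def using linear_compose_sub[OF linear_cone_form[OF that] lm] by simp
  have h0: "h \<zeta> x = 0" if "\<zeta> \<in> \<Sigma>" "\<eta> \<subseteq> \<zeta>" "x \<in> span \<eta>" for \<zeta> x
  proof (rule linear_eq_0_on_span[OF lh _ that(3)])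
    fix x assume "x \<in> \<eta>"
    then show "h \<zeta> x = 0" unfolding h_def using cone_form_in that mf by auto
  qed fact
  have hq: "h \<zeta> (quot \<eta> x) = h \<zeta> x" if "\<zeta> \<in> \<Sigma>" "\<eta> \<subseteq> \<zeta>" for \<zeta> x
  proof -
    have "h \<zeta> (x - quot \<eta> x) = 0" using h0[OF that quot_diff_span] .
    then show ?thesis using linear_diff[OF lh[OF that(1)]] by simp
  qed
  have hf: "h \<zeta> x = f x - m x" if "\<zeta> \<in> \<Sigma>" "x \<in> \<zeta>" for \<zeta> x
    unfolding h_def using cone_form_in that by simp
  \<comment> \<open>Points of different cones with the same image are compared through the common
    point \<open>x + b = y + a\<close>; adding vectors of \<open>\<eta>\<close> does not change
    \<open>h\<close>.\<close>
  have welldef: "f x - m x = f y - m y"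
    if that': "\<zeta> \<in> \<Sigma>" "\<eta> \<subseteq> \<zeta>" "x \<in> \<zeta>" "\<xi> \<in> \<Sigma>" "\<eta> \<subseteq> \<xi>" "y \<in> \<xi>" "quot \<eta> x = quot \<eta> y" for \<zeta> \<xi> x y
  proof -
    obtain a b where ab: "a \<in> \<eta>" "b \<in> \<eta>" "x - y = a - b"
      using span_cone_diff \<eta> that'(7) quot_eq_iff by blast
    then have eq: "x + b = y + a" by (simp add: algebra_simps)
    have "b \<in> \<zeta>" "a \<in> \<xi>" using that ab by auto
    then have i: "x + b \<in> \<zeta>" "y + a \<in> \<xi>" using that cone_add by auto
    have "h \<zeta> x = h \<zeta> (x + b)"
      using h0[of \<zeta> b] that ab linear_add[OF lh] by (simp add: span_base)
    also have "\<dots> = f (x + b) - m (x + b)" using hf i that by simp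
    also have "\<dots> = h \<xi> (y + a)" using hf[OF that(4) i(2)] eq by simp
    also have "\<dots> = h \<xi> y"
      using h0[of \<xi> a] that ab linear_add[OF lh] by (simp add: span_base)
    finally show ?thesis using hf that by simp
  qed
  \<comment> \<open>The chosen preimage may come from any cone containing \<open>\<eta>\<close>;
    \<open>welldef\<close> makes the choice immaterial.\<close>
  define g where "g y = (let x = (SOME x. (\<exists>\<zeta>\<in>\<Sigma>. \<eta> \<subseteq> \<zeta> \<and> x \<in> \<zeta>) \<and> quot \<eta> x = y) in f x - m x)" for y
  have g: "g (quot \<eta> x) = f x - m x" if "\<zeta> \<in> \<Sigma>" "\<eta> \<subseteq> \<zeta>" "x \<in> \<zeta>" for \<zeta> x
  proof -
    define z where "z = (SOME z. (\<exists>\<zeta>\<in>\<Sigma>. \<eta> \<subseteq> \<zeta> \<and> z \<in> \<zeta>) \<and> quot \<eta> z = quot \<eta> x)"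
    have "(\<exists>\<zeta>\<in>\<Sigma>. \<eta> \<subseteq> \<zeta> \<and> z \<in> \<zeta>) \<and> quot \<eta> z = quot \<eta> x"
      unfolding z_def by (rule someI[of _ x]) (use that in auto)
    then obtain \<xi> where "\<xi> \<in> \<Sigma>" "\<eta> \<subseteq> \<xi>" "z \<in> \<xi>" "quot \<eta> z = quot \<eta> x" by auto
    from welldef[OF this(1-3) that this(4)] show ?thesis unfolding g_def z_def Let_def .
  qed
  have gh: "g y = h \<zeta> y" if "\<zeta> \<in> \<Sigma>" "\<eta> \<subseteq> \<zeta>" "y \<in> quot \<eta> ` \<zeta>" for \<zeta> y
    using that g hq hf by auto
  have "conewise_integral_linear (quot_lattice N \<eta>) (star_fan \<Sigma> \<eta>) g"
    unfolding conewise_integral_linear_def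
  proof (intro conjI ballI)
    have "continuous_on (\<Union>\<zeta>\<in>{\<zeta>\<in>\<Sigma>. \<eta> \<subseteq> \<zeta>}. quot \<eta> ` \<zeta>) g"
    proof (rule continuous_on_closed_Union)
      show "finite {\<zeta>\<in>\<Sigma>. \<eta> \<subseteq> \<zeta>}" using finite_fan by simp
      fix \<zeta> assume \<zeta>: "\<zeta> \<in> {\<zeta>\<in>\<Sigma>. \<eta> \<subseteq> \<zeta>}"
      then show "closed (quot \<eta> ` \<zeta>)" using closed_cone_image linear_quot by auto
      have "continuous_on (quot \<eta> ` \<zeta>) (h \<zeta>)"
        using lh \<zeta> by (intro linear_continuous_on) (auto simp: linear_conv_bounded_linear)
      moreover have "continuous_on (quot \<eta> ` \<zeta>) g = continuous_on (quot \<eta> ` \<zeta>) (h \<zeta>)"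
        by (rule continuous_on_cong) (use gh \<zeta> in auto)
      ultimately show "continuous_on (quot \<eta> ` \<zeta>) g" by simp
    qed
    then show "continuous_on (\<Union>(star_fan \<Sigma> \<eta>)) g" unfolding star_fan_def by simp
    fix \<sigma>' assume "\<sigma>' \<in> star_fan \<Sigma> \<eta>"
    then obtain \<zeta> where \<zeta>: "\<zeta> \<in> \<Sigma>" "\<eta> \<subseteq> \<zeta>" "\<sigma>' = quot \<eta> ` \<zeta>" unfolding star_fan_def by auto
    have "h \<zeta> y \<in> \<int>" if y: "y \<in> cone_lattice (quot_lattice N \<eta>) (quot \<eta> ` \<zeta>)" for y
    proof -
      obtain n where n: "n \<in> cone_lattice N \<zeta>" "y = quot \<eta> n" using y cone_lattice_quot[OF \<zeta>(2)] by auto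
      have "h \<zeta> y = h \<zeta> n" using hq \<zeta> n by simp
      then show ?thesis
        using cone_form_int[OF \<zeta>(1) n(1)] mN n(1) unfolding h_def cone_lattice_def by auto
    qed
    then show "\<exists>l. integral_form (cone_lattice (quot_lattice N \<eta>) \<sigma>') l \<and> (\<forall>x\<in>\<sigma>'. g x = l x)"
      unfolding integral_form_def using lh[OF \<zeta>(1)] gh[OF \<zeta>(1,2)] \<zeta>(3) by blast
  qed
  moreover have "\<tau> \<in> codim1_cones \<Sigma> d \<and>
       ord_div (quot_lattice N \<eta>) (star_fan \<Sigma> \<eta>) (d - dim \<eta>) g (quot \<eta> ` \<tau>) = ord_div N \<Sigma> d f \<tau>"
    if \<tau>: "quot \<eta> ` \<tau> \<in> codim1_cones (star_fan \<Sigma> \<eta>) (d - dim \<eta>)" "\<tau> \<in> \<Sigma>" "\<eta> \<subseteq> \<tau>" for \<tau>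
  proof
    have "dim (quot \<eta> ` \<tau>) + 1 = d - dim \<eta>" using \<tau>(1) unfolding codim1_cones_def by simp
    then have "dim \<tau> + 1 = d" using dim_quot[OF \<tau>(3)] by simp
    then show c1: "\<tau> \<in> codim1_cones \<Sigma> d" using \<tau>(2) unfolding codim1_cones_def by simp
    define A where "A = {\<sigma> \<in> cones \<Sigma> d. \<tau> \<subseteq> \<sigma>}"
    let ?n = "\<lambda>\<sigma>. normal_lift (quot_lattice N \<eta>) (quot \<eta> ` \<tau>) (quot \<eta> ` \<sigma>)"
    \<comment> \<open>The normal lift chosen in the star is unrelated to the one chosen in
      \<open>\<Sigma>\<close>. It is still the image of some lattice vector \<open>u\<close> over
      the same normal generator, and \<open>ord_div_eq\<close> accepts any such
      \<open>u\<close>.\<close>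
    have "\<exists>u. u \<in> cone_lattice N \<sigma> \<and> quot \<tau> u = normal_gen N \<tau> \<sigma> \<and> ?n \<sigma> = quot \<eta> u" if "\<sigma> \<in> A" for \<sigma>
    proof -
      have \<sigma>: "\<sigma> \<in> \<Sigma>" "\<tau> \<subseteq> \<sigma>" "dim \<sigma> = dim \<tau> + 1" "\<eta> \<subseteq> \<sigma>"
        using that \<open>dim \<tau> + 1 = d\<close> \<tau>(3) unfolding A_def cones_def by auto
      note nl = normal_lift[OF \<sigma>(1) \<tau>(2) \<sigma>(2,3)]
      have "?n \<sigma> \<in> cone_lattice (quot_lattice N \<eta>) (quot \<eta> ` \<sigma>) \<and>
          quot (quot \<eta> ` \<tau>) (?n \<sigma>) = normal_gen (quot_lattice N \<eta>) (quot \<eta> ` \<tau>) (quot \<eta> ` \<sigma>)"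
        unfolding normal_lift_def[of "quot_lattice N \<eta>"]
        by (rule someI[of _ "quot \<eta> (normal_lift N \<tau> \<sigma>)"])
          (use nl in \<open>auto simp: cone_lattice_quot[OF \<sigma>(4)] normal_gen_quot[OF \<tau>(3) \<sigma>(2)] quot_quot[OF \<tau>(3)]\<close>)
      then show ?thesis
        unfolding cone_lattice_quot[OF \<sigma>(4)] normal_gen_quot[OF \<tau>(3) \<sigma>(2)]
        using quot_quot[OF \<tau>(3)] by auto
    qed
    then obtain u where u: "\<And>\<sigma>. \<sigma> \<in> A \<Longrightarrow> u \<sigma> \<in> cone_lattice N \<sigma>"
      "\<And>\<sigma>. \<sigma> \<in> A \<Longrightarrow> quot \<tau> (u \<sigma>) = normal_gen N \<tau> \<sigma>" "\<And>\<sigma>. \<sigma> \<in> A \<Longrightarrow> ?n \<sigma> = quot \<eta> (u \<sigma>)"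
      by metis
    have cf: "cone_form g (quot \<eta> ` \<sigma>) (quot \<eta> x) = h \<sigma> x" if "\<sigma> \<in> \<Sigma>" "\<eta> \<subseteq> \<sigma>" "x \<in> span \<sigma>" for \<sigma> x
    proof -
      have "cone_form g (quot \<eta> ` \<sigma>) (quot \<eta> x) = h \<sigma> (quot \<eta> x)"
        by (rule cone_form_eq)
          (use that gh lh in \<open>auto simp: linear_span_image[OF linear_quot]\<close>)
      then show ?thesis using hq that by simp
    qed
    have "(\<Sum>\<sigma>'\<in>{\<sigma>' \<in> cones (star_fan \<Sigma> \<eta>) (d - dim \<eta>). quot \<eta> ` \<tau> \<subseteq> \<sigma>'}.
        cone_form g \<sigma>' (normal_lift (quot_lattice N \<eta>) (quot \<eta> ` \<tau>) \<sigma>'))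
      = (\<Sum>\<sigma>\<in>A. cone_form g (quot \<eta> ` \<sigma>) (?n \<sigma>))"
      unfolding star_cones_containing(1)[OF \<eta> \<tau>(2,3)] A_def
      by (rule sum.reindex_cong[OF star_cones_containing(2)[OF \<eta> \<tau>(2,3)] refl refl])
    also have "\<dots> = (\<Sum>\<sigma>\<in>A. cone_form f \<sigma> (u \<sigma>) - m (u \<sigma>))"
    proof (rule sum.cong)
      fix \<sigma> assume \<sigma>: "\<sigma> \<in> A"
      then have "\<sigma> \<in> \<Sigma>" "\<eta> \<subseteq> \<sigma>" "u \<sigma> \<in> span \<sigma>"
        using \<tau>(3) u(1) unfolding A_def cones_def cone_lattice_def by auto
      from cf[OF this] show "cone_form g (quot \<eta> ` \<sigma>) (?n \<sigma>) = cone_form f \<sigma> (u \<sigma>) - m (u \<sigma>)"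
        using u(3)[OF \<sigma>] unfolding h_def by simp
    qed simp
    finally have 1: "(\<Sum>\<sigma>'\<in>{\<sigma>' \<in> cones (star_fan \<Sigma> \<eta>) (d - dim \<eta>). quot \<eta> ` \<tau> \<subseteq> \<sigma>'}.
        cone_form g \<sigma>' (normal_lift (quot_lattice N \<eta>) (quot \<eta> ` \<tau>) \<sigma>'))
      = (\<Sum>\<sigma>\<in>A. cone_form f \<sigma> (u \<sigma>) - m (u \<sigma>))" .
    have "(\<Sum>\<sigma>'\<in>{\<sigma>' \<in> cones (star_fan \<Sigma> \<eta>) (d - dim \<eta>). quot \<eta> ` \<tau> \<subseteq> \<sigma>'}.
        normal_lift (quot_lattice N \<eta>) (quot \<eta> ` \<tau>) \<sigma>') = (\<Sum>\<sigma>\<in>A. ?n \<sigma>)"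
      unfolding star_cones_containing(1)[OF \<eta> \<tau>(2,3)] A_def
      by (rule sum.reindex_cong[OF star_cones_containing(2)[OF \<eta> \<tau>(2,3)] refl refl])
    also have "\<dots> = quot \<eta> (\<Sum>\<sigma>\<in>A. u \<sigma>)" unfolding quot_sum using u(3) by (intro sum.cong) auto
    finally have "cone_form g (quot \<eta> ` \<tau>) (\<Sum>\<sigma>'\<in>{\<sigma>' \<in> cones (star_fan \<Sigma> \<eta>) (d - dim \<eta>). quot \<eta> ` \<tau> \<subseteq> \<sigma>'}.
        normal_lift (quot_lattice N \<eta>) (quot \<eta> ` \<tau>) \<sigma>')
      = cone_form g (quot \<eta> ` \<tau>) (quot \<eta> (\<Sum>\<sigma>\<in>A. u \<sigma>))" by simp
    also have "\<dots> = h \<tau> (\<Sum>\<sigma>\<in>A. u \<sigma>)"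
      unfolding A_def by (intro cf \<tau> normal_lifts_sum_in_span[OF c1] u(2)) (simp add: A_def)
    finally have 2: "cone_form g (quot \<eta> ` \<tau>) (\<Sum>\<sigma>'\<in>{\<sigma>' \<in> cones (star_fan \<Sigma> \<eta>) (d - dim \<eta>). quot \<eta> ` \<tau> \<subseteq> \<sigma>'}.
        normal_lift (quot_lattice N \<eta>) (quot \<eta> ` \<tau>) \<sigma>') = h \<tau> (\<Sum>\<sigma>\<in>A. u \<sigma>)" .
    have "ord_div N \<Sigma> d f \<tau> = - (\<Sum>\<sigma>\<in>A. cone_form f \<sigma> (u \<sigma>) - m (u \<sigma>)) + h \<tau> (\<Sum>\<sigma>\<in>A. u \<sigma>)"
      unfolding h_def A_def by (rule ord_div_eq[OF c1 lm]) (use u(2) in \<open>auto simp: A_def\<close>)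
    then show "ord_div (quot_lattice N \<eta>) (star_fan \<Sigma> \<eta>) (d - dim \<eta>) g (quot \<eta> ` \<tau>) = ord_div N \<Sigma> d f \<tau>"
      unfolding ord_div_def[of "quot_lattice N \<eta>"] 1 2 by simp
  qed
  ultimately show thesis using that g by blast
qed

text \<open>The form of \<open>f\<close> on \<open>\<eta>\<close> is integral on
  \<open>N \<inter> span \<eta>\<close>; \<open>integral_form_extend\<close> makes it integral on
  all of \<open>N\<close>.\<close>

lemma integral_form_on_cone:
  assumes \<eta>: "\<eta> \<in> \<Sigma>"
  obtains m where "integral_form N m" "\<And>x. x \<in> \<eta> \<Longrightarrow> m x = f x"
proof -
  obtain S where S: "finite S" "S \<subseteq> N" "\<eta> = convex_cone hull S" "span S = span \<eta>" "S \<subseteq> \<eta>"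
    by (rule cone_generators[OF \<eta>])
  have "\<exists>m. integral_form N m \<and> (\<forall>x\<in>span S. m x = cone_form f \<eta> x)"
    by (rule integral_form_extend[OF lattice S(2) linear_cone_form[OF \<eta>]])
      (use cone_form_int[OF \<eta>] S(4) in \<open>auto simp: cone_lattice_def\<close>)
  then obtain m where m: "integral_form N m" "\<And>x. x \<in> span \<eta> \<Longrightarrow> m x = cone_form f \<eta> x"
    using S(4) by auto
  show thesis by (rule that[OF m(1)]) (use m(2) cone_form_in[OF \<eta>] in \<open>auto simp: span_base\<close>)
qed

text \<open>
  \<open>\<eta> \<notin> \<Delta>\<close> forces \<open>ord\<^sub>\<tau>(f) = 0\<close> for all \<open>\<tau> \<supseteq> \<eta>\<close>, since \<open>\<Delta>\<close> contains all faces of its cones.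
\<close>

lemma linear_on_star:
  assumes red: "div_reduced N \<Sigma> d f" and faithful: "div_faithful N \<Sigma> d"
    and \<eta>: "\<eta> \<in> \<Sigma>" "\<eta> \<notin> div_subfan N \<Sigma> d f"
  obtains m where "integral_form N m" "\<And>\<zeta> x. \<zeta> \<in> \<Sigma> \<Longrightarrow> \<eta> \<subseteq> \<zeta> \<Longrightarrow> x \<in> \<zeta> \<Longrightarrow> f x = m x"
proof -
  obtain m where m: "integral_form N m" "\<And>x. x \<in> \<eta> \<Longrightarrow> m x = f x" using integral_form_on_cone[OF \<eta>(1)] by blast
  obtain g where g: "conewise_integral_linear (quot_lattice N \<eta>) (star_fan \<Sigma> \<eta>) g"
    "\<And>\<zeta> x. \<zeta> \<in> \<Sigma> \<Longrightarrow> \<eta> \<subseteq> \<zeta> \<Longrightarrow> x \<in> \<zeta> \<Longrightarrow> g (quot \<eta> x) = f x - m x"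
    "\<And>\<tau>. quot \<eta> ` \<tau> \<in> codim1_cones (star_fan \<Sigma> \<eta>) (d - dim \<eta>) \<Longrightarrow> \<tau> \<in> \<Sigma> \<Longrightarrow> \<eta> \<subseteq> \<tau> \<Longrightarrow>
       \<tau> \<in> codim1_cones \<Sigma> d \<and>
       ord_div (quot_lattice N \<eta>) (star_fan \<Sigma> \<eta>) (d - dim \<eta>) g (quot \<eta> ` \<tau>) = ord_div N \<Sigma> d f \<tau>"
    by (rule star_function[OF \<eta>(1) m]) blast+
  have "div_trivial (quot_lattice N \<eta>) (star_fan \<Sigma> \<eta>) (d - dim \<eta>) g"
    unfolding div_trivial_def
  proof
    fix \<tau>' assume t: "\<tau>' \<in> codim1_cones (star_fan \<Sigma> \<eta>) (d - dim \<eta>)"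
    then obtain \<tau> where \<tau>: "\<tau> \<in> \<Sigma>" "\<eta> \<subseteq> \<tau>" "\<tau>' = quot \<eta> ` \<tau>" unfolding codim1_cones_def star_fan_def by auto
    note * = g(3)[OF t[unfolded \<tau>(3)] \<tau>(1,2)]
    have "ord_div N \<Sigma> d f \<tau> \<noteq> 1"
      using \<eta> * cone_face_iff[OF \<tau>(1) \<eta>(1)] \<tau>(2) unfolding div_subfan_def by auto
    then show "ord_div (quot_lattice N \<eta>) (star_fan \<Sigma> \<eta>) (d - dim \<eta>) g \<tau>' = 0"
      using * red \<tau>(3) unfolding div_reduced_def by auto
  qed
  then obtain l where l: "integral_form (quot_lattice N \<eta>) l" "\<forall>x\<in>\<Union>(star_fan \<Sigma> \<eta>). g x = l x"
    using faithful g(1) \<eta>(1) unfolding div_faithful_def by blast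
  \<comment> \<open>Undoes the subtraction of \<open>m\<close>: on the star, \<open>f\<close> is
    \<open>m\<close> plus the pullback of the form \<open>l\<close> that div-faithfulness
    provides.\<close>
  have "linear (\<lambda>x. m x + l (quot \<eta> x))"
    using m(1) l(1) linear_compose[OF linear_quot[of \<eta>], of l] unfolding integral_form_def comp_def
    by (intro linear_compose_add) auto
  moreover have "m x + l (quot \<eta> x) \<in> \<int>" if "x \<in> N" for x
    using that m(1) l(1) unfolding integral_form_def quot_lattice_def by (intro Ints_add) auto
  ultimately have "integral_form N (\<lambda>x. m x + l (quot \<eta> x))" unfolding integral_form_def by auto
  moreover have "f x = m x + l (quot \<eta> x)" if "\<zeta> \<in> \<Sigma>" "\<eta> \<subseteq> \<zeta>" "x \<in> \<zeta>" for \<zeta> x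
    using g(2)[OF that] l(2) that unfolding star_fan_def by auto
  ultimately show thesis using that by blast
qed

end

section \<open>Integral polynomials and their quotients\<close>

definition monomial_value :: "('v \<Rightarrow> 'b::comm_monoid_mult) \<Rightarrow> ('v \<Rightarrow>\<^sub>0 nat) \<Rightarrow> 'b" where
  "monomial_value s m = (\<Prod>v\<in>Poly_Mapping.keys m. s v ^ Poly_Mapping.lookup m v)"

definition mpoly_subst :: "('v \<Rightarrow> 'b::comm_ring_1) \<Rightarrow> 'v int_mpoly \<Rightarrow> 'b" where
  "mpoly_subst s p = (\<Sum>m\<in>Poly_Mapping.keys p. of_int (Poly_Mapping.lookup p m) * monomial_value s m)"

lemma monomial_value_superset:
  assumes "finite A" "Poly_Mapping.keys m \<subseteq> A"
  shows "monomial_value s m = (\<Prod>v\<in>A. s v ^ Poly_Mapping.lookup m v)"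
  unfolding monomial_value_def
  by (rule prod.mono_neutral_left) (use assms in \<open>auto simp: in_keys_iff\<close>)

lemma monomial_value_add: "monomial_value s (m + n) = monomial_value s m * monomial_value s n"
proof -
  let ?A = "Poly_Mapping.keys m \<union> Poly_Mapping.keys n"
  have "finite ?A" by simp
  then show ?thesis
    using monomial_value_superset[of ?A m s] monomial_value_superset[of ?A n s]
      monomial_value_superset[of ?A "m + n" s] Poly_Mapping.keys_add[of m n]
    by (simp add: lookup_add power_add prod.distrib)
qed

lemma monomial_value_zero [simp]: "monomial_value s 0 = 1"
  unfolding monomial_value_def by simp

lemma monomial_value_single: "monomial_value s (Poly_Mapping.single v 1) = s v"
  unfolding monomial_value_def by (simp del: One_nat_def)

lemma mpoly_subst_superset:
  assumes "finite A" "Poly_Mapping.keys p \<subseteq> A"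
  shows "mpoly_subst s p = (\<Sum>m\<in>A. of_int (Poly_Mapping.lookup p m) * monomial_value s m)"
  unfolding mpoly_subst_def
  by (rule sum.mono_neutral_left) (use assms in \<open>auto simp: in_keys_iff\<close>)

lemma mpoly_subst_add: "mpoly_subst s (p + q) = mpoly_subst s p + mpoly_subst s q"
proof -
  let ?A = "Poly_Mapping.keys p \<union> Poly_Mapping.keys q"
  have "finite ?A" by simp
  then show ?thesis
    using mpoly_subst_superset[of ?A p s] mpoly_subst_superset[of ?A q s]
      mpoly_subst_superset[of ?A "p + q" s] Poly_Mapping.keys_add[of p q]
    by (simp add: lookup_add distrib_right sum.distrib)
qed

lemma mpoly_subst_zero [simp]: "mpoly_subst s 0 = 0"
  unfolding mpoly_subst_def by simp

lemma mpoly_subst_single [simp]: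
  "mpoly_subst s (Poly_Mapping.single m c) = of_int c * monomial_value s m"
  unfolding mpoly_subst_def by simp

lemma mpoly_sum_singles:
  "(\<Sum>m\<in>Poly_Mapping.keys p. Poly_Mapping.single m (Poly_Mapping.lookup p m)) = p"
  by (rule poly_mapping_eqI) (auto simp: lookup_sum lookup_single in_keys_iff when_def)

lemma mpoly_induct [case_names zero add single]:
  assumes "P 0" "\<And>p q. P p \<Longrightarrow> P q \<Longrightarrow> P (p + q)" "\<And>m c. P (Poly_Mapping.single m c)"
  shows "P (p :: 'v int_mpoly)"
proof -
  have "P (\<Sum>m\<in>A. Poly_Mapping.single m (Poly_Mapping.lookup p m))" for A
    by (induction A rule: infinite_finite_induct) (auto intro: assms)
  then show ?thesis using mpoly_sum_singles by metis
qed

lemma mpoly_subst_mult: "mpoly_subst s (p * q) = mpoly_subst s p * mpoly_subst s q"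
proof (induction p rule: mpoly_induct)
  case (single m c)
  show ?case
  proof (induction q rule: mpoly_induct)
    case (single n e)
    show ?case by (simp add: mult_single monomial_value_add algebra_simps)
  qed (simp_all add: mpoly_subst_add distrib_left)
qed (simp_all add: mpoly_subst_add distrib_right)

lemma mpoly_subst_one [simp]: "mpoly_subst s 1 = 1"
  using mpoly_subst_single[of s 0 1] by (simp del: mpoly_subst_single)

lemma mpoly_subst_mvar [simp]: "mpoly_subst s (mvar v) = s v"
  unfolding mvar_def mpoly_subst_single monomial_value_single by simp

lemma mpoly_subst_uminus: "mpoly_subst s (- p) = - mpoly_subst s p"
  using mpoly_subst_add[of s p "- p"] by (simp add: eq_neg_iff_add_eq_0 add.commute)

lemma mpoly_subst_of_nat [simp]: "mpoly_subst s (of_nat k) = of_nat k"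
  by (induction k) (simp_all add: mpoly_subst_add)

lemma mpoly_subst_of_int [simp]: "mpoly_subst s (of_int k) = of_int k"
  by (cases k rule: int_cases2) (simp_all add: mpoly_subst_uminus)

lemma mpoly_subst_sum: "mpoly_subst s (sum x A) = (\<Sum>a\<in>A. mpoly_subst s (x a))"
  by (induction A rule: infinite_finite_induct) (simp_all add: mpoly_subst_add)

lemma mpoly_subst_prod: "mpoly_subst s (prod x A) = (\<Prod>a\<in>A. mpoly_subst s (x a))"
  by (induction A rule: infinite_finite_induct) (simp_all add: mpoly_subst_mult)

definition mpolys :: "'v set \<Rightarrow> 'v int_mpoly set" where
  "mpolys V = {p. \<forall>m\<in>Poly_Mapping.keys p. Poly_Mapping.keys m \<subseteq> V}"

lemma mpolys_add: "p \<in> mpolys V \<Longrightarrow> q \<in> mpolys V \<Longrightarrow> p + q \<in> mpolys V"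
  unfolding mpolys_def using Poly_Mapping.keys_add[of p q] by blast

lemma mpolys_mult: "p \<in> mpolys V \<Longrightarrow> q \<in> mpolys V \<Longrightarrow> p * q \<in> mpolys V"
proof -
  assume a: "p \<in> mpolys V" "q \<in> mpolys V"
  have "Poly_Mapping.keys m \<subseteq> V" if "m \<in> Poly_Mapping.keys (p * q)" for m
  proof -
    have "m \<in> {a + b | a b. a \<in> Poly_Mapping.keys p \<and> b \<in> Poly_Mapping.keys q}"
      using that keys_mult[of p q] by (rule rev_subsetD)
    then obtain a b where "m = a + b" "a \<in> Poly_Mapping.keys p" "b \<in> Poly_Mapping.keys q" by blast
    then show ?thesis using a Poly_Mapping.keys_add[of a b] unfolding mpolys_def by blast
  qed
  then show ?thesis unfolding mpolys_def by blast
qed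

lemma mpolys_zero [simp]: "0 \<in> mpolys V" and mpolys_one [simp]: "1 \<in> mpolys V"
  unfolding mpolys_def by auto

lemma mpolys_uminus: "p \<in> mpolys V \<Longrightarrow> - p \<in> mpolys V"
  unfolding mpolys_def by simp

lemma mpolys_of_int [simp]: "of_int k \<in> mpolys V"
proof -
  have "of_nat n \<in> mpolys V" for n by (induction n) (auto intro: mpolys_add)
  then show ?thesis by (cases k rule: int_cases2) (auto intro: mpolys_uminus)
qed

lemma mpolys_mvar: "v \<in> V \<Longrightarrow> mvar v \<in> mpolys V"
  unfolding mpolys_def mvar_def by simp

lemma mpolys_sum: "(\<And>a. a \<in> A \<Longrightarrow> x a \<in> mpolys V) \<Longrightarrow> sum x A \<in> mpolys V"
  by (induction A rule: infinite_finite_induct) (auto intro: mpolys_add)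

lemma mpolys_prod: "(\<And>a. a \<in> A \<Longrightarrow> x a \<in> mpolys V) \<Longrightarrow> prod x A \<in> mpolys V"
  by (induction A rule: infinite_finite_induct) (auto intro: mpolys_mult)

lemma single_monomial_add:
  "(Poly_Mapping.single (m + n) 1 :: 'v int_mpoly) = Poly_Mapping.single m 1 * Poly_Mapping.single n 1"
  by (simp add: mult_single)

lemma single_eq_mvar_power: "Poly_Mapping.single (Poly_Mapping.single v k) 1 = (mvar v :: 'v int_mpoly) ^ k"
proof (induction k)
  case (Suc k)
  have "Poly_Mapping.single v (Suc k) = Poly_Mapping.single v 1 + Poly_Mapping.single v k"
    by (simp flip: single_add)
  then show ?case using Suc by (simp only: mvar_def single_monomial_add power_Suc)
qed simp

lemma mpoly_single: "Poly_Mapping.single m c = of_int c * monomial_value mvar m"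
proof -
  have m: "Poly_Mapping.single m 1 = (monomial_value mvar m :: 'a int_mpoly)" for m
  proof -
    have eq: "m = (\<Sum>v\<in>Poly_Mapping.keys m. Poly_Mapping.single v (Poly_Mapping.lookup m v))"
      by (rule poly_mapping_eqI) (auto simp: lookup_sum lookup_single in_keys_iff when_def)
    have "Poly_Mapping.single (\<Sum>v\<in>A. Poly_Mapping.single v (Poly_Mapping.lookup m v)) 1
        = (\<Prod>v\<in>A. (mvar v :: 'a int_mpoly) ^ Poly_Mapping.lookup m v)" if "finite A" for A
      using that
    proof (induction A rule: finite_induct)
      case (insert a A)
      then show ?case
        by (simp only: sum.insert prod.insert single_monomial_add single_eq_mvar_power simp_thms)
    qed simp
    from this[of "Poly_Mapping.keys m"] show ?thesis unfolding monomial_value_def using eq by simp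
  qed
  have "of_int c = Poly_Mapping.single (0 :: 'a \<Rightarrow>\<^sub>0 nat) c" by (simp flip: single_of_int)
  then show ?thesis by (simp add: mult_single flip: m)
qed

lemma mpoly_subst_id: "mpoly_subst mvar p = p"
  unfolding mpoly_subst_def mpoly_single[symmetric] by (rule mpoly_sum_singles)

text \<open>In contrast to \<open>mpoly_induct\<close>, the induction never leaves the polynomials
  in the variables \<open>V\<close>, so statements about substitutions need checking only on
  constants and on variables from \<open>V\<close>.\<close>

lemma mpolys_induct [consumes 1, case_names const mvar add mult]:
  assumes p: "p \<in> mpolys V"
    and P: "\<And>k. P (of_int k)" "\<And>v. v \<in> V \<Longrightarrow> P (mvar v)"
      "\<And>p q. p \<in> mpolys V \<Longrightarrow> q \<in> mpolys V \<Longrightarrow> P p \<Longrightarrow> P q \<Longrightarrow> P (p + q)"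
      "\<And>p q. p \<in> mpolys V \<Longrightarrow> q \<in> mpolys V \<Longrightarrow> P p \<Longrightarrow> P q \<Longrightarrow> P (p * q)"
  shows "P p"
proof -
  have P01: "P 0" "P 1" using P(1)[of 0] P(1)[of 1] by auto
  have pow: "mvar v ^ k \<in> mpolys V \<and> P (mvar v ^ k)" if "v \<in> V" for v k
    using that by (induction k) (auto intro: P P01 mpolys_mult mpolys_mvar)
  have "monomial_value mvar m \<in> mpolys V \<and> P (monomial_value mvar m)"
    if m: "m \<in> Poly_Mapping.keys p" for m
  proof -
    have "(\<Prod>v\<in>A. mvar v ^ Poly_Mapping.lookup m v) \<in> mpolys V \<and>
        P (\<Prod>v\<in>A. mvar v ^ Poly_Mapping.lookup m v)" if "A \<subseteq> V" for A
      using that by (induction A rule: infinite_finite_induct) (use pow in \<open>auto intro: P P01 mpolys_mult\<close>)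
    then show ?thesis unfolding monomial_value_def using p m unfolding mpolys_def by auto
  qed
  then have c: "of_int (Poly_Mapping.lookup p m) * monomial_value mvar m \<in> mpolys V \<and>
      P (of_int (Poly_Mapping.lookup p m) * monomial_value mvar m)" if "m \<in> Poly_Mapping.keys p" for m
    using that by (auto intro: P mpolys_mult)
  have "(\<Sum>m\<in>A. of_int (Poly_Mapping.lookup p m) * monomial_value mvar m) \<in> mpolys V \<and>
      P (\<Sum>m\<in>A. of_int (Poly_Mapping.lookup p m) * monomial_value mvar m)"
    if "A \<subseteq> Poly_Mapping.keys p" for A
    using that by (induction A rule: infinite_finite_induct) (use P01 c in \<open>auto intro: P mpolys_add\<close>)
  from this[of "Poly_Mapping.keys p"] show ?thesis
    using mpoly_subst_id[of p] unfolding mpoly_subst_def by simp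
qed

lemma mpoly_subst_closed:
  assumes "\<And>v. v \<in> V \<Longrightarrow> s v \<in> mpolys W" "p \<in> mpolys V"
  shows "mpoly_subst s p \<in> mpolys W"
  using assms(2)
  by (induction rule: mpolys_induct) (auto simp: mpoly_subst_add mpoly_subst_mult intro: assms(1) mpolys_add mpolys_mult)

lemma mpoly_subst_subst:
  "mpoly_subst t (mpoly_subst s p) = mpoly_subst (\<lambda>v. mpoly_subst t (s v)) (p :: 'v int_mpoly)"
proof -
  have "p \<in> mpolys UNIV" unfolding mpolys_def by simp
  then show ?thesis by (induction rule: mpolys_induct) (simp_all add: mpoly_subst_add mpoly_subst_mult)
qed

section \<open>Degrees and homogeneous polynomials\<close>

definition mono_degree :: "('v \<Rightarrow>\<^sub>0 nat) \<Rightarrow> nat" where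
  "mono_degree m = (\<Sum>v\<in>Poly_Mapping.keys m. Poly_Mapping.lookup m v)"

lemma homogeneous_iff: "homogeneous k p \<longleftrightarrow> (\<forall>m\<in>Poly_Mapping.keys p. mono_degree m = k)"
  unfolding homogeneous_def mono_degree_def ..

lemma mono_degree_add: "mono_degree (m + n) = mono_degree m + mono_degree n"
proof -
  have sup: "mono_degree l = (\<Sum>v\<in>A. Poly_Mapping.lookup l v)"
    if "finite A" "Poly_Mapping.keys l \<subseteq> A" for l :: "'a \<Rightarrow>\<^sub>0 nat" and A
    unfolding mono_degree_def by (rule sum.mono_neutral_left) (use that in \<open>auto simp: in_keys_iff\<close>)
  let ?A = "Poly_Mapping.keys m \<union> Poly_Mapping.keys n"
  have "finite ?A" by simp
  then show ?thesis
    using sup[of ?A m] sup[of ?A n] sup[of ?A "m + n"] Poly_Mapping.keys_add[of m n]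
    by (simp add: lookup_add sum.distrib)
qed

lemma homogeneous_zero: "homogeneous k 0"
  unfolding homogeneous_def by simp

lemma homogeneous_of_int: "homogeneous 0 (of_int c)"
proof -
  have "of_int c = Poly_Mapping.single (0 :: 'a \<Rightarrow>\<^sub>0 nat) c" by (simp flip: single_of_int)
  then show ?thesis unfolding homogeneous_def by auto
qed

lemma homogeneous_one: "homogeneous 0 1"
  using homogeneous_of_int[of 1] by simp

lemma homogeneous_add: "homogeneous k p \<Longrightarrow> homogeneous k q \<Longrightarrow> homogeneous k (p + q)"
  unfolding homogeneous_iff using Poly_Mapping.keys_add[of p q] by blast

lemma homogeneous_mult: "homogeneous k p \<Longrightarrow> homogeneous l q \<Longrightarrow> homogeneous (k + l) (p * q)"
  unfolding homogeneous_iff using keys_mult[of p q] by (fastforce simp: mono_degree_add)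

lemma homogeneous_uminus: "homogeneous k p \<Longrightarrow> homogeneous k (- p)"
  unfolding homogeneous_iff by simp

lemma homogeneous_mvar: "homogeneous 1 (mvar v)"
  unfolding homogeneous_def mvar_def by simp

lemma homogeneous_const_mult: "homogeneous k p \<Longrightarrow> homogeneous k (of_int c * p)"
  using homogeneous_mult[OF homogeneous_of_int[of c]] by fastforce

lemma homogeneous_sum: "(\<And>a. a \<in> A \<Longrightarrow> homogeneous k (x a)) \<Longrightarrow> homogeneous k (sum x A)"
  by (induction A rule: infinite_finite_induct) (auto intro: homogeneous_add homogeneous_zero)

lemma homogeneous_prod: "(\<And>a. a \<in> A \<Longrightarrow> homogeneous 1 (x a)) \<Longrightarrow> finite A \<Longrightarrow> homogeneous (card A) (prod x A)"
proof (induction A rule: infinite_finite_induct)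
  case (insert a A)
  then have "homogeneous (1 + card A) (x a * prod x A)" by (intro homogeneous_mult) auto
  then show ?case using insert by simp
qed (auto intro: homogeneous_one)

lemma homogeneous_subst:
  assumes "\<And>v. homogeneous 1 (s v)" "homogeneous k p"
  shows "homogeneous k (mpoly_subst s p)"
  unfolding mpoly_subst_def
proof (rule homogeneous_sum)
  fix m assume m: "m \<in> Poly_Mapping.keys p"
  have pow: "homogeneous j (s v ^ j)" for v j
  proof (induction j)
    case (Suc j)
    then show ?case using homogeneous_mult[OF assms(1)[of v] Suc] by simp
  qed (simp add: homogeneous_one)
  have "homogeneous (\<Sum>v\<in>A. Poly_Mapping.lookup m v) (\<Prod>v\<in>A. s v ^ Poly_Mapping.lookup m v)" if "finite A" for A
    using that
    by (induction A rule: finite_induct) (auto intro: homogeneous_one homogeneous_mult pow)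
  from this[of "Poly_Mapping.keys m"] have "homogeneous k (monomial_value s m)"
    using assms(2) m unfolding monomial_value_def homogeneous_def by auto
  then show "homogeneous k (of_int (Poly_Mapping.lookup p m) * monomial_value s m)"
    by (rule homogeneous_const_mult)
qed

section \<open>Polynomial rings as structures, their ideals and quotients\<close>

lemma mpoly_ring_simps [simp]:
  "carrier (mpoly_ring V) = mpolys V" "mult (mpoly_ring V) = (*)" "one (mpoly_ring V) = 1"
  "zero (mpoly_ring V) = 0" "add (mpoly_ring V) = (+)"
  unfolding mpoly_ring_def mpolys_def by simp_all

lemma cring_mpoly_ring: "cring (mpoly_ring V)"
proof (rule cringI)
  show "abelian_group (mpoly_ring V)"
    by (rule abelian_groupI)
      (auto simp: algebra_simps intro: mpolys_add bexI[of _ "- _"] mpolys_uminus)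
  show "comm_monoid (mpoly_ring V)"
    by (rule comm_monoidI) (auto simp: algebra_simps intro: mpolys_mult)
qed (simp add: algebra_simps)

lemma ring_mpoly_ring: "ring (mpoly_ring V)"
  using cring_mpoly_ring cring.axioms(1) by blast

lemma mpoly_ring_a_inv:
  assumes "p \<in> mpolys V" shows "a_inv (mpoly_ring V) p = - p"
proof -
  interpret ring "mpoly_ring V" by (rule ring_mpoly_ring)
  have "p \<oplus>\<^bsub>mpoly_ring V\<^esub> (- p) = \<zero>\<^bsub>mpoly_ring V\<^esub>" by simp
  then show ?thesis using minus_equality[of "- p" p] assms mpolys_uminus[OF assms] by (simp add: add.commute)
qed

text \<open>Translates the ideal predicate into arithmetic of the polynomial type; closure under
  negation is hidden in multiplication by \<open>- 1\<close>.\<close>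

lemma mpoly_ideal_iff:
  "ideal I (mpoly_ring V) \<longleftrightarrow> I \<subseteq> mpolys V \<and> 0 \<in> I \<and> (\<forall>p\<in>I. \<forall>q\<in>I. p + q \<in> I) \<and>
     (\<forall>p\<in>I. \<forall>r\<in>mpolys V. r * p \<in> I)"
proof
  assume "ideal I (mpoly_ring V)"
  then interpret ideal I "mpoly_ring V" .
  show "I \<subseteq> mpolys V \<and> 0 \<in> I \<and> (\<forall>p\<in>I. \<forall>q\<in>I. p + q \<in> I) \<and>
     (\<forall>p\<in>I. \<forall>r\<in>mpolys V. r * p \<in> I)"
    using a_subset I_l_closed additive_subgroup.a_closed[OF is_additive_subgroup]
      additive_subgroup.zero_closed[OF is_additive_subgroup] by auto
next
  assume a: "I \<subseteq> mpolys V \<and> 0 \<in> I \<and> (\<forall>p\<in>I. \<forall>q\<in>I. p + q \<in> I) \<and> (\<forall>p\<in>I. \<forall>r\<in>mpolys V. r * p \<in> I)"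
  interpret ring "mpoly_ring V" by (rule ring_mpoly_ring)
  have neg: "- p \<in> I" if "p \<in> I" for p
  proof -
    have "- 1 \<in> mpolys V" by (intro mpolys_uminus mpolys_one)
    with a that have "- 1 * p \<in> I" by blast
    then show ?thesis by simp
  qed
  have "subgroup I (add_monoid (mpoly_ring V))"
  proof (rule group.subgroupI[OF a_group])
    fix p assume p: "p \<in> I"
    then have "inv\<^bsub>add_monoid (mpoly_ring V)\<^esub> p = - p"
      using mpoly_ring_a_inv[of p V] a unfolding a_inv_def by auto
    then show "inv\<^bsub>add_monoid (mpoly_ring V)\<^esub> p \<in> I" using neg p by simp
  next
    show "I \<noteq> {}" using a by blast
  qed (use a in simp_all)
  then show "ideal I (mpoly_ring V)"
  proof (rule idealI[OF ring_mpoly_ring])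
    fix p r assume p: "p \<in> I" "r \<in> carrier (mpoly_ring V)"
    then have "r * p \<in> I" using a by simp
    then show "r \<otimes>\<^bsub>mpoly_ring V\<^esub> p \<in> I" "p \<otimes>\<^bsub>mpoly_ring V\<^esub> r \<in> I" by (simp_all add: mult.commute)
  qed
qed

text \<open>Combined with minimality of the Chow ideal, this reduces the inclusion of one ideal in
  the preimage of another to a check on generators.\<close>

lemma ideal_vimage_subst:
  assumes "ideal I (mpoly_ring W)" "\<And>v. v \<in> V \<Longrightarrow> s v \<in> mpolys W"
  shows "ideal {p \<in> mpolys V. mpoly_subst s p \<in> I} (mpoly_ring V)"
  using assms(1) mpoly_subst_closed[of V s W] assms(2) unfolding mpoly_ideal_iff
  by (auto simp: mpoly_subst_add mpoly_subst_mult intro: mpolys_add mpolys_mult)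

lemma mpoly_coset_eq_iff:
  assumes "ideal I (mpoly_ring V)" "p \<in> mpolys V" "q \<in> mpolys V"
  shows "I +>\<^bsub>mpoly_ring V\<^esub> p = I +>\<^bsub>mpoly_ring V\<^esub> q \<longleftrightarrow> p - q \<in> I"
  using ring.quotient_eq_iff_same_a_r_cos[OF ring_mpoly_ring assms(1), of p q] assms(2,3)
  by (simp add: a_minus_def mpoly_ring_a_inv)

lemma subst_congruent_id:
  assumes I: "ideal I (mpoly_ring V)" and s: "\<And>v. v \<in> V \<Longrightarrow> s v \<in> mpolys V"
    and v: "\<And>v. v \<in> V \<Longrightarrow> s v - mvar v \<in> I" and p: "p \<in> mpolys V"
  shows "mpoly_subst s p - p \<in> I"
  using p
proof (induction rule: mpolys_induct)
  case (const k)
  then show ?case using I unfolding mpoly_ideal_iff by simp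
next
  case (mvar u)
  then show ?case using v by simp
next
  case (add p q)
  have "mpoly_subst s (p + q) - (p + q) = (mpoly_subst s p - p) + (mpoly_subst s q - q)"
    by (simp add: mpoly_subst_add)
  then show ?case using add I unfolding mpoly_ideal_iff by metis
next
  case (mult p q)
  have "mpoly_subst s (p * q) - p * q
      = mpoly_subst s q * (mpoly_subst s p - p) + p * (mpoly_subst s q - q)"
    by (simp add: mpoly_subst_mult algebra_simps)
  moreover have "mpoly_subst s q \<in> mpolys V" using mpoly_subst_closed s mult by blast
  ultimately show ?case using mult I unfolding mpoly_ideal_iff by metis
qed

text \<open>Substitutions that invert each other only modulo the ideals suffice. The substitution
  \<open>s\<close> followed by the quotient map is onto by \<open>st\<close>, and its kernel is
  exactly \<open>J\<close> by \<open>IJ\<close> and \<open>ts\<close>.\<close>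

lemma quotient_iso_subst:
  fixes V :: "'v set" and W :: "'w set"
  assumes I: "ideal I (mpoly_ring V)" and J: "ideal J (mpoly_ring W)"
    and s: "\<And>w. w \<in> W \<Longrightarrow> s w \<in> mpolys V" and t: "\<And>v. v \<in> V \<Longrightarrow> t v \<in> mpolys W"
    and JI: "\<And>p. p \<in> J \<Longrightarrow> mpoly_subst s p \<in> I" and IJ: "\<And>p. p \<in> I \<Longrightarrow> mpoly_subst t p \<in> J"
    and ts: "\<And>p. p \<in> mpolys W \<Longrightarrow> mpoly_subst t (mpoly_subst s p) - p \<in> J"
    and st: "\<And>p. p \<in> mpolys V \<Longrightarrow> mpoly_subst s (mpoly_subst t p) - p \<in> I"
  obtains \<phi> where "\<phi> \<in> ring_iso (mpoly_ring W Quot J) (mpoly_ring V Quot I)"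
    and "\<And>p. p \<in> mpolys W \<Longrightarrow> \<phi> (J +>\<^bsub>mpoly_ring W\<^esub> p) = I +>\<^bsub>mpoly_ring V\<^esub> mpoly_subst s p"
proof -
  interpret I: ideal I "mpoly_ring V" by (rule I)
  interpret J: ideal J "mpoly_ring W" by (rule J)
  define h where "h p = I +>\<^bsub>mpoly_ring V\<^esub> mpoly_subst s p" for p
  note sc = mpoly_subst_closed[of W s V, OF s] and tc = mpoly_subst_closed[of V t W, OF t]
  have "mpoly_subst s \<in> ring_hom (mpoly_ring W) (mpoly_ring V)"
    by (rule ring_hom_memI) (auto simp: mpoly_subst_add mpoly_subst_mult sc)
  from ring_hom_trans[OF this I.rcos_ring_hom]
  have h: "h \<in> ring_hom (mpoly_ring W) (mpoly_ring V Quot I)" unfolding h_def comp_def .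
  interpret h: ring_hom_ring "mpoly_ring W" "mpoly_ring V Quot I" h
    by (rule ring_hom_ringI2[OF ring_mpoly_ring I.quotient_is_ring h])
  have zero: "\<zero>\<^bsub>mpoly_ring V Quot I\<^esub> = I +>\<^bsub>mpoly_ring V\<^esub> 0"
    using I.rcos_ring_hom ring_hom_zero[OF I.rcos_ring_hom ring_mpoly_ring I.quotient_is_ring] by simp
  have h0: "h p = \<zero>\<^bsub>mpoly_ring V Quot I\<^esub> \<longleftrightarrow> mpoly_subst s p \<in> I" if "p \<in> mpolys W" for p
    using mpoly_coset_eq_iff[OF I sc[OF _ that] mpolys_zero] unfolding h_def zero by simp
  have ker: "a_kernel (mpoly_ring W) (mpoly_ring V Quot I) h = J"
  proof (intro subset_antisym subsetI)
    fix p assume "p \<in> a_kernel (mpoly_ring W) (mpoly_ring V Quot I) h"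
    then have p: "p \<in> mpolys W" "mpoly_subst s p \<in> I" using h0 unfolding a_kernel_def' by auto
    \<comment> \<open>The expression is \<open>p\<close> written as an element of \<open>J\<close>
      minus an element of \<open>J\<close>: if \<open>s\<close> sends \<open>p\<close> into
      \<open>I\<close>, then \<open>t\<close> brings the result into \<open>J\<close>, and it
      differs from \<open>p\<close> by \<open>J\<close>.\<close>
    then have "mpoly_subst t (mpoly_subst s p) + - 1 * (mpoly_subst t (mpoly_subst s p) - p) \<in> J"
      using J IJ ts mpolys_uminus[OF mpolys_one, of W] unfolding mpoly_ideal_iff by blast
    then show "p \<in> J" by simp
  next
    fix p assume "p \<in> J"
    then show "p \<in> a_kernel (mpoly_ring W) (mpoly_ring V Quot I) h"
      using h0 JI J unfolding a_kernel_def' mpoly_ideal_iff by auto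
  qed
  have surj: "h ` carrier (mpoly_ring W) = carrier (mpoly_ring V Quot I)"
  proof (intro subset_antisym subsetI)
    fix X assume "X \<in> carrier (mpoly_ring V Quot I)"
    then obtain p where p: "p \<in> mpolys V" "X = I +>\<^bsub>mpoly_ring V\<^esub> p"
      unfolding FactRing_def A_RCOSETS_def' by auto
    have "h (mpoly_subst t p) = X"
      unfolding h_def p(2) using mpoly_coset_eq_iff[OF I _ p(1)] st[OF p(1)] sc tc p(1) by blast
    then show "X \<in> h ` carrier (mpoly_ring W)" using tc p(1) by force
  qed (use h.hom_closed in auto)
  show thesis
  proof (rule that)
    show "(\<lambda>X. the_elem (h ` X)) \<in> ring_iso (mpoly_ring W Quot J) (mpoly_ring V Quot I)"
      using h.FactRing_iso_set[OF surj] unfolding ker .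
    show "the_elem (h ` (J +>\<^bsub>mpoly_ring W\<^esub> p)) = I +>\<^bsub>mpoly_ring V\<^esub> mpoly_subst s p"
      if "p \<in> mpolys W" for p
      using h.the_elem_simp[of p] that unfolding ker h_def by simp
  qed
qed

declare One_nat_def [simp del]

section \<open>Chow rings of tropical modifications\<close>

lemma non_cone_monomials_subset: "non_cone_monomials \<Sigma> \<subseteq> mpolys (cones \<Sigma> 1)"
  unfolding non_cone_monomials_def by (auto intro!: mpolys_prod mpolys_mvar)

lemma linear_relations_subset: "linear_relations N \<Sigma> \<subseteq> mpolys (cones \<Sigma> 1)"
  unfolding linear_relations_def by (auto intro!: mpolys_sum mpolys_mult mpolys_mvar)

text \<open>The sum of the two generated ideals is the least ideal containing both families of
  generators; it is used below in this form.\<close>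

lemma chow_ideal:
  shows ideal_chow_ideal: "ideal (chow_ideal N \<Sigma>) (mpoly_ring (cones \<Sigma> 1))"
    and chow_ideal_minimal: "ideal I (mpoly_ring (cones \<Sigma> 1)) \<Longrightarrow> non_cone_monomials \<Sigma> \<subseteq> I \<Longrightarrow>
      linear_relations N \<Sigma> \<subseteq> I \<Longrightarrow> chow_ideal N \<Sigma> \<subseteq> I"
    and non_cone_monomials_in_chow_ideal: "non_cone_monomials \<Sigma> \<subseteq> chow_ideal N \<Sigma>"
    and linear_relations_in_chow_ideal: "linear_relations N \<Sigma> \<subseteq> chow_ideal N \<Sigma>"
proof -
  let ?R = "mpoly_ring (cones \<Sigma> 1)"
  interpret ring ?R by (rule ring_mpoly_ring)
  have sub: "non_cone_monomials \<Sigma> \<subseteq> carrier ?R" "linear_relations N \<Sigma> \<subseteq> carrier ?R"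
    using non_cone_monomials_subset[of \<Sigma>] linear_relations_subset[of N \<Sigma>] by simp_all
  let ?A = "Idl\<^bsub>?R\<^esub> non_cone_monomials \<Sigma>" and ?B = "Idl\<^bsub>?R\<^esub> linear_relations N \<Sigma>"
  have ids: "ideal ?A ?R" "ideal ?B ?R" using genideal_ideal sub by auto
  have ch: "chow_ideal N \<Sigma> = {a + b | a b. a \<in> ?A \<and> b \<in> ?B}"
    unfolding chow_ideal_def ray_ring_def set_add_def' by auto
  show "ideal (chow_ideal N \<Sigma>) ?R"
    unfolding chow_ideal_def ray_ring_def by (rule add_ideals[OF ids])
  have z: "0 \<in> ?A" "0 \<in> ?B" using ids unfolding mpoly_ideal_iff by auto
  show "non_cone_monomials \<Sigma> \<subseteq> chow_ideal N \<Sigma>"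
  proof
    fix p assume "p \<in> non_cone_monomials \<Sigma>"
    then have "p \<in> ?A" using genideal_self[OF sub(1)] by auto
    then have "p + 0 \<in> chow_ideal N \<Sigma>" unfolding ch using z(2) by blast
    then show "p \<in> chow_ideal N \<Sigma>" by simp
  qed
  show "linear_relations N \<Sigma> \<subseteq> chow_ideal N \<Sigma>"
  proof
    fix p assume "p \<in> linear_relations N \<Sigma>"
    then have "p \<in> ?B" using genideal_self[OF sub(2)] by auto
    then have "0 + p \<in> chow_ideal N \<Sigma>" unfolding ch using z(1) by blast
    then show "p \<in> chow_ideal N \<Sigma>" by simp
  qed
  assume I: "ideal I ?R" "non_cone_monomials \<Sigma> \<subseteq> I" "linear_relations N \<Sigma> \<subseteq> I"
  have "?A \<subseteq> I" "?B \<subseteq> I" using genideal_minimal[OF I(1)] I(2,3) by auto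
  then show "chow_ideal N \<Sigma> \<subseteq> I" unfolding ch using I(1) unfolding mpoly_ideal_iff by blast
qed

lemma chow_ideal_facts:
  shows chow_ideal_zero: "0 \<in> chow_ideal N \<Sigma>"
    and chow_ideal_add: "p \<in> chow_ideal N \<Sigma> \<Longrightarrow> q \<in> chow_ideal N \<Sigma> \<Longrightarrow> p + q \<in> chow_ideal N \<Sigma>"
    and chow_ideal_mult: "p \<in> chow_ideal N \<Sigma> \<Longrightarrow> r \<in> mpolys (cones \<Sigma> 1) \<Longrightarrow> r * p \<in> chow_ideal N \<Sigma>"
  using ideal_chow_ideal[of N \<Sigma>] unfolding mpoly_ideal_iff by auto

lemma chow_ideal_uminus: "p \<in> chow_ideal N \<Sigma> \<Longrightarrow> - p \<in> chow_ideal N \<Sigma>"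
  using chow_ideal_mult[of p N \<Sigma> "- 1"] mpolys_uminus[OF mpolys_one, of "cones \<Sigma> 1"] by simp

lemma chow_ideal_sum: "(\<And>i. i \<in> A \<Longrightarrow> x i \<in> chow_ideal N \<Sigma>) \<Longrightarrow> sum x A \<in> chow_ideal N \<Sigma>"
  by (induction A rule: infinite_finite_induct) (auto intro: chow_ideal_add chow_ideal_zero)

lemma non_cone_monomial_in:
  "S \<subseteq> cones \<Sigma> 1 \<Longrightarrow> convex_cone hull (\<Union>S) \<notin> \<Sigma> \<Longrightarrow> (\<Prod>\<rho>\<in>S. mvar \<rho>) \<in> chow_ideal N \<Sigma>"
  using non_cone_monomials_in_chow_ideal[of \<Sigma> N] unfolding non_cone_monomials_def by blast

lemma linear_relation_in:
  "m \<in> dual_lattice N \<Longrightarrow> (\<Sum>\<rho>\<in>cones \<Sigma> 1. of_int (m (ray_gen N \<rho>)) * mvar \<rho>) \<in> chow_ideal N \<Sigma>"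
  using linear_relations_in_chow_ideal[of N \<Sigma>] unfolding linear_relations_def by blast

text \<open>Passes from real forms that are integral on \<open>N\<close> to integer-valued elements
  of the dual; on \<open>N\<close> the floor is exact, which is what makes it additive
  there.\<close>

lemma integral_form_dual:
  assumes "integral_form N m" shows "(\<lambda>x. \<lfloor>m x\<rfloor>) \<in> dual_lattice N"
proof -
  have "\<lfloor>m (x + y)\<rfloor> = \<lfloor>m x\<rfloor> + \<lfloor>m y\<rfloor>" if "x \<in> N" "y \<in> N" for x y
  proof -
    have "m (x + y) = m x + m y" using assms unfolding integral_form_def by (simp add: linear_add)
    moreover have "m x \<in> \<int>" "m y \<in> \<int>" using that assms unfolding integral_form_def by auto
    ultimately show ?thesis by (auto elim!: Ints_cases)
  qed
  then show ?thesis unfolding dual_lattice_def by blast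
qed

lemma dual_lattice_zero: "m \<in> dual_lattice N \<Longrightarrow> 0 \<in> N \<Longrightarrow> m 0 = 0"
  unfolding dual_lattice_def by force

lemma (in lattice_fan) dim_zero_cone: "\<sigma> \<in> \<Sigma> \<Longrightarrow> dim \<sigma> = 0 \<longleftrightarrow> \<sigma> = {0}"
  using cone_zero[of \<sigma>] by (auto simp: dim_eq_0)

section \<open>Cones, rays and ray generators of the modification\<close>

locale modification = tropical +
  assumes red: "div_reduced N \<Sigma> d f" and faithful: "div_faithful N \<Sigma> d"
begin

definition \<Delta> where "\<Delta> = div_subfan N \<Sigma> d f"

definition lift :: "'a set \<Rightarrow> ('a \<times> real) set" where
  "lift \<sigma> = {(x, f x) | x. x \<in> \<sigma>}"

definition raised :: "'a set \<Rightarrow> ('a \<times> real) set" where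
  "raised \<delta> = {(x, f x) + t *\<^sub>R (0, 1) | x t. x \<in> \<delta> \<and> 0 \<le> t}"

definition \<Sigma>' where "\<Sigma>' = trop_modification \<Sigma> \<Delta> f"

definition N' :: "('a \<times> real) set" where "N' = N \<times> \<int>"

text \<open>It always makes sense as a set, but it is a cone of \<open>\<Sigma>'\<close> exactly
  when \<open>\<Delta>\<close> is non-empty.\<close>

definition vray :: "('a \<times> real) set" where "vray = raised {0}"

lemma \<Sigma>'_eq: "\<Sigma>' = lift ` \<Sigma> \<union> raised ` \<Delta>"
  unfolding \<Sigma>'_def trop_modification_def lift_def raised_def ..

lemma \<Delta>_subset: "\<Delta> \<subseteq> \<Sigma>"
  unfolding \<Delta>_def div_subfan_def codim1_cones_def using fan_face by auto

lemma \<Delta>_face: "\<delta> \<in> \<Delta> \<Longrightarrow> \<tau> \<in> \<Sigma> \<Longrightarrow> \<tau> \<subseteq> \<delta> \<Longrightarrow> \<tau> \<in> \<Delta>"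
proof -
  assume a: "\<delta> \<in> \<Delta>" "\<tau> \<in> \<Sigma>" "\<tau> \<subseteq> \<delta>"
  then obtain \<zeta> where z: "\<zeta> \<in> codim1_cones \<Sigma> d" "ord_div N \<Sigma> d f \<zeta> = 1" "cone_face \<delta> \<zeta>"
    unfolding \<Delta>_def div_subfan_def by auto
  have "\<zeta> \<in> \<Sigma>" using z(1) unfolding codim1_cones_def by auto
  moreover have "\<tau> \<subseteq> \<zeta>" using a(3) z(3) face_of_imp_subset unfolding cone_face_def by blast
  ultimately have "cone_face \<tau> \<zeta>" using cone_face_iff a(2) by blast
  then show ?thesis using z unfolding \<Delta>_def div_subfan_def by auto
qed

lemma zero_in_\<Delta>: "{0} \<in> \<Delta> \<longleftrightarrow> \<Delta> \<noteq> {}"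
  using \<Delta>_face[OF _ zero_cone] \<Delta>_subset cone_zero by auto

lemma f_zero: "f 0 = 0"
  using cone_form_in[OF zero_cone, of 0] linear_0[OF linear_cone_form[OF zero_cone]] by simp

lemma vray_eq: "vray = {(0, t) | t. 0 \<le> t}"
  unfolding vray_def raised_def by (auto simp: f_zero)

lemma fst_lift [simp]: "fst ` lift \<sigma> = \<sigma>"
  unfolding lift_def by force

lemma fst_raised [simp]: "fst ` raised \<sigma> = \<sigma>"
  unfolding raised_def by force

lemma inj_lift: "inj lift"
  by (metis fst_lift injI)

lemma lift_eq_iff [simp]: "lift \<sigma> = lift \<tau> \<longleftrightarrow> \<sigma> = \<tau>"
  using inj_lift by (auto dest: injD)

lemma up_in_raised: "\<sigma> \<in> \<Sigma> \<Longrightarrow> (0, 1) \<in> raised \<sigma>"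
  unfolding raised_def using cone_zero[of \<sigma>] f_zero by force

lemma up_notin_lift: "(0, 1) \<notin> lift \<sigma>"
  unfolding lift_def using f_zero by auto

lemma vray_neq_lift [simp]: "vray \<noteq> lift \<sigma>" "lift \<sigma> \<noteq> vray"
  using up_in_raised[OF zero_cone] up_notin_lift unfolding vray_def by auto

lemma raised_neq_lift: "\<delta> \<in> \<Sigma> \<Longrightarrow> raised \<delta> \<noteq> lift \<sigma>"
  using up_in_raised up_notin_lift by metis

lemma lift_image:
  assumes "linear l" "\<And>x. x \<in> S \<Longrightarrow> f x = l x"
  shows "lift S = (\<lambda>x. (x, l x)) ` S"
  unfolding lift_def using assms by force

lemma linear_graph: "linear l \<Longrightarrow> linear (\<lambda>x. (x, l x))"
  by (intro linearI) (auto simp: linear_add linear_cmul)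

text \<open>On a single cone the graph map is linear and so commutes with hulls. The assumption
  cannot be dropped casually: across several cones \<open>f\<close> is only piecewise linear, and
  the hull of a graph need not be a graph.\<close>

lemma lift_hull:
  assumes "convex_cone hull S \<in> \<Sigma>"
  shows "convex_cone hull (lift S) = lift (convex_cone hull S)"
proof -
  let ?l = "cone_form f (convex_cone hull S)"
  have l: "linear ?l" "\<And>x. x \<in> convex_cone hull S \<Longrightarrow> f x = ?l x"
    using linear_cone_form[OF assms] cone_form_in[OF assms] by auto
  have "lift S = (\<lambda>x. (x, ?l x)) ` S"
    by (rule lift_image[OF l(1)]) (use l(2) hull_subset[of S convex_cone] in auto)
  moreover have "lift (convex_cone hull S) = (\<lambda>x. (x, ?l x)) ` (convex_cone hull S)"
    by (rule lift_image[OF l])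
  ultimately show ?thesis using convex_cone_hull_linear_image[OF linear_graph[OF l(1)]] by simp
qed

lemma lift_Union: "\<Union>(lift ` S) = lift (\<Union>S)"
  unfolding lift_def by auto

text \<open>The hull of a union of cones is their sum. This decides which sets of rays containing
  \<open>vray\<close> generate a cone of \<open>\<Sigma>'\<close>.\<close>

lemma raised_hull:
  assumes "convex_cone hull S \<in> \<Sigma>"
  shows "convex_cone hull (vray \<union> lift S) = raised (convex_cone hull S)"
proof -
  have "convex_cone vray" unfolding vray_eq convex_cone_iff by (auto simp: zero_prod_def)
  then have "convex_cone hull vray = vray" by (rule hull_same)
  then show ?thesis unfolding convex_cone_hull_Un lift_hull[OF assms]
    unfolding vray_eq lift_def raised_def by (force simp: add.commute)
qed

lemma fst_\<Sigma>': "\<xi> \<in> \<Sigma>' \<Longrightarrow> fst ` \<xi> \<in> \<Sigma>"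
  unfolding \<Sigma>'_eq using \<Delta>_subset by auto

lemma lift_in_\<Sigma>': "lift \<sigma> \<in> \<Sigma>' \<longleftrightarrow> \<sigma> \<in> \<Sigma>"
proof
  assume "lift \<sigma> \<in> \<Sigma>'"
  then show "\<sigma> \<in> \<Sigma>" using fst_\<Sigma>'[of "lift \<sigma>"] by simp
qed (simp add: \<Sigma>'_eq)

lemma raised_in_\<Sigma>': "\<sigma> \<in> \<Sigma> \<Longrightarrow> raised \<sigma> \<in> \<Sigma>' \<longleftrightarrow> \<sigma> \<in> \<Delta>"
proof
  assume "\<sigma> \<in> \<Sigma>" "raised \<sigma> \<in> \<Sigma>'"
  then obtain \<delta> where \<delta>: "\<delta> \<in> \<Delta>" "raised \<sigma> = raised \<delta>"
    unfolding \<Sigma>'_eq using raised_neq_lift by blast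
  have "fst ` raised \<sigma> = fst ` raised \<delta>" unfolding \<delta>(2) ..
  with \<delta>(1) show "\<sigma> \<in> \<Delta>" unfolding fst_raised by (simp only:)
qed (simp add: \<Sigma>'_eq)

lemma dim_lift:
  assumes "\<sigma> \<in> \<Sigma>" shows "dim (lift \<sigma>) = dim \<sigma>"
proof -
  have "lift \<sigma> = (\<lambda>x. (x, cone_form f \<sigma> x)) ` \<sigma>"
    by (rule lift_image) (use assms linear_cone_form cone_form_in in auto)
  moreover have "dim ((\<lambda>x. (x, cone_form f \<sigma> x)) ` \<sigma>) = dim \<sigma>"
    by (rule dim_image_eq[OF linear_graph[OF linear_cone_form[OF assms]]]) (simp add: inj_on_def)
  ultimately show ?thesis by simp
qed

lemma span_lift:
  assumes "\<sigma> \<in> \<Sigma>" shows "span (lift \<sigma>) = (\<lambda>x. (x, cone_form f \<sigma> x)) ` span \<sigma>"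
proof -
  have "lift \<sigma> = (\<lambda>x. (x, cone_form f \<sigma> x)) ` \<sigma>"
    by (rule lift_image) (use assms linear_cone_form cone_form_in in auto)
  then show ?thesis using linear_span_image[OF linear_graph[OF linear_cone_form[OF assms]]] by simp
qed

lemma dim_raised:
  assumes "\<sigma> \<in> \<Sigma>" shows "dim (raised \<sigma>) = dim \<sigma> + 1"
proof -
  have "(0, 1) \<notin> span (lift \<sigma>)"
    unfolding span_lift[OF assms] using linear_0[OF linear_cone_form[OF assms]] by auto
  then have "dim (insert (0, 1) (lift \<sigma>)) = dim \<sigma> + 1" using dim_insert[of "(0, 1)" "lift \<sigma>"] dim_lift[OF assms] by simp
  moreover have "span (insert (0, 1) (lift \<sigma>)) = span (raised \<sigma>)"
  proof (rule subset_antisym)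
    have "lift \<sigma> \<subseteq> raised \<sigma>" unfolding lift_def raised_def by force
    then show "span (insert (0, 1) (lift \<sigma>)) \<subseteq> span (raised \<sigma>)"
      by (intro span_mono) (use up_in_raised[OF assms] in auto)
    have "(x, f x) + t *\<^sub>R (0, 1) \<in> span (insert (0, 1) (lift \<sigma>))" if "x \<in> \<sigma>" for x t
      by (intro span_add span_scale span_base) (use that in \<open>auto simp: lift_def\<close>)
    then show "span (raised \<sigma>) \<subseteq> span (insert (0, 1) (lift \<sigma>))"
      by (intro span_minimal subspace_span) (auto simp: raised_def)
  qed
  ultimately show ?thesis using dim_span[of "insert (0, 1) (lift \<sigma>)"] dim_span[of "raised \<sigma>"] by simp
qed

lemma cones_\<Sigma>': "cones \<Sigma>' k = lift ` cones \<Sigma> k \<union> raised ` {\<delta>\<in>\<Delta>. dim \<delta> + 1 = k}"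
  unfolding cones_def \<Sigma>'_eq using dim_lift dim_raised \<Delta>_subset by auto

lemma rays_\<Sigma>': "cones \<Sigma>' 1 = lift ` cones \<Sigma> 1 \<union> (if \<Delta> = {} then {} else {vray})"
proof -
  have "{\<delta>\<in>\<Delta>. dim \<delta> + 1 = 1} = (if \<Delta> = {} then {} else {{0}})"
    using dim_zero_cone \<Delta>_subset zero_in_\<Delta> by auto
  then show ?thesis unfolding cones_\<Sigma>' vray_def by auto
qed

lemma finite_rays: "finite (cones \<Sigma> k)"
  using finite_fan unfolding cones_def by simp

lemma f_scale_ray: "\<sigma> \<in> \<Sigma> \<Longrightarrow> x \<in> \<sigma> \<Longrightarrow> 0 \<le> c \<Longrightarrow> f (c *\<^sub>R x) = c * f x"
  using cone_form_in[of \<sigma>] linear_cmul[OF linear_cone_form[of \<sigma>], of c x] cone_scale[of \<sigma> x c] by simp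

lemma ray_gen_in: "\<rho> \<in> cones \<Sigma> 1 \<Longrightarrow> ray_gen N \<rho> \<in> \<rho>" "\<rho> \<in> cones \<Sigma> 1 \<Longrightarrow> ray_gen N \<rho> \<in> N"
proof -
  assume "\<rho> \<in> cones \<Sigma> 1"
  moreover have "ray_gen N \<rho> \<in> range (\<lambda>k::nat. of_nat k *\<^sub>R ray_gen N \<rho>)"
    by (rule range_eqI[of _ _ 1]) simp
  ultimately have "ray_gen N \<rho> \<in> \<rho> \<inter> N" using ray_gen by simp
  then show "ray_gen N \<rho> \<in> \<rho>" "ray_gen N \<rho> \<in> N" by auto
qed

lemma f_int: "\<sigma> \<in> \<Sigma> \<Longrightarrow> x \<in> \<sigma> \<Longrightarrow> x \<in> N \<Longrightarrow> f x \<in> \<int>"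
  using cone_form_int[of \<sigma> x] cone_form_in[of \<sigma> x] unfolding cone_lattice_def by (auto simp: span_base)

lemma f_ray_gen_int: "\<rho> \<in> cones \<Sigma> 1 \<Longrightarrow> f (ray_gen N \<rho>) \<in> \<int>"
  using f_int[of \<rho>] ray_gen_in[of \<rho>] unfolding cones_def by simp

text \<open>As \<open>f\<close> is integral at the lattice points of the ray, the graph map carries
  them onto the lattice points of the lifted ray; homogeneity of \<open>f\<close> on the ray turns
  multiples into multiples.\<close>

lemma ray_gen_lift:
  assumes "\<rho> \<in> cones \<Sigma> 1"
  shows "ray_gen N' (lift \<rho>) = (ray_gen N \<rho>, f (ray_gen N \<rho>))"
proof (rule ray_gen_eqI)
  have \<rho>: "\<rho> \<in> \<Sigma>" using assms unfolding cones_def by simp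
  let ?e = "ray_gen N \<rho>"
  have "lift \<rho> \<inter> N' = (\<lambda>x. (x, f x)) ` (\<rho> \<inter> N)"
    unfolding lift_def N'_def using f_int[OF \<rho>] by auto
  also have "\<dots> = (\<lambda>x. (x, f x)) ` range (\<lambda>k::nat. of_nat k *\<^sub>R ?e)" using ray_gen[OF assms] by simp
  also have "\<dots> = range (\<lambda>k::nat. of_nat k *\<^sub>R (?e, f ?e))"
    using f_scale_ray[OF \<rho> ray_gen_in(1)[OF assms]] by (simp add: image_image)
  finally show "lift \<rho> \<inter> N' = range (\<lambda>k::nat. of_nat k *\<^sub>R (?e, f ?e))" .
qed

lemma ray_gen_vray: "ray_gen N' vray = (0, 1)"
proof (rule ray_gen_eqI)
  have "\<exists>k::nat. t = of_nat k" if "0 \<le> t" "t \<in> \<int>" for t :: real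
    using that by (metis Ints_cases nonneg_int_cases of_int_0_le_iff of_int_of_nat_eq)
  then show "vray \<inter> N' = range (\<lambda>k::nat. of_nat k *\<^sub>R (0, 1))"
    unfolding vray_eq N'_def using lattice_zero[OF lattice] by auto
qed

section \<open>The element \<open>F\<close> and its products with cone monomials\<close>

abbreviation "I \<equiv> chow_ideal N \<Sigma>"
abbreviation "J \<equiv> chow_ideal N' \<Sigma>'"

text \<open>The floor only changes the type, since \<open>f\<close> is integral at ray
  generators.\<close>

definition F :: "'a set int_mpoly" where
  "F = (\<Sum>\<rho>\<in>cones \<Sigma> 1. of_int \<lfloor>f (ray_gen N \<rho>)\<rfloor> * mvar \<rho>)"

text \<open>
  Subtracting the linear relation of \<open>m\<close> replaces \<open>f\<close> by \<open>f - m\<close>, which vanishes on the cone, so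
  only the rays in its star remain.
\<close>

lemma F_times_monomial:
  assumes S: "S \<subseteq> cones \<Sigma> 1" and m: "integral_form N m" "\<And>x. x \<in> \<Union>S \<Longrightarrow> m x = f x"
  shows "F * (\<Prod>\<rho>\<in>S. mvar \<rho>) - (\<Sum>\<rho>\<in>{\<rho>\<in>cones \<Sigma> 1. \<rho> \<notin> S \<and> convex_cone hull (\<Union>(insert \<rho> S)) \<in> \<Sigma>}.
     of_int \<lfloor>f (ray_gen N \<rho>) - m (ray_gen N \<rho>)\<rfloor> * (\<Prod>\<rho>'\<in>insert \<rho> S. mvar \<rho>')) \<in> I"
proof -
  let ?e = "ray_gen N" and ?P = "\<Prod>\<rho>\<in>S. mvar \<rho>"
  define A where "A = {\<rho>\<in>cones \<Sigma> 1. \<rho> \<notin> S \<and> convex_cone hull (\<Union>(insert \<rho> S)) \<in> \<Sigma>}"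
  define c where "c \<rho> = \<lfloor>f (?e \<rho>) - m (?e \<rho>)\<rfloor>" for \<rho>
  define L where "L = (\<Sum>\<rho>\<in>cones \<Sigma> 1. of_int \<lfloor>m (?e \<rho>)\<rfloor> * mvar \<rho>)"
  have fS: "finite S" using S finite_rays finite_subset by blast
  have L: "L \<in> I" unfolding L_def by (rule linear_relation_in[OF integral_form_dual[OF m(1)]])
  have "\<lfloor>f (?e \<rho>)\<rfloor> = c \<rho> + \<lfloor>m (?e \<rho>)\<rfloor>" if "\<rho> \<in> cones \<Sigma> 1" for \<rho>
  proof -
    have "f (?e \<rho>) \<in> \<int>" "m (?e \<rho>) \<in> \<int>"
      using f_ray_gen_int ray_gen_in that m(1) unfolding integral_form_def by auto
    then show ?thesis unfolding c_def by (auto elim!: Ints_cases)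
  qed
  then have "F = (\<Sum>\<rho>\<in>cones \<Sigma> 1. of_int (c \<rho>) * mvar \<rho>) + L"
    unfolding F_def L_def by (simp add: distrib_right flip: sum.distrib)
  then have "F * ?P = (\<Sum>\<rho>\<in>cones \<Sigma> 1. of_int (c \<rho>) * mvar \<rho> * ?P) + ?P * L"
    by (simp only: distrib_right sum_distrib_right mult.commute[of L])
  moreover have "(\<Sum>\<rho>\<in>cones \<Sigma> 1. of_int (c \<rho>) * mvar \<rho> * ?P)
      = (\<Sum>\<rho>\<in>A. of_int (c \<rho>) * mvar \<rho> * ?P) + (\<Sum>\<rho>\<in>cones \<Sigma> 1 - A. of_int (c \<rho>) * mvar \<rho> * ?P)"
    using sum.subset_diff[of A "cones \<Sigma> 1"] finite_rays unfolding A_def by (simp add: add.commute)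
  moreover have "(\<Sum>\<rho>\<in>A. of_int (c \<rho>) * mvar \<rho> * ?P) = (\<Sum>\<rho>\<in>A. of_int (c \<rho>) * (\<Prod>\<rho>'\<in>insert \<rho> S. mvar \<rho>'))"
    by (rule sum.cong) (use fS in \<open>auto simp: A_def mult.assoc\<close>)
  ultimately have eq: "F * ?P - (\<Sum>\<rho>\<in>A. of_int (c \<rho>) * (\<Prod>\<rho>'\<in>insert \<rho> S. mvar \<rho>'))
      = (\<Sum>\<rho>\<in>cones \<Sigma> 1 - A. of_int (c \<rho>) * mvar \<rho> * ?P) + ?P * L" by simp
  \<comment> \<open>Outside \<open>A\<close> there are two reasons to vanish modulo
    \<open>I\<close>: for a ray of \<open>S\<close> the coefficient is 0 because \<open>m\<close>
    agrees with \<open>f\<close> on it, and any other ray enlarges \<open>S\<close> to a set that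
    generates no cone.\<close>
  have "of_int (c \<rho>) * mvar \<rho> * ?P \<in> I" if \<rho>: "\<rho> \<in> cones \<Sigma> 1 - A" for \<rho>
  proof (cases "\<rho> \<in> S")
    case True
    then have "m (ray_gen N \<rho>) = f (ray_gen N \<rho>)" using m(2) ray_gen_in(1) \<rho> by blast
    then have "c \<rho> = 0" unfolding c_def by simp
    then show ?thesis by (simp add: chow_ideal_zero)
  next
    case False
    then have "(\<Prod>\<rho>'\<in>insert \<rho> S. mvar \<rho>') \<in> I"
      using \<rho> S unfolding A_def by (intro non_cone_monomial_in) auto
    then have "of_int (c \<rho>) * (\<Prod>\<rho>'\<in>insert \<rho> S. mvar \<rho>') \<in> I" by (rule chow_ideal_mult) simp
    then show ?thesis using False fS by (simp add: mult.assoc)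
  qed
  moreover have "?P * L \<in> I"
    by (rule chow_ideal_mult[OF L]) (use S in \<open>auto intro!: mpolys_prod mpolys_mvar\<close>)
  ultimately show ?thesis
    unfolding eq[unfolded A_def c_def] by (intro chow_ideal_add chow_ideal_sum) (auto simp: A_def c_def)
qed

lemma F_times_non_\<Delta>:
  assumes S: "S \<subseteq> cones \<Sigma> 1" "convex_cone hull (\<Union>S) \<in> \<Sigma>" "convex_cone hull (\<Union>S) \<notin> \<Delta>"
  shows "F * (\<Prod>\<rho>\<in>S. mvar \<rho>) \<in> I"
proof -
  obtain m where m: "integral_form N m"
    "\<And>\<zeta> x. \<zeta> \<in> \<Sigma> \<Longrightarrow> convex_cone hull (\<Union>S) \<subseteq> \<zeta> \<Longrightarrow> x \<in> \<zeta> \<Longrightarrow> f x = m x"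
    using linear_on_star[OF red faithful S(2)] S(3) unfolding \<Delta>_def by blast
  have "F * (\<Prod>\<rho>\<in>S. mvar \<rho>) - (\<Sum>\<rho>\<in>{\<rho>\<in>cones \<Sigma> 1. \<rho> \<notin> S \<and> convex_cone hull (\<Union>(insert \<rho> S)) \<in> \<Sigma>}.
     of_int \<lfloor>f (ray_gen N \<rho>) - m (ray_gen N \<rho>)\<rfloor> * (\<Prod>\<rho>'\<in>insert \<rho> S. mvar \<rho>')) \<in> I"
  proof (rule F_times_monomial[OF S(1) m(1)])
    fix x assume "x \<in> \<Union>S"
    then have "x \<in> convex_cone hull (\<Union>S)" by (rule hull_inc)
    then show "m x = f x" using m(2)[OF S(2) subset_refl] by simp
  qed
  moreover have "(\<Sum>\<rho>\<in>{\<rho>\<in>cones \<Sigma> 1. \<rho> \<notin> S \<and> convex_cone hull (\<Union>(insert \<rho> S)) \<in> \<Sigma>}.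
     of_int \<lfloor>f (ray_gen N \<rho>) - m (ray_gen N \<rho>)\<rfloor> * (\<Prod>\<rho>'\<in>insert \<rho> S. mvar \<rho>')) = 0"
  proof (rule sum.neutral, rule ballI)
    fix \<rho> assume \<rho>: "\<rho> \<in> {\<rho>\<in>cones \<Sigma> 1. \<rho> \<notin> S \<and> convex_cone hull (\<Union>(insert \<rho> S)) \<in> \<Sigma>}"
    have "convex_cone hull (\<Union>S) \<subseteq> convex_cone hull (\<Union>(insert \<rho> S))" by (rule hull_mono) auto
    moreover have "ray_gen N \<rho> \<in> convex_cone hull (\<Union>(insert \<rho> S))"
      by (rule hull_inc) (use ray_gen_in \<rho> in auto)
    ultimately have "f (ray_gen N \<rho>) = m (ray_gen N \<rho>)" using m(2) \<rho> by blast
    then show "of_int \<lfloor>f (ray_gen N \<rho>) - m (ray_gen N \<rho>)\<rfloor> * (\<Prod>\<rho>'\<in>insert \<rho> S. mvar \<rho>') = 0" by simp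
  qed
  ultimately show ?thesis by simp
qed

text \<open>If \<open>\<Delta>\<close> is empty, \<open>vray\<close> is not a ray of \<open>\<Sigma>'\<close>, and its value under \<open>down\<close> is irrelevant.\<close>

definition down :: "('a \<times> real) set \<Rightarrow> 'a set int_mpoly" where
  "down w = (if w = vray then - F else mvar (fst ` w))"

definition up :: "'a set \<Rightarrow> ('a \<times> real) set int_mpoly" where
  "up \<rho> = mvar (lift \<rho>)"

lemma down_simps [simp]: "down vray = - F" "down (lift \<rho>) = mvar \<rho>"
  unfolding down_def by auto

lemma F_closed: "F \<in> mpolys (cones \<Sigma> 1)"
  unfolding F_def by (auto intro!: mpolys_sum mpolys_mult mpolys_mvar)

lemma homogeneous_F: "homogeneous 1 F"
  unfolding F_def by (intro homogeneous_sum homogeneous_const_mult homogeneous_mvar)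

lemma homogeneous_down: "homogeneous 1 (down w)" and homogeneous_up: "homogeneous 1 (up \<rho>)"
  unfolding down_def up_def by (simp_all add: homogeneous_F homogeneous_mvar homogeneous_uminus)

lemma down_closed: "w \<in> cones \<Sigma>' 1 \<Longrightarrow> down w \<in> mpolys (cones \<Sigma> 1)"
  unfolding rays_\<Sigma>' using mpolys_uminus[OF F_closed] by (auto intro: mpolys_mvar split: if_splits)

lemma up_closed: "\<rho> \<in> cones \<Sigma> 1 \<Longrightarrow> up \<rho> \<in> mpolys (cones \<Sigma>' 1)"
  unfolding up_def by (rule mpolys_mvar) (simp add: rays_\<Sigma>')

text \<open>An equality of polynomials, not merely a congruence: \<open>up\<close> produces lifted
  variables only, which \<open>down\<close> sends straight back.\<close>

lemma down_up: "p \<in> mpolys (cones \<Sigma> 1) \<Longrightarrow> mpoly_subst down (mpoly_subst up p) = p"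
  unfolding mpoly_subst_subst up_def by (simp add: mpoly_subst_id)

section \<open>The two substitutions respect the Chow ideals\<close>

lemma prod_lift: "(\<Prod>w\<in>lift ` S. x w) = (\<Prod>\<rho>\<in>S. x (lift \<rho>))"
  by (rule prod.reindex_cong[OF inj_on_subset[OF inj_lift subset_UNIV] refl refl])

lemma sum_lift: "(\<Sum>w\<in>lift ` S. x w) = (\<Sum>\<rho>\<in>S. x (lift \<rho>))"
  by (rule sum.reindex_cong[OF inj_on_subset[OF inj_lift subset_UNIV] refl refl])

lemma sum_rays_\<Sigma>':
  "(\<Sum>w\<in>cones \<Sigma>' 1. x w) = (\<Sum>\<rho>\<in>cones \<Sigma> 1. x (lift \<rho>)) + (if \<Delta> = {} then 0 else x vray)"
proof -
  have "vray \<notin> lift ` cones \<Sigma> 1" by auto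
  then show ?thesis unfolding rays_\<Sigma>' using finite_rays[of 1] by (simp add: sum_lift add.commute)
qed

text \<open>Without \<open>vray\<close>, the rays of a non-cone project to rays of a non-cone. With
  \<open>vray\<close>, the image is \<open>F\<close> times a monomial up to sign: either that
  monomial already belongs to a non-cone, or its cone lies outside \<open>\<Delta>\<close> and
  \<open>F_times_non_\<Delta>\<close> applies.\<close>

lemma down_non_cone:
  assumes S': "S' \<subseteq> cones \<Sigma>' 1" "convex_cone hull (\<Union>S') \<notin> \<Sigma>'"
  shows "mpoly_subst down (\<Prod>w\<in>S'. mvar w) \<in> I"
proof -
  define S where "S = {\<rho>\<in>cones \<Sigma> 1. lift \<rho> \<in> S'}"
  have S: "S \<subseteq> cones \<Sigma> 1" unfolding S_def by auto
  have fS: "finite S" using S finite_rays finite_subset by blast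
  show ?thesis
  proof (cases "vray \<in> S'")
    case False
    then have eq: "S' = lift ` S" using S'(1) unfolding S_def rays_\<Sigma>' by (auto split: if_splits)
    have "convex_cone hull (\<Union>S) \<notin> \<Sigma>"
      using S'(2) lift_hull[of "\<Union>S"] lift_in_\<Sigma>' unfolding eq lift_Union by auto
    then have "(\<Prod>\<rho>\<in>S. mvar \<rho>) \<in> I" using non_cone_monomial_in S by blast
    then show ?thesis unfolding mpoly_subst_prod eq prod_lift by simp
  next
    case True
    then have eq: "S' = insert vray (lift ` S)" and \<Delta>: "\<Delta> \<noteq> {}"
      using S'(1) unfolding S_def rays_\<Sigma>' by (auto split: if_splits)
    have Un: "\<Union>S' = vray \<union> lift (\<Union>S)" unfolding eq by (simp add: lift_Union)
    have "vray \<notin> lift ` S" by auto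
    then have subst: "mpoly_subst down (\<Prod>w\<in>S'. mvar w) = - (F * (\<Prod>\<rho>\<in>S. mvar \<rho>))"
      unfolding mpoly_subst_prod eq using fS by (simp add: prod_lift)
    have "F * (\<Prod>\<rho>\<in>S. mvar \<rho>) \<in> I"
    proof (cases "convex_cone hull (\<Union>S) \<in> \<Sigma>")
      case True
      then have "convex_cone hull (\<Union>S) \<notin> \<Delta>"
        using S'(2) raised_hull[OF True] raised_in_\<Sigma>' unfolding Un by auto
      then show ?thesis using F_times_non_\<Delta>[OF S True] by blast
    next
      case False
      then show ?thesis by (intro chow_ideal_mult F_closed non_cone_monomial_in S)
    qed
    then show ?thesis unfolding subst by (rule chow_ideal_uminus)
  qed
qed

text \<open>An element of the dual is only known to be additive on \<open>N'\<close>, so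
  proportionality along the vertical axis has to be derived: by induction for naturals, then by
  adding the opposite vector for negative integers.\<close>

lemma dual_lattice_vertical:
  assumes m: "m \<in> dual_lattice N'"
  shows "(\<lambda>x. m (x, 0)) \<in> dual_lattice N"
    and "x \<in> N \<Longrightarrow> m (x, of_int k) = m (x, 0) + k * m (0, 1)"
proof -
  have add: "m (a + b) = m a + m b" if "a \<in> N'" "b \<in> N'" for a b
    using m that unfolding dual_lattice_def by blast
  have "m (x + y, 0) = m (x, 0) + m (y, 0)" if "x \<in> N" "y \<in> N" for x y
    using add[of "(x, 0)" "(y, 0)"] that unfolding N'_def by simp
  then show "(\<lambda>x. m (x, 0)) \<in> dual_lattice N" unfolding dual_lattice_def by blast
  have N0: "0 \<in> N" by (rule lattice_zero[OF lattice])
  have nat: "m (0, of_nat n) = int n * m (0, 1)" for n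
  proof (induction n)
    case 0
    show ?case using add[of 0 0] N0 unfolding N'_def by (simp add: zero_prod_def)
  next
    case (Suc n)
    have "m (0, of_nat (Suc n)) = m ((0, 1) + (0, of_nat n))" by simp
    also have "\<dots> = m (0, 1) + m (0, of_nat n)" by (rule add) (use N0 in \<open>auto simp: N'_def\<close>)
    finally show ?case using Suc by (simp add: algebra_simps)
  qed
  have int: "m (0, of_int k) = k * m (0, 1)" for k
  proof (cases "k \<ge> 0")
    case True
    then show ?thesis using nat[of "nat k"] by simp
  next
    case False
    have "m ((0, of_int k) + (0, of_nat (nat (- k)))) = m (0, of_int k) + m (0, of_nat (nat (- k)))"
      by (rule add) (use N0 in \<open>auto simp: N'_def\<close>)
    then show ?thesis using False nat[of "nat (- k)"] nat[of 0] by simp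
  qed
  assume x: "x \<in> N"
  have "m ((x, 0) + (0, of_int k)) = m (x, 0) + m (0, of_int k)"
    by (rule add) (use x N0 in \<open>auto simp: N'_def\<close>)
  then show "m (x, of_int k) = m (x, 0) + k * m (0, 1)" using int by simp
qed

text \<open>The lifted rays contribute the relation of the horizontal part of \<open>m\<close> plus
  \<open>m (0, 1)\<close> times \<open>F\<close>, because heights of ray generators are values of
  \<open>f\<close>. The vertical variable goes to \<open>- F\<close> and cancels the second
  term.\<close>

lemma down_linear_relation:
  assumes m: "m \<in> dual_lattice N'"
  shows "mpoly_subst down (\<Sum>w\<in>cones \<Sigma>' 1. of_int (m (ray_gen N' w)) * mvar w) \<in> I"
proof -
  define L where "L = (\<Sum>\<rho>\<in>cones \<Sigma> 1. of_int (m (ray_gen N \<rho>, 0)) * mvar \<rho>)"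
  have L: "L \<in> I" unfolding L_def by (rule linear_relation_in[OF dual_lattice_vertical(1)[OF m]])
  have "m (ray_gen N' (lift \<rho>)) = m (ray_gen N \<rho>, 0) + \<lfloor>f (ray_gen N \<rho>)\<rfloor> * m (0, 1)"
    if "\<rho> \<in> cones \<Sigma> 1" for \<rho>
  proof -
    have "f (ray_gen N \<rho>) = of_int \<lfloor>f (ray_gen N \<rho>)\<rfloor>"
      using f_ray_gen_int[OF that] by (auto elim!: Ints_cases)
    then show ?thesis
      using ray_gen_lift[OF that] dual_lattice_vertical(2)[OF m ray_gen_in(2)[OF that]] by metis
  qed
  then have "(\<Sum>\<rho>\<in>cones \<Sigma> 1. of_int (m (ray_gen N' (lift \<rho>))) * mvar \<rho>) = L + of_int (m (0, 1)) * F"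
    unfolding L_def F_def by (simp add: sum_distrib_left sum.distrib algebra_simps)
  then have eq: "mpoly_subst down (\<Sum>w\<in>cones \<Sigma>' 1. of_int (m (ray_gen N' w)) * mvar w)
      = L + of_int (m (0, 1)) * F + (if \<Delta> = {} then 0 else - (of_int (m (0, 1)) * F))"
    unfolding mpoly_subst_sum unfolding sum_rays_\<Sigma>' by (simp add: mpoly_subst_mult ray_gen_vray)
  show ?thesis
  proof (cases "\<Delta> = {}")
    case True
    \<comment> \<open>The empty product: with \<open>\<Delta>\<close> empty the zero cone lies
      outside \<open>\<Delta>\<close>, and its star is the whole fan, so \<open>F\<close> itself is
      in \<open>I\<close>. This replaces the missing vertical variable.\<close>
    then have "F * (\<Prod>\<rho>\<in>{}. mvar \<rho>) \<in> I" by (intro F_times_non_\<Delta>) (auto simp: zero_cone)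
    then have "of_int (m (0, 1)) * F \<in> I" by (intro chow_ideal_mult) auto
    then show ?thesis unfolding eq using L True by (simp add: chow_ideal_add)
  next
    case False
    then show ?thesis unfolding eq using L by simp
  qed
qed

lemma down_ideal: "p \<in> J \<Longrightarrow> mpoly_subst down p \<in> I"
proof -
  have "J \<subseteq> {p \<in> mpolys (cones \<Sigma>' 1). mpoly_subst down p \<in> I}"
  proof (rule chow_ideal_minimal)
    show "ideal {p \<in> mpolys (cones \<Sigma>' 1). mpoly_subst down p \<in> I} (mpoly_ring (cones \<Sigma>' 1))"
      by (rule ideal_vimage_subst[OF ideal_chow_ideal down_closed])
    show "non_cone_monomials \<Sigma>' \<subseteq> {p \<in> mpolys (cones \<Sigma>' 1). mpoly_subst down p \<in> I}"
      using non_cone_monomials_subset[of \<Sigma>'] down_non_cone unfolding non_cone_monomials_def by blast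
    show "linear_relations N' \<Sigma>' \<subseteq> {p \<in> mpolys (cones \<Sigma>' 1). mpoly_subst down p \<in> I}"
      using linear_relations_subset[of N' \<Sigma>'] down_linear_relation unfolding linear_relations_def by blast
  qed
  then show "p \<in> J \<Longrightarrow> mpoly_subst down p \<in> I" by auto
qed

text \<open>Cones of \<open>\<Sigma>'\<close> project to cones of \<open>\<Sigma>\<close>, so
  non-cones lift to non-cones. A linear relation lifts to the relation of the form composed with the
  projection, in which the vertical ray has coefficient 0.\<close>

lemma up_ideal: "p \<in> I \<Longrightarrow> mpoly_subst up p \<in> J"
proof -
  have 1: "mpoly_subst up (\<Prod>\<rho>\<in>S. mvar \<rho>) \<in> J" if S: "S \<subseteq> cones \<Sigma> 1" "convex_cone hull (\<Union>S) \<notin> \<Sigma>" for S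
  proof -
    have "fst ` (convex_cone hull (\<Union>(lift ` S))) = convex_cone hull (\<Union>S)"
      using convex_cone_hull_linear_image[OF linear_fst, of "lift (\<Union>S)"] by (simp add: lift_Union)
    then have "convex_cone hull (\<Union>(lift ` S)) \<notin> \<Sigma>'" using fst_\<Sigma>' S(2) by metis
    moreover have "lift ` S \<subseteq> cones \<Sigma>' 1" using S(1) unfolding rays_\<Sigma>' by auto
    ultimately have "(\<Prod>w\<in>lift ` S. mvar w) \<in> J" by (intro non_cone_monomial_in)
    then show ?thesis unfolding mpoly_subst_prod prod_lift by (simp add: up_def)
  qed
  have 2: "mpoly_subst up (\<Sum>\<rho>\<in>cones \<Sigma> 1. of_int (m (ray_gen N \<rho>)) * mvar \<rho>) \<in> J"
    if m: "m \<in> dual_lattice N" for m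
  proof -
    have "(\<lambda>x. m (fst x)) \<in> dual_lattice N'" using m unfolding dual_lattice_def N'_def by auto
    then have "(\<Sum>w\<in>cones \<Sigma>' 1. of_int (m (fst (ray_gen N' w))) * mvar w) \<in> J" by (rule linear_relation_in)
    moreover have "(\<Sum>\<rho>\<in>cones \<Sigma> 1. of_int (m (fst (ray_gen N' (lift \<rho>)))) * mvar (lift \<rho>))
        = (\<Sum>\<rho>\<in>cones \<Sigma> 1. of_int (m (ray_gen N \<rho>)) * up \<rho>)"
      unfolding up_def by (rule sum.cong) (auto simp: ray_gen_lift)
    ultimately show ?thesis
      unfolding mpoly_subst_sum unfolding sum_rays_\<Sigma>'
      using dual_lattice_zero[OF m lattice_zero[OF lattice]]
      by (simp add: mpoly_subst_mult ray_gen_vray if_distrib cong: if_cong)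
  qed
  have "I \<subseteq> {p \<in> mpolys (cones \<Sigma> 1). mpoly_subst up p \<in> J}"
  proof (rule chow_ideal_minimal)
    show "ideal {p \<in> mpolys (cones \<Sigma> 1). mpoly_subst up p \<in> J} (mpoly_ring (cones \<Sigma> 1))"
      by (rule ideal_vimage_subst[OF ideal_chow_ideal up_closed])
    show "non_cone_monomials \<Sigma> \<subseteq> {p \<in> mpolys (cones \<Sigma> 1). mpoly_subst up p \<in> J}"
      using non_cone_monomials_subset[of \<Sigma>] 1 unfolding non_cone_monomials_def by blast
    show "linear_relations N \<Sigma> \<subseteq> {p \<in> mpolys (cones \<Sigma> 1). mpoly_subst up p \<in> J}"
      using linear_relations_subset[of N \<Sigma>] 2 unfolding linear_relations_def by blast
  qed
  then show "p \<in> I \<Longrightarrow> mpoly_subst up p \<in> J" by auto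
qed

lemma up_F: "\<Delta> \<noteq> {} \<Longrightarrow> mpoly_subst up F + mvar vray \<in> J"
proof -
  assume \<Delta>: "\<Delta> \<noteq> {}"
  have "(\<lambda>x::'a \<times> real. \<lfloor>snd x\<rfloor>) \<in> dual_lattice N'"
    by (rule integral_form_dual) (auto simp: integral_form_def N'_def linear_snd)
  then have "(\<Sum>w\<in>cones \<Sigma>' 1. of_int \<lfloor>snd (ray_gen N' w)\<rfloor> * mvar w) \<in> J" by (rule linear_relation_in)
  moreover have "(\<Sum>\<rho>\<in>cones \<Sigma> 1. of_int \<lfloor>snd (ray_gen N' (lift \<rho>))\<rfloor> * mvar (lift \<rho>))
      = mpoly_subst up F"
    unfolding F_def mpoly_subst_sum by (rule sum.cong) (auto simp: ray_gen_lift mpoly_subst_mult up_def)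
  ultimately show ?thesis unfolding sum_rays_\<Sigma>' using \<Delta> by (simp add: ray_gen_vray)
qed

text \<open>Lifted variables return unchanged; the vertical one is moved by the element that
  \<open>up_F\<close> places in \<open>J\<close>.\<close>

lemma up_down: "p \<in> mpolys (cones \<Sigma>' 1) \<Longrightarrow> mpoly_subst up (mpoly_subst down p) - p \<in> J"
  unfolding mpoly_subst_subst
proof (rule subst_congruent_id[OF ideal_chow_ideal])
  show "mpoly_subst up (down w) \<in> mpolys (cones \<Sigma>' 1)" if "w \<in> cones \<Sigma>' 1" for w
    by (rule mpoly_subst_closed[OF up_closed down_closed[OF that]])
  show "mpoly_subst up (down w) - mvar w \<in> J" if w: "w \<in> cones \<Sigma>' 1" for w
  proof -
    consider \<rho> where "w = lift \<rho>" | "w = vray" "\<Delta> \<noteq> {}" using w unfolding rays_\<Sigma>' by (auto split: if_splits)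
    then show ?thesis
    proof cases
      case 1
      then show ?thesis by (simp add: up_def chow_ideal_zero)
    next
      case 2
      then show ?thesis using chow_ideal_uminus[OF up_F] by (simp add: mpoly_subst_uminus)
    qed
  qed
qed

lemma chow_iso:
  obtains \<phi> where "\<phi> \<in> ring_iso (chow_ring N' \<Sigma>') (chow_ring N \<Sigma>)"
    and "\<And>p. p \<in> mpolys (cones \<Sigma>' 1) \<Longrightarrow> \<phi> (chow_class N' \<Sigma>' p) = chow_class N \<Sigma> (mpoly_subst down p)"
proof (rule quotient_iso_subst[OF ideal_chow_ideal[of N \<Sigma>] ideal_chow_ideal[of N' \<Sigma>'] down_closed up_closed
      down_ideal up_ideal up_down])
  show "mpoly_subst down (mpoly_subst up p) - p \<in> I" if "p \<in> mpolys (cones \<Sigma> 1)" for p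
    using down_up[OF that] by (simp add: chow_ideal_zero)
qed (use that in \<open>auto simp: chow_ring_def chow_class_def ray_ring_def\<close>)

end

section \<open>Degrees in the unimodular case\<close>

lemma convex_cone_hull_finite:
  assumes "finite B"
  shows "convex_cone hull B = {\<Sum>b\<in>B. c b *\<^sub>R b | c. \<forall>b\<in>B. 0 \<le> c b}" (is "_ = ?R")
proof (rule subset_antisym)
  have "convex_cone ?R"
    unfolding convex_cone_iff
  proof (intro conjI ballI allI impI)
    show "0 \<in> ?R" by (rule CollectI, rule exI[of _ "\<lambda>_. 0"]) simp
  next
    fix x y assume "x \<in> ?R" "y \<in> ?R"
    then obtain c e where "x = (\<Sum>b\<in>B. c b *\<^sub>R b)" "\<forall>b\<in>B. 0 \<le> c b" "y = (\<Sum>b\<in>B. e b *\<^sub>R b)" "\<forall>b\<in>B. 0 \<le> e b"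
      by blast
    then have "x + y = (\<Sum>b\<in>B. (c b + e b) *\<^sub>R b) \<and> (\<forall>b\<in>B. 0 \<le> c b + e b)"
      by (simp add: scaleR_add_left sum.distrib)
    then show "x + y \<in> ?R" by (intro CollectI exI[of _ "\<lambda>b. c b + e b"])
  next
    fix x and a :: real assume "x \<in> ?R" "0 \<le> a"
    then obtain c where "x = (\<Sum>b\<in>B. c b *\<^sub>R b)" "\<forall>b\<in>B. 0 \<le> c b" by blast
    then have "a *\<^sub>R x = (\<Sum>b\<in>B. (a * c b) *\<^sub>R b) \<and> (\<forall>b\<in>B. 0 \<le> a * c b)"
      using \<open>0 \<le> a\<close> by (simp add: scaleR_sum_right)
    then show "a *\<^sub>R x \<in> ?R" by (intro CollectI exI[of _ "\<lambda>b. a * c b"])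
  qed
  moreover have "B \<subseteq> ?R"
  proof
    fix a assume "a \<in> B"
    have "(\<Sum>b\<in>B. (if b = a then 1 else 0) *\<^sub>R b) = (\<Sum>b\<in>B. if b = a then a else 0)"
      by (rule sum.cong) auto
    also have "\<dots> = a" using assms \<open>a \<in> B\<close> by simp
    finally show "a \<in> ?R" by (intro CollectI exI[of _ "\<lambda>b. if b = a then 1 else 0"]) auto
  qed
  ultimately show "convex_cone hull B \<subseteq> ?R" by (intro hull_minimal) simp_all
  have "(\<Sum>b\<in>A. c b *\<^sub>R b) \<in> convex_cone hull B" if "A \<subseteq> B" "\<forall>b\<in>B. 0 \<le> c b" for A c
    using finite_subset[OF that(1) assms] that(1)
  proof (induction A rule: finite_induct)
    case (insert a A)
    have "c a *\<^sub>R a \<in> convex_cone hull B"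
      using insert.prems that(2) by (intro convex_cone_hull_mul hull_inc) auto
    then show ?case using insert by (simp add: convex_cone_hull_add)
  qed (simp add: convex_cone_hull_contains_0)
  then show "?R \<subseteq> convex_cone hull B" by blast
qed

lemma dim_convex_cone_hull: "dim (convex_cone hull B) = dim B"
  using dim_span[of B] dim_span[of "convex_cone hull B"] by (simp add: span_convex_cone_hull)

lemma ray_hull: "convex_cone hull {b} = {c *\<^sub>R b | c. 0 \<le> c}"
proof -
  have "finite {b}" by simp
  then have "convex_cone hull {b} = {c b *\<^sub>R b | c. 0 \<le> c b}" by (simp add: convex_cone_hull_finite)
  also have "\<dots> = {c *\<^sub>R b | c. 0 \<le> c}"
  proof (intro subset_antisym subsetI)
    fix x assume "x \<in> {c *\<^sub>R b | c. 0 \<le> c}"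
    then obtain c where "x = c *\<^sub>R b" "0 \<le> c" by blast
    then show "x \<in> {c b *\<^sub>R b | c. 0 \<le> c b}" by (intro CollectI exI[of _ "\<lambda>_. c"]) simp
  qed blast
  finally show ?thesis .
qed

lemma lattice_basis_in:
  fixes N :: "'a::euclidean_space set"
  assumes "lattice_basis N C" "c \<in> C"
  shows "c \<in> N"
proof -
  have "finite C" using assms independent_imp_finite unfolding lattice_basis_def by blast
  then have "c = (\<Sum>b\<in>C. of_int ((if b = c then 1 else 0) :: int) *\<^sub>R b)"
    using assms(2) by (simp add: if_distrib if_distribR cong: if_cong)
  moreover have "N = range (\<lambda>c::'a \<Rightarrow> int. \<Sum>b\<in>C. of_int (c b) *\<^sub>R b)"
    using assms(1) unfolding lattice_basis_def by blast
  ultimately show ?thesis by (simp only:) (rule range_eqI, assumption)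
qed

lemma lattice_basis_coordinate:
  assumes "lattice_basis N C" "b \<in> C"
  obtains h :: "'a::euclidean_space \<Rightarrow> real" where "linear h" "h b = 1" "\<And>c. c \<in> C \<Longrightarrow> c \<noteq> b \<Longrightarrow> h c = 0"
    "\<And>x. x \<in> N \<Longrightarrow> h x \<in> \<int>"
proof -
  have C: "independent C" and N: "N = range (\<lambda>c::'a \<Rightarrow> int. \<Sum>b\<in>C. of_int (c b) *\<^sub>R b)"
    using assms(1) unfolding lattice_basis_def by auto
  obtain h :: "'a \<Rightarrow> real" where h: "linear h" "h b = 1" "\<And>x. x \<in> span (C - {b}) \<Longrightarrow> h x = 0"
    using dual_functional_exists[OF C assms(2)] by blast
  have hC: "h c = 0" if "c \<in> C" "c \<noteq> b" for c using that h(3) by (simp add: span_base)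
  have "h x \<in> \<int>" if x: "x \<in> N" for x
  proof -
    obtain k :: "'a \<Rightarrow> int" where "x = (\<Sum>b\<in>C. of_int (k b) *\<^sub>R b)" using x N by auto
    then have "h x = (\<Sum>c\<in>C. of_int (k c) * h c)" by (simp add: linear_sum[OF h(1)] linear_cmul[OF h(1)])
    moreover have "of_int (k c) * h c \<in> \<int>" if "c \<in> C" for c
      using that hC h(2) by (cases "c = b") auto
    ultimately show ?thesis by (simp add: Ints_sum)
  qed
  then show thesis using that h hC by blast
qed

text \<open>A coordinate outside \<open>A\<close> vanishes at \<open>x\<close>. It is a positive
  combination of the non-negative coordinates of \<open>p\<close> and \<open>q\<close>, so these
  vanish too.\<close>

lemma face_of_independent_cone:
  assumes B: "independent (B :: 'a::euclidean_space set)" "A \<subseteq> B"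
  shows "(convex_cone hull A) face_of (convex_cone hull B)"
  unfolding face_of_def
proof (intro conjI ballI impI)
  show "convex_cone hull A \<subseteq> convex_cone hull B" by (rule hull_mono[OF B(2)])
  show "convex (convex_cone hull A)" by (rule convex_convex_cone_hull)
  have fB: "finite B" using B(1) by (rule independent_imp_finite)
  have fA: "finite A" using fB B(2) finite_subset by blast
  fix p q x assume p: "p \<in> convex_cone hull B" and q: "q \<in> convex_cone hull B"
    and x: "x \<in> convex_cone hull A" "x \<in> open_segment p q"
  obtain c where c: "p = (\<Sum>b\<in>B. c b *\<^sub>R b)" "\<forall>b\<in>B. 0 \<le> c b"
    using p unfolding convex_cone_hull_finite[OF fB] by auto
  obtain e where e: "q = (\<Sum>b\<in>B. e b *\<^sub>R b)" "\<forall>b\<in>B. 0 \<le> e b"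
    using q unfolding convex_cone_hull_finite[OF fB] by auto
  obtain u where u: "0 < u" "u < 1" "x = (1 - u) *\<^sub>R p + u *\<^sub>R q" using x(2) unfolding in_segment by auto
  have z: "c b = 0 \<and> e b = 0" if b: "b \<in> B - A" for b
  proof -
    obtain h :: "'a \<Rightarrow> real" where h: "linear h" "h b = 1" "\<And>x. x \<in> span (B - {b}) \<Longrightarrow> h x = 0"
      using dual_functional_exists[OF B(1)] b by blast
    have co: "h (\<Sum>b\<in>B. k b *\<^sub>R b) = k b" for k
    proof -
      have "h (\<Sum>b\<in>B. k b *\<^sub>R b) = (\<Sum>b'\<in>B. k b' * h b')" using h(1) by (simp add: linear_sum linear_cmul)
      also have "\<dots> = (\<Sum>b'\<in>B. if b' = b then k b else 0)"
        by (rule sum.cong) (use h in \<open>auto simp: span_base\<close>)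
      finally show ?thesis using b fB by simp
    qed
    have "A \<subseteq> B - {b}" using b B(2) by auto
    then have "x \<in> span (B - {b})"
      using x(1) span_convex_cone_hull[of A] span_mono[of A "B - {b}"] span_superset[of "convex_cone hull A"] by auto
    then have "(1 - u) * c b + u * e b = 0"
      using h(3)[of x] h(1) u(3) co c(1) e(1) by (simp add: linear_add linear_cmul)
    moreover have "0 \<le> (1 - u) * c b" "0 \<le> u * e b" using u c e b by auto
    ultimately have "(1 - u) * c b = 0" "u * e b = 0" by linarith+
    then show ?thesis using u by simp
  qed
  have "p = (\<Sum>b\<in>A. c b *\<^sub>R b)" "q = (\<Sum>b\<in>A. e b *\<^sub>R b)"
    unfolding c(1) e(1) by (rule sum.mono_neutral_right; use fB B(2) z in force)+
  then show "p \<in> convex_cone hull A" "q \<in> convex_cone hull A"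
    unfolding convex_cone_hull_finite[OF fA] using c(2) e(2) B(2) by blast+
qed

context modification
begin

text \<open>Inclusion can stand for the face relation, by \<open>cone_face_iff\<close>.\<close>

definition rays :: "'a set \<Rightarrow> 'a set set" where
  "rays \<sigma> = {\<rho>\<in>cones \<Sigma> 1. \<rho> \<subseteq> \<sigma>}"

lemma cone_monomial_eq: "\<sigma> \<in> \<Sigma> \<Longrightarrow> cone_monomial \<Sigma> \<sigma> = (\<Prod>\<rho>\<in>rays \<sigma>. mvar \<rho>)"
  unfolding cone_monomial_def rays_def using cone_face_iff[of \<sigma>]
  by (intro prod.cong) (auto simp: cones_def)

text \<open>If \<open>b\<close> has a positive coefficient in a point of \<open>\<tau>\<close>, that
  multiple of \<open>b\<close> is a summand of a point of a face, so it lies in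
  \<open>\<tau>\<close>, and so does \<open>b\<close>. Only generators inside \<open>\<tau>\<close>
  can therefore occur.\<close>

lemma subcone_generators:
  assumes "\<sigma> \<in> \<Sigma>" "\<sigma> = convex_cone hull B" "independent B" "\<tau> \<in> \<Sigma>" "\<tau> \<subseteq> \<sigma>"
  shows "\<tau> = convex_cone hull (B \<inter> \<tau>)" "dim \<tau> = card (B \<inter> \<tau>)"
proof -
  have fB: "finite B" using assms(3) by (rule independent_imp_finite)
  show \<tau>: "\<tau> = convex_cone hull (B \<inter> \<tau>)"
  proof (rule subset_antisym)
    show "convex_cone hull (B \<inter> \<tau>) \<subseteq> \<tau>" by (rule hull_minimal) (use convex_cone_fan assms(4) in auto)
    show "\<tau> \<subseteq> convex_cone hull (B \<inter> \<tau>)"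
    proof
      fix x assume x: "x \<in> \<tau>"
      then have "x \<in> convex_cone hull B" using assms by auto
      then obtain c where c: "x = (\<Sum>b\<in>B. c b *\<^sub>R b)" "\<forall>b\<in>B. 0 \<le> c b"
        unfolding convex_cone_hull_finite[OF fB] by auto
      have B\<sigma>: "B \<subseteq> \<sigma>" using assms(2) hull_subset[of B convex_cone] by auto
      have "c b = 0" if b: "b \<in> B - \<tau>" for b
      proof (rule ccontr)
        assume "c b \<noteq> 0"
        then have pos: "c b > 0" using c(2) b by force
        have "(\<Sum>b\<in>B - {b}. c b *\<^sub>R b) \<in> convex_cone hull B"
        proof -
          have "(\<Sum>b'\<in>B - {b}. c b' *\<^sub>R b') = (\<Sum>b'\<in>B. (if b' = b then 0 else c b') *\<^sub>R b')"
            by (rule sum.mono_neutral_cong_left) (use fB in auto)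
          then show ?thesis unfolding convex_cone_hull_finite[OF fB] using c(2)
            by (intro CollectI exI[of _ "\<lambda>b'. if b' = b then 0 else c b'"]) auto
        qed
        moreover have "x = c b *\<^sub>R b + (\<Sum>b\<in>B - {b}. c b *\<^sub>R b)" unfolding c(1) using sum.remove[OF fB, of b] b by blast
        moreover have "c b *\<^sub>R b \<in> \<sigma>" using b B\<sigma> pos assms(1) by (intro cone_scale) auto
        ultimately have "c b *\<^sub>R b \<in> \<tau>" using cone_sumD[OF assms(1,4,5)] x assms(2) by blast
        from cone_scale[OF assms(4) this, of "1 / c b"] show False using pos b by simp
      qed
      then have "x = (\<Sum>b\<in>B \<inter> \<tau>. c b *\<^sub>R b)"
        unfolding c(1) by (intro sum.mono_neutral_right) (use fB in auto)
      moreover have "finite (B \<inter> \<tau>)" using fB by simp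
      ultimately show "x \<in> convex_cone hull (B \<inter> \<tau>)"
        using c(2) by (auto simp: convex_cone_hull_finite)
    qed
  qed
  have "independent (B \<inter> \<tau>)" using assms(3) independent_mono by blast
  then have "dim (convex_cone hull (B \<inter> \<tau>)) = card (B \<inter> \<tau>)"
    unfolding dim_convex_cone_hull by (rule dim_eq_card_independent)
  then show "dim \<tau> = card (B \<inter> \<tau>)" using \<tau> by simp
qed

lemma rays_independent:
  assumes "\<sigma> \<in> \<Sigma>" "\<sigma> = convex_cone hull B" "independent B"
  shows "rays \<sigma> = (\<lambda>b. convex_cone hull {b}) ` B"
proof (intro subset_antisym subsetI)
  fix \<rho> assume "\<rho> \<in> rays \<sigma>"
  then have \<rho>: "\<rho> \<in> \<Sigma>" "dim \<rho> = 1" "\<rho> \<subseteq> \<sigma>" unfolding rays_def cones_def by auto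
  note sg = subcone_generators[OF assms \<rho>(1,3)]
  then obtain b where "B \<inter> \<rho> = {b}" using \<rho>(2) by (metis card_1_singletonE)
  then show "\<rho> \<in> (\<lambda>b. convex_cone hull {b}) ` B" using sg(1) by auto
next
  fix \<rho> assume "\<rho> \<in> (\<lambda>b. convex_cone hull {b}) ` B"
  then obtain b where b: "b \<in> B" "\<rho> = convex_cone hull {b}" by auto
  have "cone_face \<rho> \<sigma>" unfolding cone_face_def b(2) assms(2)
    using face_of_independent_cone[OF assms(3), of "{b}"] b(1) convex_cone_hull_nonempty by auto
  then have "\<rho> \<in> \<Sigma>" "\<rho> \<subseteq> \<sigma>" using fan_face assms(1) face_of_imp_subset unfolding cone_face_def by blast+
  moreover have "b \<noteq> 0" using b(1) assms(3) dependent_zero by blast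
  then have "dim \<rho> = 1" unfolding b(2) dim_convex_cone_hull by (simp add: dim_eq_card_independent)
  ultimately show "\<rho> \<in> rays \<sigma>" unfolding rays_def cones_def by auto
qed

lemma inj_ray_hull: "independent B \<Longrightarrow> inj_on (\<lambda>b. convex_cone hull {b}) (B :: 'a set)"
proof (rule inj_onI)
  fix a b assume ab: "independent B" "a \<in> B" "b \<in> B" "convex_cone hull {a} = convex_cone hull {b}"
  have "a \<in> convex_cone hull {b}" using ab(4) hull_inc[of a "{a}"] by blast
  then have "a \<in> span {b}" using span_convex_cone_hull[of "{b}"] span_base by blast
  show "a = b"
  proof (rule ccontr)
    assume "a \<noteq> b"
    then have "span {b} \<subseteq> span (B - {a})" using ab by (intro span_mono) auto
    then show False using ab(1,2) \<open>a \<in> span {b}\<close> unfolding dependent_def by blast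
  qed
qed

end

section \<open>Unimodular cones and the degree of the vertical ray\<close>

locale unimodular_modification = modification +
  assumes unimodular: "unimodular_fan N \<Sigma>"
begin

lemma basis:
  assumes "\<sigma> \<in> \<Sigma>"
  obtains B C where "B \<subseteq> C" "lattice_basis N C" "\<sigma> = convex_cone hull B" "independent B" "finite B"
proof -
  obtain B C where BC: "B \<subseteq> C" "lattice_basis N C" "\<sigma> = convex_cone hull B"
    using unimodular assms unfolding unimodular_fan_def by blast
  then have "independent B" using independent_mono unfolding lattice_basis_def by blast
  then show thesis using that BC independent_imp_finite by blast
qed

lemma hull_rays:
  assumes "\<sigma> \<in> \<Sigma>"
  shows "convex_cone hull (\<Union>(rays \<sigma>)) = \<sigma>"
proof -
  obtain B C where B: "B \<subseteq> C" "lattice_basis N C" "\<sigma> = convex_cone hull B" "independent B" "finite B"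
    by (rule basis[OF assms])
  have "B \<subseteq> \<Union>(rays \<sigma>)" unfolding rays_independent[OF assms B(3,4)] by (auto intro: hull_inc)
  then have "\<sigma> \<subseteq> convex_cone hull (\<Union>(rays \<sigma>))" unfolding B(3) by (rule hull_mono)
  moreover have "convex_cone hull (\<Union>(rays \<sigma>)) \<subseteq> \<sigma>"
    by (rule hull_minimal) (use convex_cone_fan[OF assms] in \<open>auto simp: rays_def\<close>)
  ultimately show ?thesis by blast
qed

text \<open>The coordinate of \<open>b\<close> is integral on \<open>N\<close>, so no fractional
  multiple of \<open>b\<close> is a lattice point.\<close>

lemma ray_gen_hull:
  assumes "lattice_basis N C" "b \<in> C"
  shows "ray_gen N (convex_cone hull {b}) = b"
proof (rule ray_gen_eqI)
  obtain h :: "'a \<Rightarrow> real" where h: "linear h" "h b = 1" "\<And>x. x \<in> N \<Longrightarrow> h x \<in> \<int>"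
    using lattice_basis_coordinate[OF assms] by metis
  show "convex_cone hull {b} \<inter> N = range (\<lambda>k::nat. of_nat k *\<^sub>R b)"
  proof (intro subset_antisym subsetI)
    fix x assume "x \<in> convex_cone hull {b} \<inter> N"
    then obtain c where c: "x = c *\<^sub>R b" "0 \<le> c" "x \<in> N" unfolding ray_hull by auto
    then have "c \<in> \<int>" using h(3)[of x] h(1,2) by (simp add: linear_cmul)
    then obtain k :: nat where "c = of_nat k"
      using c(2) by (metis Ints_cases nonneg_int_cases of_int_0_le_iff of_int_of_nat_eq)
    then show "x \<in> range (\<lambda>k::nat. of_nat k *\<^sub>R b)" using c(1) by auto
  next
    fix x assume "x \<in> range (\<lambda>k::nat. of_nat k *\<^sub>R b)"
    then show "x \<in> convex_cone hull {b} \<inter> N"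
      unfolding ray_hull using lattice_scale_nat[OF lattice lattice_basis_in[OF assms]] by auto
  qed
qed

text \<open>Unimodularity makes the one missing basis vector a generator of the lattice of
  \<open>\<sigma>\<close> modulo that of \<open>\<delta>\<close>. Hence the generator of the extra
  ray itself is a normal lift, which lets orders be read off from ray generators.\<close>

lemma codim1_extension:
  assumes \<delta>: "\<delta> \<in> \<Sigma>" and \<sigma>: "\<sigma> \<in> \<Sigma>" "\<delta> \<subseteq> \<sigma>" "dim \<sigma> = dim \<delta> + 1" and \<rho>: "\<rho> \<in> rays \<sigma>" "\<rho> \<notin> rays \<delta>"
  shows "rays \<sigma> = insert \<rho> (rays \<delta>)" "is_normal_lift \<delta> \<sigma> (ray_gen N \<rho>)"
proof -
  obtain B C where B: "B \<subseteq> C" "lattice_basis N C" "\<sigma> = convex_cone hull B" "independent B" "finite B"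
    by (rule basis[OF \<sigma>(1)])
  have r\<sigma>: "rays \<sigma> = (\<lambda>b. convex_cone hull {b}) ` B" by (rule rays_independent[OF \<sigma>(1) B(3,4)])
  then obtain b where b: "b \<in> B" "\<rho> = convex_cone hull {b}" using \<rho>(1) by auto
  have b\<delta>: "b \<notin> \<delta>"
  proof
    assume "b \<in> \<delta>"
    then have "\<rho> \<subseteq> \<delta>" unfolding b(2) using convex_cone_fan[OF \<delta>] by (intro hull_minimal) auto
    then show False using \<rho> unfolding rays_def by auto
  qed
  note sg = subcone_generators[OF \<sigma>(1) B(3,4) \<delta> \<sigma>(2)]
  have "dim \<sigma> = card B" unfolding B(3) dim_convex_cone_hull using B(4) by (rule dim_eq_card_independent)
  \<comment> \<open>Counting generators: \<open>B \<inter> \<delta>\<close> has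
    \<open>dim \<delta>\<close> elements, one fewer than \<open>B\<close>, so \<open>b\<close> is
    the only generator outside \<open>\<delta>\<close>.\<close>
  then have "card (insert b (B \<inter> \<delta>)) = card B" using \<sigma>(3) sg(2) B(5) b\<delta> by simp
  then have Beq: "insert b (B \<inter> \<delta>) = B" using b(1) B(5) by (intro card_subset_eq) auto
  have "independent (B \<inter> \<delta>)" using B(4) independent_mono by blast
  from rays_independent[OF \<delta> sg(1) this]
  have "rays \<delta> = (\<lambda>b. convex_cone hull {b}) ` (B \<inter> \<delta>)" .
  then show "rays \<sigma> = insert \<rho> (rays \<delta>)" unfolding r\<sigma> b(2) using Beq by (metis image_insert)
  have bC: "b \<in> C" using b(1) B(1) by auto
  have e: "ray_gen N \<rho> = b" unfolding b(2) by (rule ray_gen_hull[OF B(2) bC])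
  obtain h :: "'a \<Rightarrow> real" where h: "linear h" "h b = 1" "\<And>c. c \<in> C \<Longrightarrow> c \<noteq> b \<Longrightarrow> h c = 0"
    "\<And>x. x \<in> N \<Longrightarrow> h x \<in> \<int>"
    using lattice_basis_coordinate[OF B(2) bC] by metis
  have b\<sigma>: "b \<in> \<sigma>" unfolding B(3) by (rule hull_inc[OF b(1)])
  have bN: "b \<in> N" by (rule lattice_basis_in[OF B(2) bC])
  \<comment> \<open>Modulo \<open>span \<delta>\<close> only the \<open>b\<close>-coordinate
    survives, and \<open>h\<close> is integral on all of \<open>N\<close>.\<close>
  have "quot \<delta> x = h x *\<^sub>R quot \<delta> b" if "x \<in> span \<sigma>" for x
  proof -
    have "x \<in> span (insert b (B \<inter> \<delta>))" using that unfolding B(3) span_convex_cone_hull Beq .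
    then obtain k where k: "x - k *\<^sub>R b \<in> span (B \<inter> \<delta>)"
      unfolding span_breakdown_eq by blast
    have "h (x - k *\<^sub>R b) = 0"
      by (rule linear_eq_0_on_span[OF h(1) _ k]) (use h(3) b\<delta> B(1) in auto)
    then have "h x = k" using h(1,2) by (simp add: linear_diff linear_cmul)
    moreover have "x - k *\<^sub>R b \<in> span \<delta>" using k span_mono[of "B \<inter> \<delta>" \<delta>] by auto
    ultimately show ?thesis by (simp add: quot_eq_iff flip: quot_scale)
  qed
  then have q: "quot \<delta> x \<in> range (\<lambda>k::int. of_int k *\<^sub>R quot \<delta> b)" if "x \<in> cone_lattice N \<sigma>" for x
    using that h(4)[of x] unfolding cone_lattice_def by (auto elim!: Ints_cases)
  show "is_normal_lift \<delta> \<sigma> (ray_gen N \<rho>)"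
    unfolding is_normal_lift_def e
  proof (intro conjI subset_antisym subsetI)
    show "b \<in> cone_lattice N \<sigma>" unfolding cone_lattice_def using bN b\<sigma> by (simp add: span_base)
    show "quot \<delta> b \<in> quot \<delta> ` \<sigma>" using b\<sigma> by simp
    fix y assume "y \<in> quot \<delta> ` cone_lattice N \<sigma>"
    then show "y \<in> range (\<lambda>k::int. of_int k *\<^sub>R quot \<delta> b)" using q by blast
  next
    fix y assume "y \<in> range (\<lambda>k::int. of_int k *\<^sub>R quot \<delta> b)"
    then obtain k :: int where "y = quot \<delta> (of_int k *\<^sub>R b)" by (auto simp: quot_scale)
    moreover have "of_int k *\<^sub>R b \<in> cone_lattice N \<sigma>" unfolding cone_lattice_def
      using bN b\<sigma> lattice by (auto intro: lattice_scale span_scale span_base)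
    ultimately show "y \<in> quot \<delta> ` cone_lattice N \<sigma>" by blast
  qed
qed

lemma cone_eq_dim:
  assumes "\<sigma> \<in> \<Sigma>" "\<tau> \<in> \<Sigma>" "\<tau> \<subseteq> \<sigma>" "dim \<tau> = dim \<sigma>"
  shows "\<tau> = \<sigma>"
proof -
  have "span \<tau> = span \<sigma>" by (rule subspace_dim_equal) (use assms in \<open>auto simp: dim_span span_mono\<close>)
  then show ?thesis using cone_Int_span[OF assms(1-3)] span_superset[of \<sigma>] by auto
qed

text \<open>\<open>\<Delta>\<close> also contains the proper faces of the cones of order 1; a face
  of full dimension is the cone itself.\<close>

lemma ord_div_\<Delta>:
  assumes \<delta>: "\<delta> \<in> \<Delta>" "dim \<delta> + 1 = d"
  shows "\<delta> \<in> codim1_cones \<Sigma> d" "ord_div N \<Sigma> d f \<delta> = 1"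
proof -
  obtain \<zeta> where z: "\<zeta> \<in> codim1_cones \<Sigma> d" "ord_div N \<Sigma> d f \<zeta> = 1" "cone_face \<delta> \<zeta>"
    using \<delta>(1) unfolding \<Delta>_def div_subfan_def by auto
  then have "\<zeta> \<in> \<Sigma>" "dim \<zeta> + 1 = d" "\<delta> \<subseteq> \<zeta>"
    unfolding codim1_cones_def cone_face_def using face_of_imp_subset by auto
  then have "\<delta> = \<zeta>" using \<delta> \<Delta>_subset by (intro cone_eq_dim) auto
  then show "\<delta> \<in> codim1_cones \<Sigma> d" "ord_div N \<Sigma> d f \<delta> = 1" using z by auto
qed

text \<open>The dictionary between the index set of rays left over by
  \<open>F_times_monomial\<close> and the maximal cones over which the order at
  \<open>\<delta>\<close> is summed.\<close>

lemma ray_extensions: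
  assumes \<delta>: "\<delta> \<in> \<Sigma>" "dim \<delta> + 1 = d"
  defines "H \<equiv> \<lambda>\<rho>. convex_cone hull (\<Union>(insert \<rho> (rays \<delta>)))"
    and "R \<equiv> {\<rho>\<in>cones \<Sigma> 1. \<rho> \<notin> rays \<delta> \<and> convex_cone hull (\<Union>(insert \<rho> (rays \<delta>))) \<in> \<Sigma>}"
  shows "bij_betw H R {\<sigma>\<in>cones \<Sigma> d. \<delta> \<subseteq> \<sigma>}"
    and "\<rho> \<in> R \<Longrightarrow> rays (H \<rho>) = insert \<rho> (rays \<delta>)"
    and "\<rho> \<in> R \<Longrightarrow> is_normal_lift \<delta> (H \<rho>) (ray_gen N \<rho>)"
proof -
  have H: "H \<rho> \<in> {\<sigma>\<in>cones \<Sigma> d. \<delta> \<subseteq> \<sigma>} \<and> rays (H \<rho>) = insert \<rho> (rays \<delta>) \<and>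
      is_normal_lift \<delta> (H \<rho>) (ray_gen N \<rho>)" if \<rho>: "\<rho> \<in> R" for \<rho>
  proof -
    have H\<Sigma>: "H \<rho> \<in> \<Sigma>" and \<rho>1: "\<rho> \<in> cones \<Sigma> 1" "\<rho> \<notin> rays \<delta>" using \<rho> unfolding H_def R_def by auto
    have "convex_cone hull (\<Union>(rays \<delta>)) \<subseteq> H \<rho>" unfolding H_def by (rule hull_mono) auto
    then have sub: "\<delta> \<subseteq> H \<rho>" unfolding hull_rays[OF \<delta>(1)] .
    have "\<rho> \<subseteq> H \<rho>" unfolding H_def by (auto intro: hull_inc)
    then have \<rho>H: "\<rho> \<in> rays (H \<rho>)" using \<rho>1 unfolding rays_def by auto
    have "H \<rho> \<noteq> \<delta>" using \<rho>H \<rho>1(2) by auto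
    then have "dim \<delta> \<noteq> dim (H \<rho>)" using cone_eq_dim[OF H\<Sigma> \<delta>(1) sub] by auto
    moreover have "dim \<delta> \<le> dim (H \<rho>)" by (rule dim_subset[OF sub])
    ultimately have dim: "dim (H \<rho>) = dim \<delta> + 1" using dim_le[OF H\<Sigma>] \<delta>(2) by linarith
    show ?thesis
      using codim1_extension[OF \<delta>(1) H\<Sigma> sub dim \<rho>H \<rho>1(2)] H\<Sigma> sub dim \<delta>(2) unfolding cones_def by simp
  qed
  have "inj_on H R"
  proof (rule inj_onI)
    fix \<rho> \<rho>' assume a: "\<rho> \<in> R" "\<rho>' \<in> R" "H \<rho> = H \<rho>'"
    then have "insert \<rho> (rays \<delta>) = insert \<rho>' (rays \<delta>)" using H by metis
    then show "\<rho> = \<rho>'" using a unfolding R_def by blast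
  qed
  moreover have "\<exists>\<rho>\<in>R. \<sigma> = H \<rho>" if "\<sigma> \<in> {\<sigma>\<in>cones \<Sigma> d. \<delta> \<subseteq> \<sigma>}" for \<sigma>
  proof -
    have \<sigma>: "\<sigma> \<in> \<Sigma>" "\<delta> \<subseteq> \<sigma>" "dim \<sigma> = dim \<delta> + 1" using that \<delta>(2) unfolding cones_def by auto
    have "\<not> rays \<sigma> \<subseteq> rays \<delta>"
    proof
      assume "rays \<sigma> \<subseteq> rays \<delta>"
      then have "convex_cone hull (\<Union>(rays \<sigma>)) \<subseteq> convex_cone hull (\<Union>(rays \<delta>))" by (intro hull_mono) auto
      then have "\<sigma> \<subseteq> \<delta>" using hull_rays \<sigma>(1) \<delta>(1) by simp
      then show False using dim_subset[of \<sigma> \<delta>] \<sigma>(3) by simp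
    qed
    then obtain \<rho> where \<rho>: "\<rho> \<in> rays \<sigma>" "\<rho> \<notin> rays \<delta>" by auto
    have "H \<rho> = \<sigma>" unfolding H_def codim1_extension(1)[OF \<delta>(1) \<sigma> \<rho>, symmetric] by (rule hull_rays[OF \<sigma>(1)])
    moreover have "\<rho> \<in> R" using \<rho> \<sigma>(1) \<open>H \<rho> = \<sigma>\<close> unfolding R_def H_def rays_def by auto
    ultimately show ?thesis by blast
  qed
  ultimately show "bij_betw H R {\<sigma>\<in>cones \<Sigma> d. \<delta> \<subseteq> \<sigma>}"
    using H unfolding bij_betw_def by blast
  show "\<rho> \<in> R \<Longrightarrow> rays (H \<rho>) = insert \<rho> (rays \<delta>)"
    "\<rho> \<in> R \<Longrightarrow> is_normal_lift \<delta> (H \<rho>) (ray_gen N \<rho>)" using H by auto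
qed

lemma vertical_ray_degree:
  assumes \<delta>: "\<delta> \<in> \<Delta>" "dim \<delta> + 1 = d"
  obtains c :: "'a set \<Rightarrow> int" where "(\<Sum>\<sigma>\<in>{\<sigma>\<in>cones \<Sigma> d. \<delta> \<subseteq> \<sigma>}. c \<sigma>) = 1"
    "- (F * (\<Prod>\<rho>\<in>rays \<delta>. mvar \<rho>)) - (\<Sum>\<sigma>\<in>{\<sigma>\<in>cones \<Sigma> d. \<delta> \<subseteq> \<sigma>}. of_int (c \<sigma>) * cone_monomial \<Sigma> \<sigma>) \<in> I"
proof -
  have \<delta>\<Sigma>: "\<delta> \<in> \<Sigma>" using \<delta> \<Delta>_subset by auto
  define H where "H \<rho> = convex_cone hull (\<Union>(insert \<rho> (rays \<delta>)))" for \<rho>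
  define R where "R = {\<rho>\<in>cones \<Sigma> 1. \<rho> \<notin> rays \<delta> \<and> convex_cone hull (\<Union>(insert \<rho> (rays \<delta>))) \<in> \<Sigma>}"
  define A where "A = {\<sigma>\<in>cones \<Sigma> d. \<delta> \<subseteq> \<sigma>}"
  have bij: "bij_betw H R A" and raysH: "\<And>\<rho>. \<rho> \<in> R \<Longrightarrow> rays (H \<rho>) = insert \<rho> (rays \<delta>)"
    and liftH: "\<And>\<rho>. \<rho> \<in> R \<Longrightarrow> is_normal_lift \<delta> (H \<rho>) (ray_gen N \<rho>)"
    using ray_extensions[OF \<delta>\<Sigma> \<delta>(2)] unfolding H_def R_def A_def by auto
  define r where "r = the_inv_into R H"
  have r: "r (H \<rho>) = \<rho>" if "\<rho> \<in> R" for \<rho>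
    unfolding r_def using bij that by (simp add: bij_betw_def the_inv_into_f_f)
  obtain m where m: "integral_form N m" "\<And>x. x \<in> \<delta> \<Longrightarrow> m x = f x" using integral_form_on_cone[OF \<delta>\<Sigma>] by blast
  have lm: "linear m" using m(1) unfolding integral_form_def by simp
  define n where "n \<rho> = \<lfloor>f (ray_gen N \<rho>) - m (ray_gen N \<rho>)\<rfloor>" for \<rho>
  have n: "of_int (n \<rho>) = f (ray_gen N \<rho>) - m (ray_gen N \<rho>)" if "\<rho> \<in> R" for \<rho>
  proof -
    have "f (ray_gen N \<rho>) \<in> \<int>" "m (ray_gen N \<rho>) \<in> \<int>"
      using f_ray_gen_int ray_gen_in that m(1) unfolding R_def integral_form_def by auto
    then show ?thesis unfolding n_def by (auto elim!: Ints_cases)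
  qed
  have sumAR: "(\<Sum>\<sigma>\<in>A. g \<sigma>) = (\<Sum>\<rho>\<in>R. g (H \<rho>))" for g :: "'a set \<Rightarrow> 'z::comm_monoid_add"
    using sum.reindex_bij_betw[OF bij, of g] by simp
  \<comment> \<open>The generator of the extra ray serves as lift in place of
    \<open>normal_lift\<close>, so that the order involves the same numbers as the coefficients of
    \<open>F\<close>.\<close>
  define u where "u \<sigma> = ray_gen N (r \<sigma>)" for \<sigma>
  note c1 = ord_div_\<Delta>[OF \<delta>]
  have u: "quot \<delta> (u \<sigma>) = normal_gen N \<delta> \<sigma> \<and> u \<sigma> \<in> \<sigma>" if \<sigma>: "\<sigma> \<in> A" for \<sigma>
  proof -
    obtain \<rho> where \<rho>: "\<rho> \<in> R" "\<sigma> = H \<rho>" using bij \<sigma> unfolding bij_betw_def by auto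
    then have "is_normal_lift \<delta> \<sigma> (u \<sigma>)" using liftH r unfolding u_def by simp
    moreover have "\<rho> \<subseteq> \<sigma>" using raysH[OF \<rho>(1)] \<rho>(2) unfolding rays_def by auto
    then have "u \<sigma> \<in> \<sigma>" using ray_gen_in(1)[of \<rho>] \<rho> r unfolding u_def R_def by auto
    ultimately show ?thesis using normal_gen_eq[OF _ \<delta>\<Sigma>] \<sigma> unfolding A_def cones_def by auto
  qed
  have "ord_div N \<Sigma> d f \<delta> = - (\<Sum>\<sigma>\<in>A. cone_form f \<sigma> (u \<sigma>) - m (u \<sigma>))
      + (cone_form f \<delta> (\<Sum>\<sigma>\<in>A. u \<sigma>) - m (\<Sum>\<sigma>\<in>A. u \<sigma>))"
    unfolding A_def by (rule ord_div_eq[OF c1(1) lm]) (use u in \<open>auto simp: A_def\<close>)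
  \<comment> \<open>Balancing puts the sum of the lifts into \<open>span \<delta>\<close>, where the
    form of \<open>f\<close> agrees with \<open>m\<close>; the second term of the order therefore
    vanishes.\<close>
  moreover have "(\<Sum>\<sigma>\<in>A. u \<sigma>) \<in> span \<delta>"
    unfolding A_def by (rule normal_lifts_sum_in_span[OF c1(1)]) (use u in \<open>auto simp: A_def\<close>)
  then have "cone_form f \<delta> (\<Sum>\<sigma>\<in>A. u \<sigma>) = m (\<Sum>\<sigma>\<in>A. u \<sigma>)"
    by (intro cone_form_eq[OF lm]) (use m(2) in auto)
  moreover have "(\<Sum>\<sigma>\<in>A. cone_form f \<sigma> (u \<sigma>) - m (u \<sigma>)) = (\<Sum>\<sigma>\<in>A. f (u \<sigma>) - m (u \<sigma>))"
    by (rule sum.cong) (use u cone_form_in in \<open>auto simp: A_def cones_def\<close>)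
  moreover have "(\<Sum>\<sigma>\<in>A. f (u \<sigma>) - m (u \<sigma>)) = (\<Sum>\<rho>\<in>R. of_int (n \<rho>))"
    unfolding sumAR u_def by (rule sum.cong) (use r n in auto)
  \<comment> \<open>The order is 1 and equals minus the sum of the \<open>n \<rho>\<close>; this is
    the reason why \<open>- F\<close>, and not \<open>F\<close>, has coefficient sum 1.\<close>
  ultimately have "real_of_int (\<Sum>\<rho>\<in>R. n \<rho>) = - 1" using c1(2) by simp
  then have n1: "(\<Sum>\<rho>\<in>R. n \<rho>) = - 1" by linarith
  have fr: "finite (rays \<delta>)" unfolding rays_def using finite_rays by simp
  have "F * (\<Prod>\<rho>\<in>rays \<delta>. mvar \<rho>) - (\<Sum>\<rho>\<in>R. of_int (n \<rho>) * (\<Prod>\<rho>'\<in>insert \<rho> (rays \<delta>). mvar \<rho>')) \<in> I"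
    unfolding R_def n_def by (rule F_times_monomial) (use m in \<open>auto simp: rays_def\<close>)
  then have "- (F * (\<Prod>\<rho>\<in>rays \<delta>. mvar \<rho>)
      - (\<Sum>\<rho>\<in>R. of_int (n \<rho>) * (\<Prod>\<rho>'\<in>insert \<rho> (rays \<delta>). mvar \<rho>'))) \<in> I" by (rule chow_ideal_uminus)
  moreover have "(\<Sum>\<rho>\<in>R. of_int (n \<rho>) * (\<Prod>\<rho>'\<in>insert \<rho> (rays \<delta>). mvar \<rho>'))
      = (\<Sum>\<sigma>\<in>A. of_int (n (r \<sigma>)) * cone_monomial \<Sigma> \<sigma>)"
    unfolding sumAR
  proof (rule sum.cong)
    fix \<rho> assume \<rho>: "\<rho> \<in> R"
    have "cone_monomial \<Sigma> (H \<rho>) = (\<Prod>\<rho>'\<in>insert \<rho> (rays \<delta>). mvar \<rho>')"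
      using cone_monomial_eq[of "H \<rho>"] raysH[OF \<rho>] \<rho> unfolding R_def H_def by simp
    then show "of_int (n \<rho>) * (\<Prod>\<rho>'\<in>insert \<rho> (rays \<delta>). mvar \<rho>') = of_int (n (r (H \<rho>))) * cone_monomial \<Sigma> (H \<rho>)"
      using r[OF \<rho>] by simp
  qed simp
  ultimately have I: "- (F * (\<Prod>\<rho>\<in>rays \<delta>. mvar \<rho>)) - (\<Sum>\<sigma>\<in>A. of_int (- n (r \<sigma>)) * cone_monomial \<Sigma> \<sigma>) \<in> I"
    by (simp add: sum_negf)
  have "(\<Sum>\<sigma>\<in>A. - n (r \<sigma>)) = (\<Sum>\<rho>\<in>R. - n \<rho>)" unfolding sumAR by (rule sum.cong) (use r in auto)
  then have "(\<Sum>\<sigma>\<in>A. - n (r \<sigma>)) = 1" using n1 by (simp add: sum_negf)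
  then show thesis using that[of "\<lambda>\<sigma>. - n (r \<sigma>)"] I unfolding A_def by blast
qed

end

section \<open>Chow classes, graded pieces and perfect pairings\<close>

lemma carrier_chow_ring: "carrier (chow_ring N \<Sigma>) = chow_class N \<Sigma> ` mpolys (cones \<Sigma> 1)"
  unfolding chow_ring_def chow_class_def ray_ring_def FactRing_def A_RCOSETS_def' by auto

lemma chow_class_eq_iff:
  "p \<in> mpolys (cones \<Sigma> 1) \<Longrightarrow> q \<in> mpolys (cones \<Sigma> 1) \<Longrightarrow>
    chow_class N \<Sigma> p = chow_class N \<Sigma> q \<longleftrightarrow> p - q \<in> chow_ideal N \<Sigma>"
  unfolding chow_class_def ray_ring_def by (rule mpoly_coset_eq_iff[OF ideal_chow_ideal])

lemma ring_chow_ring: "ring (chow_ring N \<Sigma>)"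
  unfolding chow_ring_def ray_ring_def by (rule ideal.quotient_is_ring[OF ideal_chow_ideal])

lemma chow_class_add:
  assumes "p \<in> mpolys (cones \<Sigma> 1)" "q \<in> mpolys (cones \<Sigma> 1)"
  shows "chow_class N \<Sigma> p \<oplus>\<^bsub>chow_ring N \<Sigma>\<^esub> chow_class N \<Sigma> q = chow_class N \<Sigma> (p + q)"
  using ring_hom_add[OF ideal.rcos_ring_hom[OF ideal_chow_ideal[of N \<Sigma>]], of p q] assms
  unfolding chow_ring_def chow_class_def ray_ring_def by simp

lemma chow_graded_eq:
  "chow_graded N \<Sigma> k = chow_class N \<Sigma> ` {p \<in> mpolys (cones \<Sigma> 1). homogeneous k p}"
  unfolding chow_graded_def ray_ring_def by simp

lemma chow_graded_subset: "chow_graded N \<Sigma> k \<subseteq> carrier (chow_ring N \<Sigma>)"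
  unfolding chow_graded_eq carrier_chow_ring by auto

lemma chow_graded_add:
  "\<alpha> \<in> chow_graded N \<Sigma> k \<Longrightarrow> \<beta> \<in> chow_graded N \<Sigma> k \<Longrightarrow> \<alpha> \<oplus>\<^bsub>chow_ring N \<Sigma>\<^esub> \<beta> \<in> chow_graded N \<Sigma> k"
  unfolding chow_graded_eq by (auto simp: chow_class_add intro!: imageI mpolys_add homogeneous_add)

text \<open>Additivity of \<open>D\<close> is given only on one graded piece, so compatibility with
  integral multiples is derived while staying among homogeneous polynomials of degree
  \<open>k\<close>.\<close>

lemma additive_combination:
  assumes D: "additive_on (chow_ring N \<Sigma>) (chow_graded N \<Sigma> k) D"
    and p: "\<And>i. i \<in> A \<Longrightarrow> p i \<in> mpolys (cones \<Sigma> 1) \<and> homogeneous k (p i)"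
  shows "D (chow_class N \<Sigma> (\<Sum>i\<in>A. of_int (c i) * p i)) = (\<Sum>i\<in>A. c i * D (chow_class N \<Sigma> (p i)))"
proof -
  let ?H = "{p \<in> mpolys (cones \<Sigma> 1). homogeneous k p}"
  define E where "E p = D (chow_class N \<Sigma> p)" for p
  have add: "E (p + q) = E p + E q" if "p \<in> ?H" "q \<in> ?H" for p q
    using D that unfolding additive_on_def E_def chow_graded_eq
    by (simp add: chow_class_add[symmetric])
  have closed: "p + q \<in> ?H" if "p \<in> ?H" "q \<in> ?H" for p q using that by (auto intro: mpolys_add homogeneous_add)
  have int_closed: "of_int a * p \<in> ?H" if "p \<in> ?H" for a p
    using that by (auto intro: mpolys_mult homogeneous_const_mult)
  have zero_in: "0 \<in> ?H" by (simp add: homogeneous_zero)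
  have E0: "E 0 = 0" using add[OF zero_in zero_in] by simp
  have int: "E (of_int a * p) = a * E p" if p: "p \<in> ?H" for a p
  proof -
    have nat: "E (of_int (int n) * p) = int n * E p" for n
    proof (induction n)
      case (Suc n)
      have "E (of_int (int (Suc n)) * p) = E (p + of_int (int n) * p)" by (simp add: algebra_simps)
      also have "\<dots> = E p + E (of_int (int n) * p)" by (rule add[OF p int_closed[OF p]])
      finally show ?case using Suc by (simp add: algebra_simps)
    qed (simp add: E0)
    show ?thesis
    proof (cases a rule: int_cases2)
      case (nonneg n)
      then show ?thesis using nat by simp
    next
      case (nonpos n)
      have "E (of_int (- int n) * p + of_int (int n) * p) = E (of_int (- int n) * p) + E (of_int (int n) * p)"
        by (rule add[OF int_closed[OF p] int_closed[OF p]])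
      then have "0 = E (of_int (- int n) * p) + int n * E p" using nat E0 by simp
      then show ?thesis using nonpos by simp
    qed
  qed
  have "(\<Sum>i\<in>B. of_int (c i) * p i) \<in> ?H \<and> E (\<Sum>i\<in>B. of_int (c i) * p i) = (\<Sum>i\<in>B. c i * E (p i))"
    if "B \<subseteq> A" for B
    using that
  proof (induction B rule: infinite_finite_induct)
    case (insert i B)
    then have pi: "p i \<in> ?H" using p by auto
    have IH: "(\<Sum>i\<in>B. of_int (c i) * p i) \<in> ?H" "E (\<Sum>i\<in>B. of_int (c i) * p i) = (\<Sum>i\<in>B. c i * E (p i))"
      using insert by auto
    show ?case using insert(1,2) closed[OF int_closed[OF pi] IH(1)]
        add[OF int_closed[OF pi, of "c i"] IH(1)] int[OF pi] IH(2) by simp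
  qed (use zero_in E0 in auto)
  then show ?thesis unfolding E_def by blast
qed

text \<open>A functional is pulled back along \<open>\<phi>\<close>, represented on the primed side,
  and the representing element is pushed forward. With the isomorphism and with its inverse in the
  place of \<open>\<phi>\<close>, this gives both directions of the equivalence.\<close>

lemma perfect_pairing_transfer:
  assumes pp: "perfect_pairing R' A' B' p'"
    and bij: "bij_betw \<phi> A' A" "bij_betw \<phi> B' B"
    and clA: "\<And>x y. x \<in> A' \<Longrightarrow> y \<in> A' \<Longrightarrow> x \<oplus>\<^bsub>R'\<^esub> y \<in> A' \<and> \<phi> (x \<oplus>\<^bsub>R'\<^esub> y) = \<phi> x \<oplus>\<^bsub>R\<^esub> \<phi> y"
    and clB: "\<And>x y. x \<in> B' \<Longrightarrow> y \<in> B' \<Longrightarrow> x \<oplus>\<^bsub>R'\<^esub> y \<in> B' \<and> \<phi> (x \<oplus>\<^bsub>R'\<^esub> y) = \<phi> x \<oplus>\<^bsub>R\<^esub> \<phi> y"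
    and pair: "\<And>a b. a \<in> A' \<Longrightarrow> b \<in> B' \<Longrightarrow> p (\<phi> a) (\<phi> b) = p' a b"
  shows "perfect_pairing R A B p"
proof -
  have A: "A = \<phi> ` A'" "inj_on \<phi> A'" and B: "B = \<phi> ` B'" "inj_on \<phi> B'"
    using bij unfolding bij_betw_def by auto
  have lin: "\<forall>a\<in>A'. additive_on R' B' (p' a)" "\<forall>b\<in>B'. additive_on R' A' (\<lambda>a. p' a b)"
    and ex: "\<And>h. additive_on R' B' h \<Longrightarrow> \<exists>!a. a \<in> A' \<and> (\<forall>b\<in>B'. p' a b = h b)"
      "\<And>h. additive_on R' A' h \<Longrightarrow> \<exists>!b. b \<in> B' \<and> (\<forall>a\<in>A'. p' a b = h a)"
    using pp unfolding perfect_pairing_def by auto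
  have adB: "additive_on R' B' (\<lambda>b. h (\<phi> b))" if "additive_on R B h" for h
    using that clB unfolding additive_on_def B(1) by auto
  have adA: "additive_on R' A' (\<lambda>a. h (\<phi> a))" if "additive_on R A h" for h
    using that clA unfolding additive_on_def A(1) by auto
  show ?thesis
    unfolding perfect_pairing_def
  proof (intro conjI ballI allI impI)
    fix a assume "a \<in> A"
    then show "additive_on R B (p a)"
      using lin(1) clB pair unfolding additive_on_def A(1) B(1) by (auto, metis)
  next
    fix b assume "b \<in> B"
    then show "additive_on R A (\<lambda>a. p a b)"
      using lin(2) clA pair unfolding additive_on_def A(1) B(1) by (auto, metis)
  next
    fix h assume h: "additive_on R B h"
    obtain a where a: "a \<in> A'" "\<forall>b\<in>B'. p' a b = h (\<phi> b)"
      and u: "\<And>a2. a2 \<in> A' \<Longrightarrow> \<forall>b\<in>B'. p' a2 b = h (\<phi> b) \<Longrightarrow> a2 = a"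
      using ex(1)[OF adB[OF h]] by blast
    show "\<exists>!a. a \<in> A \<and> (\<forall>b\<in>B. p a b = h b)"
    proof (rule ex1I[of _ "\<phi> a"])
      show "\<phi> a \<in> A \<and> (\<forall>b\<in>B. p (\<phi> a) b = h b)" using a pair unfolding A(1) B(1) by auto
      fix x assume "x \<in> A \<and> (\<forall>b\<in>B. p x b = h b)"
      then obtain a2 where "a2 \<in> A'" "x = \<phi> a2" "\<forall>b\<in>B'. p (\<phi> a2) (\<phi> b) = h (\<phi> b)"
        unfolding A(1) B(1) by auto
      then show "x = \<phi> a" using u[of a2] pair by auto
    qed
  next
    fix h assume h: "additive_on R A h"
    obtain b where b: "b \<in> B'" "\<forall>a\<in>A'. p' a b = h (\<phi> a)"
      and u: "\<And>b2. b2 \<in> B' \<Longrightarrow> \<forall>a\<in>A'. p' a b2 = h (\<phi> a) \<Longrightarrow> b2 = b"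
      using ex(2)[OF adA[OF h]] by blast
    show "\<exists>!b. b \<in> B \<and> (\<forall>a\<in>A. p a b = h a)"
    proof (rule ex1I[of _ "\<phi> b"])
      show "\<phi> b \<in> B \<and> (\<forall>a\<in>A. p a (\<phi> b) = h a)" using b pair unfolding A(1) B(1) by auto
      fix x assume "x \<in> B \<and> (\<forall>a\<in>A. p a x = h a)"
      then obtain b2 where "b2 \<in> B'" "x = \<phi> b2" "\<forall>a\<in>A'. p (\<phi> a) (\<phi> b2) = h (\<phi> a)"
        unfolding A(1) B(1) by auto
      then show "x = \<phi> b" using u[of b2] pair by auto
    qed
  qed
qed

section \<open>Faces and cone monomials of the modification\<close>

context modification
begin

text \<open>On \<open>\<sigma>\<close> the function is linear, so a shear identifies the lifted and
  raised cones with products of \<open>\<sigma>\<close> with a point or a half-line, and faces of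
  products are products of faces.\<close>

lemma lift_faces:
  assumes \<sigma>: "\<sigma> \<in> \<Sigma>" and \<rho>: "\<rho> \<in> \<Sigma>" "\<rho> \<subseteq> \<sigma>"
  shows "cone_face (lift \<rho>) (lift \<sigma>)" "cone_face (lift \<rho>) (raised \<sigma>)" "cone_face vray (raised \<sigma>)"
proof -
  define l where "l = cone_form f \<sigma>"
  have l: "linear l" "\<And>x. x \<in> \<sigma> \<Longrightarrow> f x = l x"
    using linear_cone_form[OF \<sigma>] cone_form_in[OF \<sigma>] unfolding l_def by auto
  \<comment> \<open>The shear along the form of \<open>f\<close> on \<open>\<sigma>\<close>; the
    factor \<open>{0..}\<close> becomes the vertical direction.\<close>
  define T where "T = (\<lambda>(x, t). (x, l x + t :: real))"
  have T: "linear T" unfolding T_def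
    by (rule linearI) (auto simp: linear_add[OF l(1)] linear_cmul[OF l(1)] algebra_simps)
  have injT: "inj T" unfolding T_def by (auto intro: injI)
  have liftT: "lift \<tau> = T ` (\<tau> \<times> {0})" if "\<tau> \<subseteq> \<sigma>" for \<tau>
    unfolding lift_def T_def using that l(2) by force
  have raisedT: "raised \<sigma> = T ` (\<sigma> \<times> {0..})" unfolding raised_def T_def using l(2) by force
  have vrayT: "vray = T ` ({0} \<times> {0..})" unfolding vray_eq T_def using linear_0[OF l(1)] by force
  have half: "convex_cone {0::real..}" "strongly_convex {0::real..}"
    unfolding convex_cone_iff strongly_convex_def by auto
  have f0: "{0} face_of {0::real..}" by (rule zero_face_of_strongly_convex[OF half])
  have fr: "{0::real..} face_of {0..}" "{0::real} face_of {0}" by (auto intro!: face_of_refl)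
  have f\<rho>: "\<rho> face_of \<sigma>" using cone_face_iff[OF \<sigma> \<rho>(1)] \<rho>(2) unfolding cone_face_def by simp
  have f\<sigma>: "{0} face_of \<sigma>" by (rule zero_face_of_strongly_convex[OF convex_cone_fan[OF \<sigma>] strongly_convex_fan[OF \<sigma>]])
  have ne: "0 \<in> \<rho>" by (rule cone_zero[OF \<rho>(1)])
  show "cone_face (lift \<rho>) (lift \<sigma>)"
    unfolding cone_face_def liftT[OF \<rho>(2)] liftT[OF subset_refl] face_of_linear_image[OF T injT]
    using face_of_Times[OF f\<rho> fr(2)] ne by auto
  show "cone_face (lift \<rho>) (raised \<sigma>)"
    unfolding cone_face_def liftT[OF \<rho>(2)] raisedT face_of_linear_image[OF T injT]
    using face_of_Times[OF f\<rho> f0] ne by auto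
  show "cone_face vray (raised \<sigma>)"
    unfolding cone_face_def vrayT raisedT face_of_linear_image[OF T injT]
    using face_of_Times[OF f\<sigma> fr(1)] by auto
qed

lemma cone_monomial_lift:
  assumes \<sigma>: "\<sigma> \<in> \<Sigma>"
  shows "cone_monomial \<Sigma>' (lift \<sigma>) = (\<Prod>\<rho>\<in>rays \<sigma>. mvar (lift \<rho>))"
proof -
  have "{w\<in>cones \<Sigma>' 1. cone_face w (lift \<sigma>)} = lift ` rays \<sigma>"
  proof (intro subset_antisym subsetI)
    fix w assume w: "w \<in> {w\<in>cones \<Sigma>' 1. cone_face w (lift \<sigma>)}"
    then have sub: "w \<subseteq> lift \<sigma>" unfolding cone_face_def using face_of_imp_subset by auto
    have "w \<noteq> vray" using sub up_in_raised[OF zero_cone] up_notin_lift unfolding vray_def by auto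
    then obtain \<rho> where \<rho>: "\<rho> \<in> cones \<Sigma> 1" "w = lift \<rho>" using w unfolding rays_\<Sigma>' by (auto split: if_splits)
    have "fst ` lift \<rho> \<subseteq> fst ` lift \<sigma>" using sub \<rho>(2) by blast
    then show "w \<in> lift ` rays \<sigma>" using \<rho> unfolding rays_def by simp
  next
    fix w assume "w \<in> lift ` rays \<sigma>"
    then obtain \<rho> where \<rho>: "\<rho> \<in> cones \<Sigma> 1" "\<rho> \<subseteq> \<sigma>" "w = lift \<rho>" unfolding rays_def by auto
    then have "cone_face w (lift \<sigma>)" using lift_faces(1)[OF \<sigma>] unfolding cones_def by simp
    then show "w \<in> {w\<in>cones \<Sigma>' 1. cone_face w (lift \<sigma>)}" using \<rho> unfolding rays_\<Sigma>' by simp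
  qed
  then show ?thesis unfolding cone_monomial_def by (simp add: prod_lift)
qed

lemma cone_monomial_raised:
  assumes \<delta>: "\<delta> \<in> \<Delta>"
  shows "cone_monomial \<Sigma>' (raised \<delta>) = mvar vray * (\<Prod>\<rho>\<in>rays \<delta>. mvar (lift \<rho>))"
proof -
  have \<delta>\<Sigma>: "\<delta> \<in> \<Sigma>" using \<delta> \<Delta>_subset by auto
  have "{w\<in>cones \<Sigma>' 1. cone_face w (raised \<delta>)} = insert vray (lift ` rays \<delta>)"
  proof (intro subset_antisym subsetI)
    fix w assume w: "w \<in> {w\<in>cones \<Sigma>' 1. cone_face w (raised \<delta>)}"
    then have sub: "w \<subseteq> raised \<delta>" unfolding cone_face_def using face_of_imp_subset by auto
    show "w \<in> insert vray (lift ` rays \<delta>)"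
    proof (cases "w = vray")
      case False
      then obtain \<rho> where \<rho>: "\<rho> \<in> cones \<Sigma> 1" "w = lift \<rho>" using w unfolding rays_\<Sigma>' by (auto split: if_splits)
      have "fst ` lift \<rho> \<subseteq> fst ` raised \<delta>" using sub \<rho>(2) by blast
      then show ?thesis using \<rho> unfolding rays_def by simp
    qed simp
  next
    fix w assume "w \<in> insert vray (lift ` rays \<delta>)"
    then consider "w = vray" | \<rho> where "\<rho> \<in> cones \<Sigma> 1" "\<rho> \<subseteq> \<delta>" "w = lift \<rho>" unfolding rays_def by auto
    then show "w \<in> {w\<in>cones \<Sigma>' 1. cone_face w (raised \<delta>)}"
    proof cases
      case 1
      then show ?thesis
        using lift_faces(3)[OF \<delta>\<Sigma> \<delta>\<Sigma> subset_refl] \<delta> unfolding rays_\<Sigma>' by auto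
    next
      case 2
      then show ?thesis using lift_faces(2)[OF \<delta>\<Sigma>] unfolding rays_\<Sigma>' by (simp add: cones_def)
    qed
  qed
  moreover have "vray \<notin> lift ` rays \<delta>" by auto
  moreover have "finite (rays \<delta>)" using finite_rays unfolding rays_def by simp
  ultimately show ?thesis unfolding cone_monomial_def by (simp add: prod_lift)
qed

text \<open>Both substitutions replace variables by forms of degree 1 and so preserve homogeneity;
  \<open>up\<close> supplies the homogeneous preimages.\<close>

lemma graded_image:
  assumes \<phi>: "\<And>p. p \<in> mpolys (cones \<Sigma>' 1) \<Longrightarrow> \<phi> (chow_class N' \<Sigma>' p) = chow_class N \<Sigma> (mpoly_subst down p)"
  shows "\<phi> ` chow_graded N' \<Sigma>' k = chow_graded N \<Sigma> k"
proof (intro subset_antisym subsetI)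
  fix \<alpha> assume "\<alpha> \<in> \<phi> ` chow_graded N' \<Sigma>' k"
  then obtain p where "p \<in> mpolys (cones \<Sigma>' 1)" "homogeneous k p" "\<alpha> = \<phi> (chow_class N' \<Sigma>' p)"
    unfolding chow_graded_eq by auto
  then show "\<alpha> \<in> chow_graded N \<Sigma> k"
    using \<phi> mpoly_subst_closed[of _ down, OF down_closed] homogeneous_subst[of down, OF homogeneous_down]
    unfolding chow_graded_eq by auto
next
  fix \<alpha> assume "\<alpha> \<in> chow_graded N \<Sigma> k"
  then obtain q where q: "q \<in> mpolys (cones \<Sigma> 1)" "homogeneous k q" "\<alpha> = chow_class N \<Sigma> q"
    unfolding chow_graded_eq by auto
  have up: "mpoly_subst up q \<in> mpolys (cones \<Sigma>' 1)" by (rule mpoly_subst_closed[OF up_closed q(1)])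
  moreover have "homogeneous k (mpoly_subst up q)" by (rule homogeneous_subst[OF homogeneous_up q(2)])
  moreover have "\<alpha> = \<phi> (chow_class N' \<Sigma>' (mpoly_subst up q))" using \<phi>[OF up] down_up[OF q(1)] q(3) by simp
  ultimately show "\<alpha> \<in> \<phi> ` chow_graded N' \<Sigma>' k" unfolding chow_graded_eq by blast
qed

end

section \<open>Transport of degrees, pairings and Poincare duality\<close>

context unimodular_modification
begin

lemma card_rays: "\<sigma> \<in> \<Sigma> \<Longrightarrow> card (rays \<sigma>) = dim \<sigma>"
proof -
  assume \<sigma>: "\<sigma> \<in> \<Sigma>"
  obtain B C where B: "B \<subseteq> C" "lattice_basis N C" "\<sigma> = convex_cone hull B" "independent B" "finite B"
    by (rule basis[OF \<sigma>])
  have "card (rays \<sigma>) = card B"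
    unfolding rays_independent[OF \<sigma> B(3,4)] by (rule card_image[OF inj_ray_hull[OF B(4)]])
  then show ?thesis
    unfolding B(3) dim_convex_cone_hull using dim_eq_card_independent[OF B(4)] by simp
qed

lemma finite_ray_set: "finite (rays \<sigma>)"
  using finite_rays unfolding rays_def by simp

lemma cone_monomial_closed:
  assumes "\<sigma> \<in> cones \<Sigma> d"
  shows "cone_monomial \<Sigma> \<sigma> \<in> mpolys (cones \<Sigma> 1)" "homogeneous d (cone_monomial \<Sigma> \<sigma>)"
proof -
  have \<sigma>: "\<sigma> \<in> \<Sigma>" "dim \<sigma> = d" using assms unfolding cones_def by auto
  show "cone_monomial \<Sigma> \<sigma> \<in> mpolys (cones \<Sigma> 1)"
    unfolding cone_monomial_eq[OF \<sigma>(1)] by (intro mpolys_prod mpolys_mvar) (auto simp: rays_def)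
  show "homogeneous d (cone_monomial \<Sigma> \<sigma>)"
    unfolding cone_monomial_eq[OF \<sigma>(1)]
    using homogeneous_prod[OF homogeneous_mvar finite_ray_set, of \<sigma> id] card_rays[OF \<sigma>(1)] \<sigma>(2) by simp
qed

lemma down_cone_monomial_raised:
  assumes \<delta>: "\<delta> \<in> \<Delta>"
  shows "mpoly_subst down (cone_monomial \<Sigma>' (raised \<delta>)) = - (F * (\<Prod>\<rho>\<in>rays \<delta>. mvar \<rho>))"
  unfolding cone_monomial_raised[OF \<delta>] by (simp add: mpoly_subst_mult mpoly_subst_prod)

lemma down_cone_monomial_lift:
  assumes "\<sigma> \<in> \<Sigma>"
  shows "mpoly_subst down (cone_monomial \<Sigma>' (lift \<sigma>)) = cone_monomial \<Sigma> \<sigma>"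
  unfolding cone_monomial_lift[OF assms] cone_monomial_eq[OF assms] by (simp add: mpoly_subst_prod)

lemma cone_monomial_\<Sigma>'_closed: "cone_monomial \<Sigma>' w \<in> mpolys (cones \<Sigma>' 1)"
  unfolding cone_monomial_def by (intro mpolys_prod mpolys_mvar) simp

text \<open>Maximal cones of \<open>\<Sigma>'\<close> are of two kinds. For a lifted cone the
  monomial goes to the monomial of the cone below; for a raised cone the image is the combination of
  \<open>vertical_ray_degree\<close>, whose coefficients sum to 1.\<close>

lemma degree_of_down:
  assumes D: "is_degree_map N \<Sigma> d D" and w: "w \<in> cones \<Sigma>' d"
  shows "D (chow_class N \<Sigma> (mpoly_subst down (cone_monomial \<Sigma>' w))) = 1"
proof -
  have Dm: "\<And>\<sigma>. \<sigma> \<in> cones \<Sigma> d \<Longrightarrow> D (chow_class N \<Sigma> (cone_monomial \<Sigma> \<sigma>)) = 1"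
    and Da: "additive_on (chow_ring N \<Sigma>) (chow_graded N \<Sigma> d) D"
    using D unfolding is_degree_map_def by auto
  consider \<sigma> where "\<sigma> \<in> cones \<Sigma> d" "w = lift \<sigma>" | \<delta> where "\<delta> \<in> \<Delta>" "dim \<delta> + 1 = d" "w = raised \<delta>"
    using w unfolding cones_\<Sigma>' by auto
  then show ?thesis
  proof cases
    case 1
    then show ?thesis using down_cone_monomial_lift Dm unfolding cones_def by auto
  next
    case 2
    let ?A = "{\<sigma>\<in>cones \<Sigma> d. \<delta> \<subseteq> \<sigma>}"
    obtain c :: "'a set \<Rightarrow> int" where c: "(\<Sum>\<sigma>\<in>?A. c \<sigma>) = 1"
      "- (F * (\<Prod>\<rho>\<in>rays \<delta>. mvar \<rho>)) - (\<Sum>\<sigma>\<in>?A. of_int (c \<sigma>) * cone_monomial \<Sigma> \<sigma>) \<in> I"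
      using vertical_ray_degree[OF 2(1,2)] by blast
    have "chow_class N \<Sigma> (mpoly_subst down (cone_monomial \<Sigma>' w))
        = chow_class N \<Sigma> (\<Sum>\<sigma>\<in>?A. of_int (c \<sigma>) * cone_monomial \<Sigma> \<sigma>)"
    proof (subst chow_class_eq_iff)
      show "mpoly_subst down (cone_monomial \<Sigma>' w) \<in> mpolys (cones \<Sigma> 1)"
        by (rule mpoly_subst_closed[OF down_closed cone_monomial_\<Sigma>'_closed])
      show "(\<Sum>\<sigma>\<in>?A. of_int (c \<sigma>) * cone_monomial \<Sigma> \<sigma>) \<in> mpolys (cones \<Sigma> 1)"
        by (intro mpolys_sum mpolys_mult mpolys_of_int cone_monomial_closed(1)) simp
      show "mpoly_subst down (cone_monomial \<Sigma>' w) - (\<Sum>\<sigma>\<in>?A. of_int (c \<sigma>) * cone_monomial \<Sigma> \<sigma>) \<in> I"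
        unfolding 2(3) down_cone_monomial_raised[OF 2(1)] by (rule c(2))
    qed
    moreover have "D (chow_class N \<Sigma> (\<Sum>\<sigma>\<in>?A. of_int (c \<sigma>) * cone_monomial \<Sigma> \<sigma>))
        = (\<Sum>\<sigma>\<in>?A. c \<sigma> * D (chow_class N \<Sigma> (cone_monomial \<Sigma> \<sigma>)))"
      by (rule additive_combination[OF Da]) (use cone_monomial_closed in auto)
    moreover have "\<dots> = (\<Sum>\<sigma>\<in>?A. c \<sigma>)" using Dm by (intro sum.cong) auto
    ultimately show ?thesis using c(1) by simp
  qed
qed

text \<open>Composition with \<open>\<phi>\<close> and with its inverse carries degree maps to
  degree maps, so both definite descriptions in \<open>chow_deg\<close> have the same possible
  values and agree.\<close>

lemma chow_deg_transport:
  assumes iso: "\<phi> \<in> ring_iso (chow_ring N' \<Sigma>') (chow_ring N \<Sigma>)"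
    and \<phi>: "\<And>p. p \<in> mpolys (cones \<Sigma>' 1) \<Longrightarrow> \<phi> (chow_class N' \<Sigma>' p) = chow_class N \<Sigma> (mpoly_subst down p)"
    and \<alpha>: "\<alpha> \<in> carrier (chow_ring N' \<Sigma>')"
  shows "chow_deg N \<Sigma> d (\<phi> \<alpha>) = chow_deg N' \<Sigma>' d \<alpha>"
proof -
  let ?R' = "chow_ring N' \<Sigma>'" and ?R = "chow_ring N \<Sigma>"
  have inj: "inj_on \<phi> (carrier ?R')" using iso unfolding ring_iso_def bij_betw_def by auto
  have add: "\<phi> (x \<oplus>\<^bsub>?R'\<^esub> y) = \<phi> x \<oplus>\<^bsub>?R\<^esub> \<phi> y" if "x \<in> carrier ?R'" "y \<in> carrier ?R'" for x y
    using iso that unfolding ring_iso_def by (auto simp: ring_hom_add)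
  note sub' = subsetD[OF chow_graded_subset[of N' \<Sigma>' d]]
  have gr: "\<phi> ` chow_graded N' \<Sigma>' d = chow_graded N \<Sigma> d" by (rule graded_image[OF \<phi>])
  have "is_degree_map N' \<Sigma>' d (\<lambda>x. D (\<phi> x))" if D: "is_degree_map N \<Sigma> d D" for D
    unfolding is_degree_map_def
  proof (intro conjI ballI)
    show "additive_on ?R' (chow_graded N' \<Sigma>' d) (\<lambda>x. D (\<phi> x))"
      unfolding additive_on_def
    proof (intro ballI)
      fix x y assume xy: "x \<in> chow_graded N' \<Sigma>' d" "y \<in> chow_graded N' \<Sigma>' d"
      then have "\<phi> x \<in> chow_graded N \<Sigma> d" "\<phi> y \<in> chow_graded N \<Sigma> d" using gr by blast+
      then show "D (\<phi> (x \<oplus>\<^bsub>?R'\<^esub> y)) = D (\<phi> x) + D (\<phi> y)"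
        using D add sub' xy unfolding is_degree_map_def additive_on_def by simp
    qed
    show "D (\<phi> (chow_class N' \<Sigma>' (cone_monomial \<Sigma>' w))) = 1" if "w \<in> cones \<Sigma>' d" for w
      using \<phi>[OF cone_monomial_\<Sigma>'_closed] degree_of_down[OF D that] by simp
  qed
  \<comment> \<open>In this direction the lifted cones suffice, since the monomial of each maximal
    cone of \<open>\<Sigma>\<close> comes from the monomial of its lift.\<close>
  moreover have "is_degree_map N \<Sigma> d (\<lambda>y. D (inv_into (carrier ?R') \<phi> y))"
    if D: "is_degree_map N' \<Sigma>' d D" for D
    unfolding is_degree_map_def
  proof (intro conjI ballI)
    have inv: "inv_into (carrier ?R') \<phi> (\<phi> x) = x" if "x \<in> carrier ?R'" for x
      using inj that by (rule inv_into_f_f)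
    show "additive_on ?R (chow_graded N \<Sigma> d) (\<lambda>y. D (inv_into (carrier ?R') \<phi> y))"
      unfolding additive_on_def
    proof (intro ballI)
      fix u v assume "u \<in> chow_graded N \<Sigma> d" "v \<in> chow_graded N \<Sigma> d"
      then obtain x y where xy: "x \<in> chow_graded N' \<Sigma>' d" "y \<in> chow_graded N' \<Sigma>' d" "u = \<phi> x" "v = \<phi> y"
        unfolding gr[symmetric] by blast
      then have c: "x \<in> carrier ?R'" "y \<in> carrier ?R'" "x \<oplus>\<^bsub>?R'\<^esub> y \<in> carrier ?R'"
        using sub' chow_graded_add[OF xy(1,2)] by auto
      show "D (inv_into (carrier ?R') \<phi> (u \<oplus>\<^bsub>?R\<^esub> v))
          = D (inv_into (carrier ?R') \<phi> u) + D (inv_into (carrier ?R') \<phi> v)"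
        unfolding xy(3,4) add[OF c(1,2), symmetric] inv[OF c(1)] inv[OF c(2)] inv[OF c(3)]
        using D xy(1,2) unfolding is_degree_map_def additive_on_def by blast
    qed
    fix \<sigma> assume \<sigma>: "\<sigma> \<in> cones \<Sigma> d"
    have "chow_class N \<Sigma> (cone_monomial \<Sigma> \<sigma>) = \<phi> (chow_class N' \<Sigma>' (cone_monomial \<Sigma>' (lift \<sigma>)))"
      using \<phi>[OF cone_monomial_\<Sigma>'_closed] down_cone_monomial_lift \<sigma> unfolding cones_def by simp
    moreover have "chow_class N' \<Sigma>' (cone_monomial \<Sigma>' (lift \<sigma>)) \<in> carrier ?R'"
      unfolding carrier_chow_ring using cone_monomial_\<Sigma>'_closed by blast
    moreover have "lift \<sigma> \<in> cones \<Sigma>' d" using \<sigma> unfolding cones_\<Sigma>' by blast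
    ultimately show "D (inv_into (carrier ?R') \<phi> (chow_class N \<Sigma> (cone_monomial \<Sigma> \<sigma>))) = 1"
      using inv D unfolding is_degree_map_def by simp
  qed
  moreover have "inv_into (carrier ?R') \<phi> (\<phi> \<alpha>) = \<alpha>" using inj \<alpha> by (rule inv_into_f_f)
  ultimately have "(\<exists>D. is_degree_map N \<Sigma> d D \<and> D (\<phi> \<alpha>) = n) \<longleftrightarrow> (\<exists>D. is_degree_map N' \<Sigma>' d D \<and> D \<alpha> = n)" for n
    by metis
  then show ?thesis unfolding chow_deg_def by simp
qed

text \<open>Take an integral form \<open>l\<close> on \<open>N\<close> that agrees with
  \<open>f\<close> on \<open>\<sigma>\<close>. Its graph map sends a basis of \<open>N\<close> to
  vectors that, together with \<open>(0, 1)\<close>, form a basis of \<open>N'\<close>, and on the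
  generators of \<open>\<sigma>\<close> it is the lift.\<close>

lemma unimodular_\<Sigma>': "unimodular_fan N' \<Sigma>'"
  unfolding unimodular_fan_def
proof
  have base: "\<exists>X Y. X \<subseteq> Y \<and> lattice_basis N' (insert (0, 1) Y) \<and> lift \<sigma> = convex_cone hull X \<and>
      raised \<sigma> = convex_cone hull (insert (0, 1) X)" if \<sigma>: "\<sigma> \<in> \<Sigma>" for \<sigma>
  proof -
    obtain B C where B: "B \<subseteq> C" "lattice_basis N C" "\<sigma> = convex_cone hull B" "independent B" "finite B"
      by (rule basis[OF \<sigma>])
    obtain l where l: "integral_form N l" "\<And>x. x \<in> \<sigma> \<Longrightarrow> l x = f x" using integral_form_on_cone[OF \<sigma>] by blast
    have ll: "linear l" and lN: "\<And>x. x \<in> N \<Longrightarrow> l x \<in> \<int>" using l(1) unfolding integral_form_def by auto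
    define G where "G x = (x, l x)" for x
    have G: "linear G" unfolding G_def by (rule linear_graph[OF ll])
    have injG: "inj_on G A" for A unfolding G_def by (auto intro: inj_onI)
    have iC: "independent C" and NC: "N = range (\<lambda>c::'a \<Rightarrow> int. \<Sum>b\<in>C. of_int (c b) *\<^sub>R b)"
      using B(2) unfolding lattice_basis_def by auto
    have fC: "finite C" using iC by (rule independent_imp_finite)
    have sp: "(0, 1) \<notin> span (G ` C)"
      unfolding linear_span_image[OF G] G_def using linear_0[OF ll] by auto
    then have n: "(0, 1) \<notin> G ` C" using span_superset[of "G ` C"] by blast
    have "independent (G ` C)" by (rule linear_independent_injective_image[OF G iC injG])
    then have ind: "independent (insert (0, 1) (G ` C))" using sp n by (simp add: independent_insert)
    have sum: "(\<Sum>y\<in>insert (0, 1) (G ` C). of_int (c y) *\<^sub>R y)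
        = (\<Sum>b\<in>C. of_int (c (G b)) *\<^sub>R b, of_int (c (0, 1)) + l (\<Sum>b\<in>C. of_int (c (G b)) *\<^sub>R b))"
      for c :: "'a \<times> real \<Rightarrow> int"
    proof -
      have "(\<Sum>y\<in>G ` C. of_int (c y) *\<^sub>R y) = (\<Sum>b\<in>C. of_int (c (G b)) *\<^sub>R G b)"
        by (rule sum.reindex_cong[OF injG refl refl])
      also have "\<dots> = G (\<Sum>b\<in>C. of_int (c (G b)) *\<^sub>R b)"
        by (simp add: linear_sum[OF G] linear_cmul[OF G])
      finally show ?thesis using n fC by (simp add: G_def)
    qed
    have "N' = range (\<lambda>c::'a \<times> real \<Rightarrow> int. \<Sum>y\<in>insert (0, 1) (G ` C). of_int (c y) *\<^sub>R y)"
    proof (intro subset_antisym subsetI)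
      fix y assume "y \<in> N'"
      then obtain x t where y: "y = (x, t)" "x \<in> N" "t \<in> \<int>" unfolding N'_def by auto
      obtain c :: "'a \<Rightarrow> int" where c: "x = (\<Sum>b\<in>C. of_int (c b) *\<^sub>R b)" using y(2) unfolding NC by blast
      have "t - l x \<in> \<int>" using y(3) lN[OF y(2)] by simp
      then obtain k where k: "t - l x = of_int k" by (rule Ints_cases)
      \<comment> \<open>The vertical coefficient is the height of the point over the graph of
        \<open>l\<close>, an integer because \<open>l\<close> is integral on \<open>N\<close>; the
        others are the coordinates of the projection.\<close>
      define e where "e z = (if z = (0, 1) then k else c (fst z))" for z :: "'a \<times> real"
      have "e (G b) = c b" if "b \<in> C" for b
      proof -
        have "G b \<noteq> (0, 1)" using n imageI[OF that, of G] by metis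
        then have "e (G b) = c (fst (G b))" unfolding e_def by (rule if_not_P)
        then show ?thesis by (simp add: G_def)
      qed
      then have "(\<Sum>b\<in>C. of_int (e (G b)) *\<^sub>R b) = x" unfolding c by (intro sum.cong) auto
      then have "y = (\<Sum>y\<in>insert (0, 1) (G ` C). of_int (e y) *\<^sub>R y)"
        unfolding sum y(1) using k by (simp add: e_def)
      then show "y \<in> range (\<lambda>c::'a \<times> real \<Rightarrow> int. \<Sum>y\<in>insert (0, 1) (G ` C). of_int (c y) *\<^sub>R y)"
        by (rule range_eqI[where x=e])
    next
      fix y assume "y \<in> range (\<lambda>c::'a \<times> real \<Rightarrow> int. \<Sum>y\<in>insert (0, 1) (G ` C). of_int (c y) *\<^sub>R y)"
      then obtain c :: "'a \<times> real \<Rightarrow> int" where c: "y = (\<Sum>y\<in>insert (0, 1) (G ` C). of_int (c y) *\<^sub>R y)" by blast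
      have x: "(\<Sum>b\<in>C. of_int (c (G b)) *\<^sub>R b) \<in> N" unfolding NC by (rule range_eqI[where x="\<lambda>b. c (G b)"]) (rule refl)
      show "y \<in> N'" unfolding c sum N'_def using x lN[OF x] by simp
    qed
    then have lb: "lattice_basis N' (insert (0, 1) (G ` C))" using ind unfolding lattice_basis_def by simp
    have B\<sigma>: "B \<subseteq> \<sigma>" unfolding B(3) by (rule hull_subset)
    have lB: "lift B = G ` B" unfolding G_def by (rule lift_image[OF ll]) (use l(2) B\<sigma> in auto)
    have H\<Sigma>: "convex_cone hull B \<in> \<Sigma>" using \<sigma> B(3) by simp
    have "convex_cone hull {(0, 1)} = vray" unfolding ray_hull vray_eq by force
    then have "convex_cone hull {(0, 1)} = vray" "convex_cone hull vray = vray" by (simp, metis hull_hull)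
    then have "convex_cone hull (insert (0, 1) (G ` B)) = convex_cone hull (vray \<union> G ` B)"
      using convex_cone_hull_Un[of "{(0, 1)}" "G ` B"] convex_cone_hull_Un[of vray "G ` B"] by simp
    then show ?thesis
      using lift_hull[OF H\<Sigma>] raised_hull[OF H\<Sigma>] lb image_mono[OF B(1), of G] unfolding lB B(3)[symmetric]
      by (intro exI[of _ "G ` B"] exI[of _ "G ` C"]) simp
  qed
  fix w assume "w \<in> \<Sigma>'"
  then consider \<sigma> where "\<sigma> \<in> \<Sigma>" "w = lift \<sigma>" | \<sigma> where "\<sigma> \<in> \<Sigma>" "w = raised \<sigma>"
    using \<Delta>_subset unfolding \<Sigma>'_eq by auto
  then show "\<exists>X Y. X \<subseteq> Y \<and> lattice_basis N' Y \<and> w = convex_cone hull X"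
  proof cases
    case 1
    then show ?thesis using base[OF 1(1)] by (metis insert_subset subset_insertI subset_trans)
  next
    case 2
    then show ?thesis using base[OF 2(1)] by (metis insert_mono)
  qed
qed

text \<open>Pairings are degrees of products, and \<open>\<phi>\<close> respects both. Since it also
  matches the graded pieces, perfectness of each pairing passes in both directions.\<close>

lemma poincare_transport:
  assumes iso: "\<phi> \<in> ring_iso (chow_ring N' \<Sigma>') (chow_ring N \<Sigma>)"
    and \<phi>: "\<And>p. p \<in> mpolys (cones \<Sigma>' 1) \<Longrightarrow> \<phi> (chow_class N' \<Sigma>' p) = chow_class N \<Sigma> (mpoly_subst down p)"
  shows "\<alpha> \<in> carrier (chow_ring N' \<Sigma>') \<Longrightarrow> \<beta> \<in> carrier (chow_ring N' \<Sigma>') \<Longrightarrow>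
      chow_pairing N \<Sigma> d (\<phi> \<alpha>) (\<phi> \<beta>) = chow_pairing N' \<Sigma>' d \<alpha> \<beta>"
    and "poincare_duality N' \<Sigma>' d \<longleftrightarrow> poincare_duality N \<Sigma> d"
proof -
  let ?R' = "chow_ring N' \<Sigma>'" and ?R = "chow_ring N \<Sigma>"
  interpret R': ring ?R' by (rule ring_chow_ring)
  have hom: "\<phi> \<in> ring_hom ?R' ?R" and bij: "bij_betw \<phi> (carrier ?R') (carrier ?R)"
    using iso unfolding ring_iso_def by auto
  have pair: "chow_pairing N \<Sigma> d (\<phi> \<alpha>) (\<phi> \<beta>) = chow_pairing N' \<Sigma>' d \<alpha> \<beta>"
    if "\<alpha> \<in> carrier ?R'" "\<beta> \<in> carrier ?R'" for \<alpha> \<beta>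
    unfolding chow_pairing_def ring_hom_mult[OF hom that, symmetric]
    by (rule chow_deg_transport[OF iso \<phi>]) (use that in auto)
  then show "\<alpha> \<in> carrier ?R' \<Longrightarrow> \<beta> \<in> carrier ?R' \<Longrightarrow>
      chow_pairing N \<Sigma> d (\<phi> \<alpha>) (\<phi> \<beta>) = chow_pairing N' \<Sigma>' d \<alpha> \<beta>" by blast
  \<comment> \<open>Inverts \<open>\<phi>\<close> on the carrier only, which is enough because all
    graded pieces lie in the carrier.\<close>
  define \<psi> where "\<psi> = inv_into (carrier ?R') \<phi>"
  have \<psi>: "\<psi> (\<phi> x) = x" if "x \<in> carrier ?R'" for x
    unfolding \<psi>_def using bij that by (simp add: bij_betw_def inv_into_f_f)
  note sub' = subsetD[OF chow_graded_subset[of N' \<Sigma>']]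
  have gr: "chow_graded N \<Sigma> k = \<phi> ` chow_graded N' \<Sigma>' k" for k using graded_image[of \<phi>, OF \<phi>] by simp
  have bij\<phi>: "bij_betw \<phi> (chow_graded N' \<Sigma>' k) (chow_graded N \<Sigma> k)" for k
    unfolding gr using bij inj_on_subset[OF _ chow_graded_subset[of N' \<Sigma>' k], of \<phi>]
    by (simp add: bij_betw_def)
  have \<psi>gr: "\<psi> ` chow_graded N \<Sigma> k = chow_graded N' \<Sigma>' k" for k
    unfolding gr image_image using \<psi> sub' by force
  have bij\<psi>: "bij_betw \<psi> (chow_graded N \<Sigma> k) (chow_graded N' \<Sigma>' k)" for k
    unfolding bij_betw_def \<psi>gr
  proof
    show "inj_on \<psi> (chow_graded N \<Sigma> k)" unfolding gr by (rule inj_onI) (use \<psi> sub' in force)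
  qed simp
  have cl\<phi>: "x \<oplus>\<^bsub>?R'\<^esub> y \<in> chow_graded N' \<Sigma>' k \<and> \<phi> (x \<oplus>\<^bsub>?R'\<^esub> y) = \<phi> x \<oplus>\<^bsub>?R\<^esub> \<phi> y"
    if "x \<in> chow_graded N' \<Sigma>' k" "y \<in> chow_graded N' \<Sigma>' k" for x y k
    using chow_graded_add[OF that] ring_hom_add[OF hom sub'[OF that(1)] sub'[OF that(2)]] by simp
  have cl\<psi>: "u \<oplus>\<^bsub>?R\<^esub> v \<in> chow_graded N \<Sigma> k \<and> \<psi> (u \<oplus>\<^bsub>?R\<^esub> v) = \<psi> u \<oplus>\<^bsub>?R'\<^esub> \<psi> v"
    if uv: "u \<in> chow_graded N \<Sigma> k" "v \<in> chow_graded N \<Sigma> k" for u v k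
  proof
    show "u \<oplus>\<^bsub>?R\<^esub> v \<in> chow_graded N \<Sigma> k" by (rule chow_graded_add[OF uv])
    obtain x y where xy: "x \<in> chow_graded N' \<Sigma>' k" "y \<in> chow_graded N' \<Sigma>' k" "u = \<phi> x" "v = \<phi> y"
      using uv unfolding gr by blast
    have "\<psi> (u \<oplus>\<^bsub>?R\<^esub> v) = \<psi> (\<phi> (x \<oplus>\<^bsub>?R'\<^esub> y))" using cl\<phi>[OF xy(1,2)] xy(3,4) by simp
    then show "\<psi> (u \<oplus>\<^bsub>?R\<^esub> v) = \<psi> u \<oplus>\<^bsub>?R'\<^esub> \<psi> v"
      using \<psi> sub' xy chow_graded_add[OF xy(1,2)] by simp
  qed
  have pair\<psi>: "chow_pairing N' \<Sigma>' d (\<psi> u) (\<psi> v) = chow_pairing N \<Sigma> d u v"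
    if uv: "u \<in> chow_graded N \<Sigma> k" "v \<in> chow_graded N \<Sigma> j" for u v k j
  proof -
    obtain x y where xy: "x \<in> chow_graded N' \<Sigma>' k" "y \<in> chow_graded N' \<Sigma>' j" "u = \<phi> x" "v = \<phi> y"
      using uv unfolding gr by blast
    then show ?thesis using pair[of x y] \<psi> sub' by simp
  qed
  show "poincare_duality N' \<Sigma>' d \<longleftrightarrow> poincare_duality N \<Sigma> d"
    unfolding poincare_duality_def
  proof (intro iffI allI impI)
    fix k assume "\<forall>k\<le>d. perfect_pairing ?R' (chow_graded N' \<Sigma>' k) (chow_graded N' \<Sigma>' (d - k)) (chow_pairing N' \<Sigma>' d)" "k \<le> d"
    then have "perfect_pairing ?R' (chow_graded N' \<Sigma>' k) (chow_graded N' \<Sigma>' (d - k)) (chow_pairing N' \<Sigma>' d)" by blast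
    then show "perfect_pairing ?R (chow_graded N \<Sigma> k) (chow_graded N \<Sigma> (d - k)) (chow_pairing N \<Sigma> d)"
      by (rule perfect_pairing_transfer[OF _ bij\<phi> bij\<phi> cl\<phi> cl\<phi>]) (use pair sub' in auto)
  next
    fix k assume "\<forall>k\<le>d. perfect_pairing ?R (chow_graded N \<Sigma> k) (chow_graded N \<Sigma> (d - k)) (chow_pairing N \<Sigma> d)" "k \<le> d"
    then have "perfect_pairing ?R (chow_graded N \<Sigma> k) (chow_graded N \<Sigma> (d - k)) (chow_pairing N \<Sigma> d)" by blast
    then show "perfect_pairing ?R' (chow_graded N' \<Sigma>' k) (chow_graded N' \<Sigma>' (d - k)) (chow_pairing N' \<Sigma>' d)"
      by (rule perfect_pairing_transfer[OF _ bij\<psi> bij\<psi> cl\<psi> cl\<psi>]) (use pair\<psi> in auto)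
  qed
qed

end

theorem theorem6p8:
  fixes N :: "'a::euclidean_space set"
    and \<Sigma> \<Delta> :: "'a set set"
    and \<Sigma>' :: "('a \<times> real) set set"
    and N' :: "('a \<times> real) set"
    and d :: nat
    and f :: "'a \<Rightarrow> real"
  assumes "is_lattice N"
    and "tropical_fan N \<Sigma> d"
    and "simplicial_fan \<Sigma>"
    and "conewise_integral_linear N \<Sigma> f"
    and "div_reduced N \<Sigma> d f"
    and "\<Delta> = div_subfan N \<Sigma> d f"
    and "\<Sigma>' = trop_modification \<Sigma> \<Delta> f"
    and "N' = N \<times> \<int>"
    and "div_faithful N \<Sigma> d"
  shows "\<exists>\<phi> \<in> ring_iso (chow_ring N' \<Sigma>') (chow_ring N \<Sigma>).
      (\<forall>k. \<phi> ` chow_graded N' \<Sigma>' k = chow_graded N \<Sigma> k) \<and>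
      (unimodular_fan N \<Sigma> \<longrightarrow>
         unimodular_fan N' \<Sigma>' \<and>
         (\<forall>\<alpha>\<in>chow_graded N' \<Sigma>' d. chow_deg N \<Sigma> d (\<phi> \<alpha>) = chow_deg N' \<Sigma>' d \<alpha>) \<and>
         (\<forall>k\<le>d. \<forall>\<alpha>\<in>chow_graded N' \<Sigma>' k. \<forall>\<beta>\<in>chow_graded N' \<Sigma>' (d - k).
            chow_pairing N \<Sigma> d (\<phi> \<alpha>) (\<phi> \<beta>) = chow_pairing N' \<Sigma>' d \<alpha> \<beta>) \<and>
         (poincare_duality N' \<Sigma>' d \<longleftrightarrow> poincare_duality N \<Sigma> d))"
proof -
  interpret M: modification N \<Sigma> d f
    by unfold_locales (use assms in \<open>auto simp: tropical_fan_def\<close>)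
  have eq: "\<Sigma>' = M.\<Sigma>'" "N' = M.N'"
    using assms(6-8) unfolding M.\<Sigma>'_def M.\<Delta>_def M.N'_def by simp_all
  obtain \<phi> where \<phi>: "\<phi> \<in> ring_iso (chow_ring M.N' M.\<Sigma>') (chow_ring N \<Sigma>)"
    "\<And>p. p \<in> mpolys (cones M.\<Sigma>' 1) \<Longrightarrow> \<phi> (chow_class M.N' M.\<Sigma>' p) = chow_class N \<Sigma> (mpoly_subst M.down p)"
    using M.chow_iso by blast
  show ?thesis
    unfolding eq
  proof (rule bexI[OF _ \<phi>(1)], intro conjI allI impI)
    show "\<phi> ` chow_graded M.N' M.\<Sigma>' k = chow_graded N \<Sigma> k" for k by (rule M.graded_image[OF \<phi>(2)])
  next
    assume "unimodular_fan N \<Sigma>"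
    then interpret U: unimodular_modification N \<Sigma> d f by unfold_locales
    show "unimodular_fan M.N' M.\<Sigma>'" by (rule U.unimodular_\<Sigma>')
    show "\<forall>\<alpha>\<in>chow_graded M.N' M.\<Sigma>' d. chow_deg N \<Sigma> d (\<phi> \<alpha>) = chow_deg M.N' M.\<Sigma>' d \<alpha>"
      using U.chow_deg_transport[OF \<phi>] chow_graded_subset by blast
    show "\<forall>\<alpha>\<in>chow_graded M.N' M.\<Sigma>' k. \<forall>\<beta>\<in>chow_graded M.N' M.\<Sigma>' (d - k).
        chow_pairing N \<Sigma> d (\<phi> \<alpha>) (\<phi> \<beta>) = chow_pairing M.N' M.\<Sigma>' d \<alpha> \<beta>" for k
      using U.poincare_transport(1)[OF \<phi>] chow_graded_subset by blast
    show "poincare_duality M.N' M.\<Sigma>' d \<longleftrightarrow> poincare_duality N \<Sigma> d"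
      by (rule U.poincare_transport(2)[OF \<phi>])
  qed
qed

end
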